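(* Let $n>1$ be even. For every $f\in \widetilde{C}^\infty_{0e}(\mathbb{R}^n)$, \[ \int_{\mathbb{R}^n}\frac{|f(x)|^2}{|x_n|}\,dx=\int_{\mathbb{R}^n}\frac{|(\mathcal{U}f)(x',t)|^2}{|t|}\,dx'\,dt . \] Consequently $\mathcal{U}$ extends uniquely to a linear isometry of $L^2_{e,w}(\mathbb{R}^n)$ into itself.
   Context: Points of $\mathbb{R}^n$ are written $x=(x',x_n)$ with $x'\in\mathbb{R}^{n-1}$. $\widetilde{C}^\infty_{e}(\mathbb{R}^n)$ is the set of smooth functions on $\mathbb{R}^n$ that are even in $x_n$ and vanish to infinite order on $\{x_n=0\}$ (all partial derivatives vanish there). $\widetilde{C}^\infty_{0e}(\mathbb{R}^n)$ is the subspace of compactly supported functions in $\widetilde{C}^\infty_{e}(\mathbb{R}^n)$. $L^2_{e,w}(\mathbb{R}^n)$ is the Hilbert space of measurable functions on $\mathbb{R}^n$, even in the last variable, with $\int_{\mathbb{R}^n}|f(x)|^2|x_n|^{-1}dx<\infty$, with the corresponding inner product. For $f\in\widetilde{C}^\infty_{0e}(\mathbb{R}^n)$ let $u$ be the solution of $u_{tt}-\Delta u=0$ on $\mathbb{R}^n\times\mathbb{R}$, $u(x,0)=f(x)$, $u_t(x,0)=0$; define $(\mathcal{U}f)(x',t):=u(x',0,t)$ for $(x',t)\in\mathbb{R}^{n-1}\times\mathbb{R}$, regarded as a function on $\mathbb{R}^n$ (with $t$ as last variable). *)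

theory Defs
  imports "HOL-Analysis.Analysis"
begin

text \<open>Points of R^n are pairs (x', x_n) with x' :: real^'m, so n = CARD('m) + 1.\<close>

definition dd :: "'a::euclidean_space \<Rightarrow> ('a \<Rightarrow> real) \<Rightarrow> 'a \<Rightarrow> real" where
  "dd v g x = frechet_derivative g (at x) v"

definition iter_pd :: "'a::euclidean_space list \<Rightarrow> ('a \<Rightarrow> real) \<Rightarrow> 'a \<Rightarrow> real" where
  "iter_pd vs g = foldr dd vs g"

definition C_inf :: "('a::euclidean_space \<Rightarrow> real) \<Rightarrow> bool" where
  "C_inf g \<longleftrightarrow> (\<forall>vs. set vs \<subseteq> Basis \<longrightarrow> (\<forall>x. iter_pd vs g differentiable at x))"

definition Ctilde0e :: "((real^'m) \<times> real \<Rightarrow> real) set" where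
  "Ctilde0e = {f. C_inf f
      \<and> (\<forall>x' s. f (x', - s) = f (x', s))
      \<and> (\<forall>vs. set vs \<subseteq> Basis \<longrightarrow> (\<forall>x'. iter_pd vs f (x', 0) = 0))
      \<and> compact (closure {x. f x \<noteq> 0})}"

definition wave_sol :: "((real^'m) \<times> real \<Rightarrow> real) \<Rightarrow> (((real^'m) \<times> real) \<times> real \<Rightarrow> real) \<Rightarrow> bool" where
  "wave_sol f u \<longleftrightarrow> C_inf u
      \<and> (\<forall>p. dd (0, 1) (dd (0, 1) u) p - (\<Sum>b\<in>Basis. dd (b, 0) (dd (b, 0) u) p) = 0)
      \<and> (\<forall>x. u (x, 0) = f x)
      \<and> (\<forall>x. dd (0, 1) u (x, 0) = 0)"

definition Uop :: "((real^'m) \<times> real \<Rightarrow> real) \<Rightarrow> ((real^'m) \<times> real \<Rightarrow> real)" where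
  "Uop f = (\<lambda>(x', t). (THE u. wave_sol f u) ((x', 0), t))"

definition wnorm2 :: "((real^'m) \<times> real \<Rightarrow> real) \<Rightarrow> ennreal" where
  "wnorm2 g = (\<integral>\<^sup>+ x. ennreal ((g x)\<^sup>2 / \<bar>snd x\<bar>) \<partial>lborel)"

text \<open>Representatives of L^2_{e,w}(R^n).\<close>
definition L2ew :: "((real^'m) \<times> real \<Rightarrow> real) set" where
  "L2ew = {g. g \<in> borel_measurable lborel \<and> (\<forall>x' s. g (x', - s) = g (x', s)) \<and> wnorm2 g < \<infinity>}"

text \<open>T (acting on representatives) is a linear isometry of L^2_{e,w} into itself
  (well defined on a.e.-classes) extending U from C~^infty_{0e}.\<close>
definition isometric_extension_of_U ::
    "(((real^'m) \<times> real \<Rightarrow> real) \<Rightarrow> ((real^'m) \<times> real \<Rightarrow> real)) \<Rightarrow> bool" where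
  "isometric_extension_of_U T \<longleftrightarrow>
      (\<forall>g\<in>L2ew. T g \<in> L2ew)
    \<and> (\<forall>g\<in>L2ew. \<forall>h\<in>L2ew. (AE x in lborel. g x = h x) \<longrightarrow> (AE x in lborel. T g x = T h x))
    \<and> (\<forall>g\<in>L2ew. \<forall>h\<in>L2ew. \<forall>a b::real.
         AE x in lborel. T (\<lambda>y. a * g y + b * h y) x = a * T g x + b * T h x)
    \<and> (\<forall>g\<in>L2ew. wnorm2 (T g) = wnorm2 g)
    \<and> (\<forall>f\<in>Ctilde0e. AE x in lborel. T f x = Uop f x)"

end

theory Submission
  imports Defs "HOL-Probability.Characteristic_Functions" "HOL-Probability.Sinc_Integral"
begin

text \<open>
  Let \<open>h\<close> be the Fourier transform of \<open>f\<close>. Since \<open>f\<close> is even in the last variable, up to the same constant,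
  \<open>f (x', s) = \<integral> h (\<xi>, \<eta>) cos (s \<eta>) cis (x' \<bullet> \<xi>)\<close> and \<open>Uop f (x', t) = \<integral> h (\<xi>, \<eta>) cos (t sqrt (\<bar>\<xi>\<bar>\<^sup>2 + \<eta>\<^sup>2)) cis (x' \<bullet> \<xi>)\<close>.
  By Plancherel in \<open>x'\<close> it suffices to compare, for almost every fixed \<open>\<xi>\<close> and \<open>H = h (\<xi>, _)\<close>, the integrals of
  \<open>\<bar>B t\<bar>\<^sup>2 / \<bar>t\<bar>\<close> for \<open>B t = \<integral> H \<eta> cos (t p(\<eta>)) d\<eta>\<close> with \<open>p(\<eta>) = \<eta>\<close> and with \<open>p(\<eta>) = sqrt (\<bar>\<xi>\<bar>\<^sup>2 + \<eta>\<^sup>2)\<close>.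
  Here \<open>\<integral> H = 0\<close> because \<open>f\<close> vanishes on \<open>x\<^sub>n = 0\<close>, so a Frullani integral turns both into
  \<open>- \<integral>\<integral> H \<eta> cnj (H \<eta>') ln \<bar>p(\<eta>)\<^sup>2 - p(\<eta>')\<^sup>2\<bar>\<close> (formally; a factor \<open>exp (- \<epsilon> \<bar>t\<bar>)\<close> makes this precise), and
  \<open>p(\<eta>)\<^sup>2 - p(\<eta>')\<^sup>2 = \<eta>\<^sup>2 - \<eta>'\<^sup>2\<close> in both cases.
\<close>

section \<open>Gaussian integrals, Fourier inversion and the Plancherel identity\<close>

text \<open>The weight 1/|t| is not integrable at 0, so |B t|^2 / |t| cannot be expanded into a
  double integral term by term. As H has integral 0, cos(t p) cos(t p') may be replaced by cos(t p)
  cos(t p') - 1, whose zero at t = 0 absorbs the singularity. For eps > 0 the two kernels do not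
  coincide: the arguments of their logarithms differ by 4 |xi|^2 / eps^2. The difference of the
  kernels tends to 0 off the diagonals, and its bound |xi| / sqrt(|eta| |eta'|), uniform in eps,
  lets the limit pass under the double integral. The energies are nonnegative extended integrals, so
  their finiteness is never presupposed. Two further obstacles shape the development.
  \<open>Uop\<close> is defined by a definite description, so the wave equation needs a uniqueness
  proof; it uses an energy localised to a smoothed cone. The extension acts on representatives, so
  limits must be realised as actual functions; sequences with a geometric rate provide them as
  pointwise limits.\<close>

lemma measurable_cis [measurable (raw)]:
  "f \<in> borel_measurable M \<Longrightarrow> (\<lambda>x. cis (f x)) \<in> borel_measurable M"
  by (rule borel_measurable_continuous_on[of cis]) (auto intro: continuous_intros)

lemma measurable_cnj [measurable (raw)]:
  "f \<in> borel_measurable M \<Longrightarrow> (\<lambda>x. cnj (f x)) \<in> borel_measurable M"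
  by (rule borel_measurable_continuous_on[of cnj]) (auto intro: continuous_intros)

lemma lborel_integrable_affine:
  fixes f :: "'a::euclidean_space \<Rightarrow> 'b::{banach,second_countable_topology}"
  assumes "c \<noteq> 0" "integrable lborel f"
  shows "integrable lborel (\<lambda>x. f (t + c *\<^sub>R x))"
proof -
  have "integrable (density (distr lborel borel (\<lambda>x. t + c *\<^sub>R x)) (\<lambda>_. \<bar>c\<bar>^DIM('a))) f"
    using assms(2) lborel_affine[OF assms(1), of t] by simp
  then have "integrable lborel (\<lambda>x. inverse (\<bar>c\<bar> ^ DIM('a)) *\<^sub>R (\<bar>c\<bar> ^ DIM('a) *\<^sub>R f (t + c *\<^sub>R x)))"
    using assms(1) borel_measurable_integrable[OF assms(2)]
    by (simp add: integrable_density integrable_distr_eq del: scaleR_scaleR)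
  then show ?thesis
    using assms(1) by simp
qed

lemma lborel_integral_affine:
  fixes f :: "'a::euclidean_space \<Rightarrow> 'b::{banach,second_countable_topology}"
  assumes c: "c \<noteq> 0" and f: "f \<in> borel_measurable borel"
  shows "(\<integral>x. f x \<partial>lborel) = \<bar>c\<bar>^DIM('a) *\<^sub>R (\<integral>x. f (t + c *\<^sub>R x) \<partial>lborel)"
  using f
  by (subst lborel_affine[OF c, of t]) (simp add: integral_density integral_distr)

text \<open>On a Euclidean space \<open>lborel\<close> is the image of the product of the
  one-dimensional Lebesgue measures over \<open>Basis\<close>, so integrals of functions that factor
  over the coordinates factor too. Both the Gaussian and the decay majorant are treated in this
  way.\<close>

lemma
  fixes g :: "'a::euclidean_space \<Rightarrow> real \<Rightarrow> 'b::{real_normed_field,banach,second_countable_topology}"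
  assumes "\<And>b. b \<in> Basis \<Longrightarrow> integrable lborel (g b)"
  shows lborel_integrable_prod_Basis: "integrable lborel (\<lambda>x::'a. \<Prod>b\<in>Basis. g b (x \<bullet> b))"
    and lborel_integral_prod_Basis: "(\<integral>x. (\<Prod>b\<in>Basis. g b (x \<bullet> b)) \<partial>lborel) = (\<Prod>b\<in>Basis. \<integral>s. g b s \<partial>lborel)"
proof -
  interpret product_sigma_finite "\<lambda>b::'a. lborel :: real measure" ..
  have m: "(\<lambda>x::'a. \<Prod>b\<in>Basis. g b (x \<bullet> b)) \<in> borel_measurable borel"
    using assms[THEN borel_measurable_integrable] by measurable
  have T: "(\<lambda>f. \<Sum>b\<in>Basis. f b *\<^sub>R b) \<in> measurable (\<Pi>\<^sub>M b\<in>(Basis::'a set). lborel) borel"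
    by measurable
  have e: "(\<Prod>b\<in>Basis. g b ((\<Sum>b\<in>Basis. f b *\<^sub>R b) \<bullet> b)) = (\<Prod>b\<in>Basis. g b (f b))" for f
    by (intro prod.cong) auto
  show "integrable lborel (\<lambda>x::'a. \<Prod>b\<in>Basis. g b (x \<bullet> b))"
    by (subst lborel_eq, subst integrable_distr_eq[OF T m]) (unfold e, intro product_integrable_prod assms finite_Basis)
  show "(\<integral>x. (\<Prod>b\<in>Basis. g b (x \<bullet> b)) \<partial>lborel) = (\<Prod>b\<in>Basis. \<integral>s. g b s \<partial>lborel)"
    by (subst lborel_eq, subst integral_distr[OF T m]) (unfold e, intro product_integral_prod assms finite_Basis)
qed

section \<open>Gaussian integrals in one and several dimensions\<close>

lemma
  fixes w :: real
  shows gaussian_integrable_1d: "integrable lborel (\<lambda>x::real. cis (w * x) * of_real (exp (- x\<^sup>2 / 2)))"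
    and gaussian_integral_1d: "(\<integral>x. cis (w * x) * of_real (exp (- x\<^sup>2 / 2)) \<partial>lborel) = of_real (sqrt (2 * pi) * exp (- w\<^sup>2 / 2))"
proof -
  interpret real_distribution std_normal_distribution
    by (rule real_dist_normal_dist)
  \<comment> \<open>Up to the factor sqrt(2 pi) this is the integrand of the characteristic function
    of the standard normal law, whose value is known.\<close>
  have *: "cis (w * x) * of_real (exp (- x\<^sup>2 / 2)) = of_real (sqrt (2 * pi)) * (std_normal_density x *\<^sub>R iexp (w * x))" for x
    by (simp add: std_normal_density_def cis_conv_exp scaleR_conv_of_real)
  have i: "integrable std_normal_distribution (\<lambda>x. iexp (w * x))"
    by (intro integrable_const_bound[where B=1]) auto
  then have i': "integrable lborel (\<lambda>x. std_normal_density x *\<^sub>R iexp (w * x))"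
    by (subst (asm) integrable_density) auto
  show "integrable lborel (\<lambda>x::real. cis (w * x) * of_real (exp (- x\<^sup>2 / 2)))"
    unfolding * using i' by (rule integrable_mult_right)
  have "of_real (exp (- w\<^sup>2 / 2)) = (CLINT x|std_normal_distribution. iexp (w * x))"
    using char_std_normal_distribution[THEN fun_cong, of w] by (simp add: char_def)
  also have "\<dots> = (\<integral>x. std_normal_density x *\<^sub>R iexp (w * x) \<partial>lborel)"
    by (subst integral_density) auto
  finally show "(\<integral>x. cis (w * x) * of_real (exp (- x\<^sup>2 / 2)) \<partial>lborel) = of_real (sqrt (2 * pi) * exp (- w\<^sup>2 / 2))"
    unfolding * by (subst integral_mult_right_zero) simp
qed

lemma norm_sq_Basis: "(norm (x::'a::euclidean_space))\<^sup>2 = (\<Sum>b\<in>Basis. (x \<bullet> b)\<^sup>2)"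
  by (subst power2_norm_eq_inner, subst euclidean_inner) (simp add: power2_eq_square)

lemma cis_inner_prod_Basis: "cis (w \<bullet> (x::'a::euclidean_space)) = (\<Prod>b\<in>Basis. cis ((w \<bullet> b) * (x \<bullet> b)))"
proof -
  have "cis (sum f A) = (\<Prod>a\<in>A. cis (f a))" if "finite A" for f and A :: "'a set"
    using that by induction (auto simp: cis_mult[symmetric])
  then show ?thesis
    by (simp add: euclidean_inner[of w x])
qed

lemma gaussian_prod_Basis:
  "cis (w \<bullet> x) * of_real (exp (- (norm (x::'a::euclidean_space))\<^sup>2 / 2))
    = (\<Prod>b\<in>Basis. cis ((w \<bullet> b) * (x \<bullet> b)) * of_real (exp (- (x \<bullet> b)\<^sup>2 / 2)))"
proof -
  have "- (norm x)\<^sup>2 / 2 = (\<Sum>b\<in>Basis. - (x \<bullet> b)\<^sup>2 / 2)"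
    by (simp add: norm_sq_Basis sum_negf sum_divide_distrib)
  then show ?thesis
    by (simp add: prod.distrib cis_inner_prod_Basis[of w x] exp_sum)
qed

lemma gaussian_integrable:
  "integrable lborel (\<lambda>x::'a::euclidean_space. cis (w \<bullet> x) * of_real (exp (- (norm x)\<^sup>2 / 2)))"
  unfolding gaussian_prod_Basis by (intro lborel_integrable_prod_Basis gaussian_integrable_1d)

lemma gaussian_integral:
  "(\<integral>x. cis (w \<bullet> x) * of_real (exp (- (norm x)\<^sup>2 / 2)) \<partial>lborel)
     = of_real (sqrt (2 * pi) ^ DIM('a) * exp (- (norm (w::'a::euclidean_space))\<^sup>2 / 2))"
proof -
  have "- (norm w)\<^sup>2 / 2 = (\<Sum>b\<in>Basis. - (w \<bullet> b)\<^sup>2 / 2)"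
    by (simp add: norm_sq_Basis sum_negf sum_divide_distrib)
  then show ?thesis
    unfolding gaussian_prod_Basis
    by (subst lborel_integral_prod_Basis)
       (simp_all only: gaussian_integral_1d gaussian_integrable_1d prod.distrib exp_sum finite_Basis of_real_prod of_real_mult prod_constant of_real_power)
qed

lemma integrable_gaussian_real:
  "integrable lborel (\<lambda>x::'a::euclidean_space. exp (- (norm x)\<^sup>2 / 2))"
proof -
  have "integrable lborel (\<lambda>x::'a. norm (cis (0 \<bullet> x) * of_real (exp (- (norm x)\<^sup>2 / 2))))"
    by (intro integrable_norm gaussian_integrable)
  then show ?thesis by simp
qed

lemma integral_gaussian_real:
  "(\<integral>x. exp (- (norm (x::'a::euclidean_space))\<^sup>2 / 2) \<partial>lborel) = sqrt (2 * pi) ^ DIM('a)"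
proof -
  have "complex_of_real (\<integral>x. exp (- (norm (x::'a))\<^sup>2 / 2) \<partial>lborel) = of_real (sqrt (2 * pi) ^ DIM('a))"
    using gaussian_integral[of "0::'a"] by (simp flip: integral_complex_of_real)
  then show ?thesis
    using of_real_eq_iff by blast
qed

lemma
  fixes w :: "'a::euclidean_space"
  assumes e: "e > 0"
  shows gaussian_scaled_integrable: "integrable lborel (\<lambda>x::'a. cis (w \<bullet> x) * of_real (exp (- e\<^sup>2 * (norm x)\<^sup>2 / 2)))"
    and gaussian_scaled_integral: "(\<integral>x. cis (w \<bullet> x) * of_real (exp (- e\<^sup>2 * (norm x)\<^sup>2 / 2)) \<partial>lborel)
     = of_real ((sqrt (2 * pi) / e) ^ DIM('a) * exp (- (norm w)\<^sup>2 / (2 * e\<^sup>2)))"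
proof -
  let ?g = "\<lambda>x::'a. cis ((w /\<^sub>R e) \<bullet> x) * of_real (exp (- (norm x)\<^sup>2 / 2)) :: complex"
  have *: "cis (w \<bullet> x) * of_real (exp (- e\<^sup>2 * (norm x)\<^sup>2 / 2)) = ?g (0 + e *\<^sub>R x)" for x
    using e by (simp add: power_mult_distrib field_simps)
  show "integrable lborel (\<lambda>x::'a. cis (w \<bullet> x) * of_real (exp (- e\<^sup>2 * (norm x)\<^sup>2 / 2)))"
    unfolding * using e by (intro lborel_integrable_affine gaussian_integrable) auto
  have "of_real (sqrt (2 * pi) ^ DIM('a) * exp (- (norm (w /\<^sub>R e))\<^sup>2 / 2)) = (\<integral>x. ?g x \<partial>lborel)"
    by (rule gaussian_integral[symmetric])
  also have "\<dots> = \<bar>e\<bar>^DIM('a) *\<^sub>R (\<integral>x. ?g (0 + e *\<^sub>R x) \<partial>lborel)"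
    using e by (intro lborel_integral_affine) auto
  finally have 1: "of_real (sqrt (2 * pi) ^ DIM('a) * exp (- (norm (w /\<^sub>R e))\<^sup>2 / 2))
      = e^DIM('a) *\<^sub>R (\<integral>x. ?g (0 + e *\<^sub>R x) \<partial>lborel)"
    using e by simp
  have "- (norm (w /\<^sub>R e))\<^sup>2 / 2 = - (norm w)\<^sup>2 / (2 * e\<^sup>2)"
    using e by (simp add: power_mult_distrib field_simps)
  then have 3: "e^DIM('a) *\<^sub>R (\<integral>x. ?g (0 + e *\<^sub>R x) \<partial>lborel)
      = of_real (sqrt (2 * pi) ^ DIM('a) * exp (- (norm w)\<^sup>2 / (2 * e\<^sup>2)))"
    using 1 by (simp only:)
  have "(\<integral>x. ?g (0 + e *\<^sub>R x) \<partial>lborel) = (e^DIM('a) *\<^sub>R (\<integral>x. ?g (0 + e *\<^sub>R x) \<partial>lborel)) /\<^sub>R e^DIM('a)"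
    using e by simp
  then have 2: "(\<integral>x. ?g (0 + e *\<^sub>R x) \<partial>lborel)
      = of_real (sqrt (2 * pi) ^ DIM('a) * exp (- (norm w)\<^sup>2 / (2 * e\<^sup>2))) /\<^sub>R e^DIM('a)"
    unfolding 3 .
  show "(\<integral>x. cis (w \<bullet> x) * of_real (exp (- e\<^sup>2 * (norm x)\<^sup>2 / 2)) \<partial>lborel)
     = of_real ((sqrt (2 * pi) / e) ^ DIM('a) * exp (- (norm w)\<^sup>2 / (2 * e\<^sup>2)))"
    unfolding * 2 by (simp only: scaleR_conv_of_real of_real_mult[symmetric] power_divide divide_inverse power_mult_distrib power_inverse mult_ac)
qed

text \<open>Each coordinate satisfies 1 + x_b^2 \<le> 1 + |x|^2, so the function is at most the
  product of the 1 / (1 + x_b^2). The exponent is the full dimension because one factor is spent on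
  each coordinate.\<close>

lemma integrable_decay:
  "integrable lborel (\<lambda>x::'a::euclidean_space. 1 / (1 + (norm x)\<^sup>2) ^ DIM('a))"
proof (rule Bochner_Integration.integrable_bound)
  have "integrable lborel (\<lambda>s::real. inverse (1 + s\<^sup>2))"
    using integrable_inverse_1_plus_square by (simp add: set_integrable_def einterval_def)
  then show "integrable lborel (\<lambda>x::'a. \<Prod>b\<in>Basis. inverse (1 + (x \<bullet> b)\<^sup>2))"
    by (intro lborel_integrable_prod_Basis)
  have "1 / (1 + (norm x)\<^sup>2) ^ DIM('a) \<le> (\<Prod>b\<in>Basis. inverse (1 + (x \<bullet> b)\<^sup>2))" for x :: 'a
  proof -
    have "(\<Prod>b\<in>Basis. 1 + (x \<bullet> b)\<^sup>2) \<le> (\<Prod>b\<in>(Basis::'a set). 1 + (norm x)\<^sup>2)"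
      by (intro prod_mono) (auto simp: norm_sq_Basis intro: member_le_sum[of _ Basis "\<lambda>b. (x \<bullet> b)\<^sup>2"])
    then have "(\<Prod>b\<in>Basis. 1 + (x \<bullet> b)\<^sup>2) \<le> (1 + (norm x)\<^sup>2) ^ DIM('a)" by simp
    moreover have "(\<Prod>b\<in>Basis. 1 + (x \<bullet> b)\<^sup>2) > 0"
      by (intro prod_pos) (auto simp: add_pos_nonneg)
    ultimately have "inverse ((1 + (norm x)\<^sup>2) ^ DIM('a)) \<le> inverse (\<Prod>b\<in>Basis. 1 + (x \<bullet> b)\<^sup>2)"
      by (rule le_imp_inverse_le)
    then show ?thesis
      by (simp add: prod_inversef[symmetric] divide_inverse o_def)
  qed
  moreover have "0 \<le> (\<Prod>b\<in>Basis. inverse (1 + (x \<bullet> b)\<^sup>2))" for x :: 'a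
    by (intro prod_nonneg) auto
  ultimately show "AE x in lborel. norm (1 / (1 + (norm x)\<^sup>2) ^ DIM('a)) \<le> norm (\<Prod>b\<in>Basis. inverse (1 + ((x::'a) \<bullet> b)\<^sup>2))"
    by (auto simp: abs_of_nonneg)
qed measurable

text \<open>A majorant in tensor form reduces joint integrability to two functions of separate
  variables. The exchanges of Bochner integrals below rest on this criterion.\<close>

lemma integrable_pair_bound:
  fixes K :: "'a::euclidean_space \<Rightarrow> 'b::euclidean_space \<Rightarrow> 'c::{banach,second_countable_topology}"
    and F :: "'a \<Rightarrow> 'd::{banach,second_countable_topology}" and G :: "'b \<Rightarrow> 'e::{banach,second_countable_topology}"
  assumes F: "integrable lborel F" and G: "integrable lborel G"
    and [measurable]: "(\<lambda>(x, y). K x y) \<in> borel_measurable (borel \<Otimes>\<^sub>M borel)"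
    and b: "\<And>x y. norm (K x y) \<le> norm (F x) * norm (G y)"
  shows "integrable (lborel \<Otimes>\<^sub>M lborel) (\<lambda>(x, y). K x y)"
proof (rule lborel_pair.Fubini_integrable)
  have K1: "integrable lborel (\<lambda>y. K x y)" for x
    by (rule Bochner_Integration.integrable_bound[OF integrable_mult_right[OF integrable_norm[OF G], of "norm (F x)"]])
       (use b in auto)
  then show "AE x in lborel. integrable lborel (\<lambda>y. case (x, y) of (x, y) \<Rightarrow> K x y)"
    by simp
  show "integrable lborel (\<lambda>x. \<integral>y. norm (case (x, y) of (x, y) \<Rightarrow> K x y) \<partial>lborel)"
  proof (rule Bochner_Integration.integrable_bound)
    show "integrable lborel (\<lambda>x. norm (F x) * (\<integral>y. norm (G y) \<partial>lborel))"
      using F by simp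
    have "(\<integral>y. norm (K x y) \<partial>lborel) \<le> norm (F x) * (\<integral>y. norm (G y) \<partial>lborel)" for x
    proof -
      have "(\<integral>y. norm (K x y) \<partial>lborel) \<le> (\<integral>y. norm (F x) * norm (G y) \<partial>lborel)"
        using K1 G b by (intro integral_mono) auto
      then show ?thesis by simp
    qed
    then show "AE x in lborel. norm (\<integral>y. norm (case (x, y) of (x, y) \<Rightarrow> K x y) \<partial>lborel)
        \<le> norm (norm (F x) * (\<integral>y. norm (G y) \<partial>lborel))"
      by (auto intro!: AE_I2 simp: abs_mult abs_of_nonneg)
  qed measurable
qed measurable

section \<open>The Fourier transform: inversion and Plancherel identity\<close>

definition FT :: "('a::euclidean_space \<Rightarrow> complex) \<Rightarrow> 'a \<Rightarrow> complex" where
  "FT f \<xi> = (\<integral>x. f x * cis (- (x \<bullet> \<xi>)) \<partial>lborel)"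

abbreviation FTR :: "('a::euclidean_space \<Rightarrow> real) \<Rightarrow> 'a \<Rightarrow> complex" where
  "FTR f \<equiv> FT (\<lambda>x. complex_of_real (f x))"

lemma integrable_mult_cis:
  fixes f :: "'a::euclidean_space \<Rightarrow> complex"
  assumes "integrable lborel f" "g \<in> borel_measurable borel"
  shows "integrable lborel (\<lambda>x. f x * cis (g x))"
  by (rule Bochner_Integration.integrable_bound[OF assms(1)])
     (use assms borel_measurable_integrable[OF assms(1)] in \<open>auto simp: norm_mult\<close>)

lemma FT_measurable [measurable]:
  assumes [measurable]: "f \<in> borel_measurable borel"
  shows "FT f \<in> borel_measurable borel"
  unfolding FT_def[abs_def] by measurable

lemma norm_FT_le:
  shows "norm (FT f \<xi>) \<le> (\<integral>x. norm (f x) \<partial>lborel)"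
  using integral_norm_bound[of lborel "\<lambda>x. f x * cis (- (x \<bullet> \<xi>))"] by (simp add: FT_def norm_mult)

text \<open>The Gaussian weight makes the double integral over y and \<xi> absolutely convergent.
  After Fubini the inner integral is the transform of a Gaussian, and the substitution y = x + e z
  turns the result into a Gaussian average of f around x. The powers of e from the transform and
  from the substitution cancel.\<close>

lemma gaussian_mollified_inversion:
  fixes f :: "'a::euclidean_space \<Rightarrow> complex"
  assumes f: "integrable lborel f" and e: "e > 0"
  shows "(\<integral>\<xi>. FT f \<xi> * (cis (x \<bullet> \<xi>) * of_real (exp (- e\<^sup>2 * (norm \<xi>)\<^sup>2 / 2))) \<partial>lborel)
    = of_real (sqrt (2 * pi) ^ DIM('a)) * (\<integral>z. f (x + e *\<^sub>R z) * of_real (exp (- (norm z)\<^sup>2 / 2)) \<partial>lborel)"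
proof -
  have [measurable]: "f \<in> borel_measurable borel" using f by auto
  let ?w = "\<lambda>\<xi>::'a. of_real (exp (- e\<^sup>2 * (norm \<xi>)\<^sup>2 / 2)) :: complex"
  let ?D = "DIM('a)"
  have c: "cis ((x - y) \<bullet> \<xi>) = cis (- (y \<bullet> \<xi>)) * cis (x \<bullet> \<xi>)" for y \<xi> :: 'a
    by (simp add: cis_mult inner_diff_left)
  have w: "integrable lborel ?w"
    using gaussian_scaled_integrable[OF e, of "0::'a"] by simp
  have "(\<integral>\<xi>. FT f \<xi> * (cis (x \<bullet> \<xi>) * ?w \<xi>) \<partial>lborel)
      = (\<integral>\<xi>. (\<integral>y. f y * (cis ((x - y) \<bullet> \<xi>) * ?w \<xi>) \<partial>lborel) \<partial>lborel)"
    unfolding FT_def by (subst integral_mult_left_zero[symmetric]) (simp only: c mult_ac)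
  also have "\<dots> = (\<integral>y. (\<integral>\<xi>. f y * (cis ((x - y) \<bullet> \<xi>) * ?w \<xi>) \<partial>lborel) \<partial>lborel)"
    by (rule lborel_pair.Fubini_integral[symmetric], rule integrable_pair_bound[OF w f])
       (auto simp: norm_mult)
  also have "\<dots> = (\<integral>y. f y * of_real ((sqrt (2 * pi) / e) ^ ?D * exp (- (norm (x - y))\<^sup>2 / (2 * e\<^sup>2))) \<partial>lborel)"
    by (simp only: integral_mult_right_zero gaussian_scaled_integral[OF e])
  also have "\<dots> = \<bar>e\<bar>^?D *\<^sub>R (\<integral>z. f (x + e *\<^sub>R z) * of_real ((sqrt (2 * pi) / e) ^ ?D * exp (- (norm (x - (x + e *\<^sub>R z)))\<^sup>2 / (2 * e\<^sup>2))) \<partial>lborel)"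
    using e by (intro lborel_integral_affine) auto
  also have "\<dots> = \<bar>e\<bar>^?D *\<^sub>R (\<integral>z. of_real ((sqrt (2 * pi) / e) ^ ?D) * (f (x + e *\<^sub>R z) * of_real (exp (- (norm z)\<^sup>2 / 2))) \<partial>lborel)"
    using e by (simp add: power_mult_distrib mult_ac)
  also have "\<dots> = of_real (\<bar>e\<bar>^?D * (sqrt (2 * pi) / e) ^ ?D) * (\<integral>z. f (x + e *\<^sub>R z) * of_real (exp (- (norm z)\<^sup>2 / 2)) \<partial>lborel)"
    by (simp only: integral_mult_right_zero scaleR_conv_of_real of_real_mult mult.assoc)
  also have "\<bar>e\<bar>^?D * (sqrt (2 * pi) / e) ^ ?D = sqrt (2 * pi) ^ ?D"
    using e by (simp add: power_divide)
  finally show ?thesis .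
qed

lemma gaussian_mollifier_bound:
  fixes f :: "'a::euclidean_space \<Rightarrow> complex"
  assumes [measurable]: "f \<in> borel_measurable borel" and B: "\<And>x. norm (f x) \<le> B"
  shows "norm (\<integral>z. f (x + e *\<^sub>R z) * of_real (exp (- (norm z)\<^sup>2 / 2)) \<partial>lborel) \<le> B * sqrt (2 * pi) ^ DIM('a)"
proof -
  have "norm (\<integral>z. f (x + e *\<^sub>R z) * of_real (exp (- (norm z)\<^sup>2 / 2)) \<partial>lborel)
      \<le> (\<integral>z. norm (f (x + e *\<^sub>R z) * of_real (exp (- (norm z)\<^sup>2 / 2))) \<partial>lborel)"
    by (rule integral_norm_bound)
  also have "\<dots> \<le> (\<integral>z. B * exp (- (norm (z::'a))\<^sup>2 / 2) \<partial>lborel)"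
  proof (rule integral_mono)
    show "integrable lborel (\<lambda>z::'a. B * exp (- (norm z)\<^sup>2 / 2))"
      using integrable_gaussian_real by (rule integrable_mult_right)
    then show "integrable lborel (\<lambda>z. norm (f (x + e *\<^sub>R z) * of_real (exp (- (norm z)\<^sup>2 / 2))))"
      by (rule Bochner_Integration.integrable_bound)
         (auto simp: norm_mult intro!: AE_I2 order_trans[OF mult_right_mono[OF B] abs_ge_self])
  qed (auto simp: norm_mult intro!: mult_right_mono B)
  also have "\<dots> = B * sqrt (2 * pi) ^ DIM('a)"
    by (simp only: integral_mult_right_zero integral_gaussian_real)
  finally show ?thesis .
qed

lemma gaussian_mollifier_tendsto:
  fixes f :: "'a::euclidean_space \<Rightarrow> complex"
  assumes f: "continuous_on UNIV f" and B: "\<And>x. norm (f x) \<le> B" and e: "e \<longlonglongrightarrow> (0::real)"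
  shows "(\<lambda>k. \<integral>z. f (x + e k *\<^sub>R z) * of_real (exp (- (norm z)\<^sup>2 / 2)) \<partial>lborel)
     \<longlonglongrightarrow> f x * of_real (sqrt (2 * pi) ^ DIM('a))"
proof -
  have [measurable]: "f \<in> borel_measurable borel"
    using f by (rule borel_measurable_continuous_onI)
  have "(\<lambda>k. \<integral>z. f (x + e k *\<^sub>R z) * of_real (exp (- (norm z)\<^sup>2 / 2)) \<partial>lborel)
     \<longlonglongrightarrow> (\<integral>z. f x * of_real (exp (- (norm (z::'a))\<^sup>2 / 2)) \<partial>lborel)"
  proof (rule integral_dominated_convergence)
    show "integrable lborel (\<lambda>z::'a. B * exp (- (norm z)\<^sup>2 / 2))"
      using integrable_gaussian_real by (rule integrable_mult_right)
    show "AE z in lborel. norm (f (x + e k *\<^sub>R z) * of_real (exp (- (norm z)\<^sup>2 / 2))) \<le> B * exp (- (norm z)\<^sup>2 / 2)" for k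
      using B by (auto simp: norm_mult intro!: mult_right_mono)
    have "(\<lambda>k. f (x + e k *\<^sub>R z)) \<longlonglongrightarrow> f x" for z
      by (rule continuous_on_tendsto_compose[OF f]) (auto intro!: tendsto_eq_intros e)
    then show "AE z in lborel. (\<lambda>k. f (x + e k *\<^sub>R z) * of_real (exp (- (norm z)\<^sup>2 / 2)))
        \<longlonglongrightarrow> f x * of_real (exp (- (norm z)\<^sup>2 / 2))"
      by (auto intro!: tendsto_intros)
  qed measurable
  also have "(\<integral>z. f x * of_real (exp (- (norm (z::'a))\<^sup>2 / 2)) \<partial>lborel) = f x * of_real (sqrt (2 * pi) ^ DIM('a))"
    using integral_gaussian_real[where 'a='a] by (simp only: integral_mult_right_zero integral_complex_of_real)
  finally show ?thesis .
qed

lemma sqrt_two_pi_square: "sqrt (2 * pi) ^ n * sqrt (2 * pi) ^ n = (2 * pi) ^ n"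
  by (subst power_mult_distrib[symmetric]) simp

lemma inverse_Suc_tendsto_0: "(\<lambda>k. 1 / real (Suc k)) \<longlonglongrightarrow> 0"
  using LIMSEQ_inverse_real_of_nat by (simp add: divide_inverse)

text \<open>\<open>FT\<close> is unnormalised, and the constant (2 pi)^n is the product of two
  factors sqrt(2 pi)^n: one from the mollified inversion formula, one from the total mass of the
  Gaussian. As the width tends to 0, the frequency side of that formula converges by integrability
  of \<open>FT f\<close>, the other side by continuity and boundedness of f.\<close>

theorem fourier_inversion:
  fixes f :: "'a::euclidean_space \<Rightarrow> complex"
  assumes f: "integrable lborel f" "continuous_on UNIV f" and B: "\<And>x. norm (f x) \<le> B"
    and F: "integrable lborel (FT f)"
  shows "(\<integral>\<xi>. FT f \<xi> * cis (x \<bullet> \<xi>) \<partial>lborel) = of_real ((2 * pi) ^ DIM('a)) * f x"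
proof (rule LIMSEQ_unique)
  let ?e = "\<lambda>k. 1 / real (Suc k)"
  let ?I = "\<lambda>k. \<integral>\<xi>. FT f \<xi> * (cis (x \<bullet> \<xi>) * of_real (exp (- (?e k)\<^sup>2 * (norm \<xi>)\<^sup>2 / 2))) \<partial>lborel"
  have [measurable]: "f \<in> borel_measurable borel" using f by auto
  show "?I \<longlonglongrightarrow> (\<integral>\<xi>. FT f \<xi> * cis (x \<bullet> \<xi>) \<partial>lborel)"
  proof (rule integral_dominated_convergence)
    show "integrable lborel (\<lambda>\<xi>. norm (FT f \<xi>))" using F by simp
    have "(\<lambda>k. exp (- (?e k)\<^sup>2 * (norm \<xi>)\<^sup>2 / 2)) \<longlonglongrightarrow> 1" for \<xi> :: 'a
      by (rule tendsto_eq_intros inverse_Suc_tendsto_0 refl | simp)+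
    then have "(\<lambda>k. FT f \<xi> * (cis (x \<bullet> \<xi>) * of_real (exp (- (?e k)\<^sup>2 * (norm \<xi>)\<^sup>2 / 2))))
        \<longlonglongrightarrow> FT f \<xi> * (cis (x \<bullet> \<xi>) * of_real 1)" for \<xi>
      by (intro tendsto_intros)
    then show "AE \<xi> in lborel. (\<lambda>k. FT f \<xi> * (cis (x \<bullet> \<xi>) * of_real (exp (- (?e k)\<^sup>2 * (norm \<xi>)\<^sup>2 / 2))))
        \<longlonglongrightarrow> FT f \<xi> * cis (x \<bullet> \<xi>)"
      by simp
    show "AE \<xi> in lborel. norm (FT f \<xi> * (cis (x \<bullet> \<xi>) * of_real (exp (- (?e k)\<^sup>2 * (norm \<xi>)\<^sup>2 / 2)))) \<le> norm (FT f \<xi>)" for k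
      by (auto simp: norm_mult intro!: mult_left_le)
  qed measurable
  have "(\<lambda>k. of_real (sqrt (2 * pi) ^ DIM('a)) * (\<integral>z. f (x + ?e k *\<^sub>R z) * of_real (exp (- (norm z)\<^sup>2 / 2)) \<partial>lborel))
     \<longlonglongrightarrow> of_real (sqrt (2 * pi) ^ DIM('a)) * (f x * of_real (sqrt (2 * pi) ^ DIM('a)))"
    by (intro tendsto_intros gaussian_mollifier_tendsto[OF f(2) B inverse_Suc_tendsto_0])
  also have "(\<lambda>k. of_real (sqrt (2 * pi) ^ DIM('a)) * (\<integral>z. f (x + ?e k *\<^sub>R z) * of_real (exp (- (norm z)\<^sup>2 / 2)) \<partial>lborel)) = ?I"
    by (rule ext, rule gaussian_mollified_inversion[OF f(1), symmetric]) simp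
  also have "of_real (sqrt (2 * pi) ^ DIM('a)) * (f x * of_real (sqrt (2 * pi) ^ DIM('a))) = of_real ((2 * pi) ^ DIM('a)) * f x"
    unfolding sqrt_two_pi_square[symmetric] by simp
  finally show "?I \<longlonglongrightarrow> of_real ((2 * pi) ^ DIM('a)) * f x" .
qed

text \<open>The formulation with nonnegative integrals makes square integrability of the transform a
  consequence instead of a premise. The squared modulus of the transform, integrated against a
  Gaussian, equals a pairing of a with a Gaussian average of its conjugate, and the width of the
  Gaussian average then tends to 0.\<close>

theorem plancherel:
  fixes a :: "'a::euclidean_space \<Rightarrow> complex"
  assumes a: "integrable lborel a" "continuous_on UNIV a" and B: "\<And>x. norm (a x) \<le> B"
  shows "(\<integral>\<^sup>+x. ennreal ((norm (\<integral>\<xi>. a \<xi> * cis (x \<bullet> \<xi>) \<partial>lborel))\<^sup>2) \<partial>lborel)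
    = ennreal ((2 * pi) ^ DIM('a)) * (\<integral>\<^sup>+\<xi>. ennreal ((norm (a \<xi>))\<^sup>2) \<partial>lborel)"
proof -
  define A where "A x = (\<integral>\<xi>. a \<xi> * cis (x \<bullet> \<xi>) \<partial>lborel)" for x
  let ?e = "\<lambda>k. 1 / real (Suc k)"
  let ?w = "\<lambda>k x::'a. exp (- (?e k)\<^sup>2 * (norm x)\<^sup>2 / 2)"
  let ?M = "\<lambda>k \<xi>. \<integral>z. cnj (a (\<xi> + ?e k *\<^sub>R z)) * of_real (exp (- (norm z)\<^sup>2 / 2)) \<partial>lborel"
  let ?s = "sqrt (2 * pi) ^ DIM('a)"
  have [measurable]: "a \<in> borel_measurable borel" using a by auto
  have B0: "0 \<le> B" using B[of 0] norm_ge_zero order_trans by blast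
  have [measurable]: "A \<in> borel_measurable borel"
    unfolding A_def[abs_def] by measurable
  have cA: "cnj (A x) = FT (\<lambda>\<xi>. cnj (a \<xi>)) x" for x
    unfolding A_def FT_def by (subst Bochner_Integration.integral_cnj[symmetric]) (simp add: cis_cnj inner_commute)
  have ia: "integrable lborel (\<lambda>\<xi>. cnj (a \<xi>))" using a by simp
  have Ab: "norm (A x) \<le> (\<integral>\<xi>. norm (a \<xi>) \<partial>lborel)" for x
    using norm_FT_le[of "\<lambda>\<xi>. cnj (a \<xi>)" x] unfolding cA[symmetric] by simp
  have wi: "integrable lborel (?w k)" for k
  proof -
    have "integrable lborel (\<lambda>x::'a. norm (cis (0 \<bullet> x) * of_real (?w k x)))"
      by (intro integrable_norm gaussian_scaled_integrable) simp
    then show ?thesis by simp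
  qed
  \<comment> \<open>One factor \<open>A x\<close> is written out as an integral over \<xi>; the
    other, \<open>cnj (A x)\<close>, is the transform of the conjugate of a, to which the mollified
    inversion formula applies.\<close>
  have key: "(\<integral>x. of_real ((norm (A x))\<^sup>2 * ?w k x) \<partial>lborel) = of_real ?s * (\<integral>\<xi>. a \<xi> * ?M k \<xi> \<partial>lborel)" for k
  proof -
    have "(\<integral>x. of_real ((norm (A x))\<^sup>2 * ?w k x) \<partial>lborel) = (\<integral>x. A x * (cnj (A x) * of_real (?w k x)) \<partial>lborel)"
      by (simp add: complex_norm_square mult_ac del: of_real_power)
    also have "\<dots> = (\<integral>x. (\<integral>\<xi>. a \<xi> * (cnj (A x) * (cis (\<xi> \<bullet> x) * of_real (?w k x))) \<partial>lborel) \<partial>lborel)"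
      by (subst A_def, subst integral_mult_left_zero[symmetric]) (simp add: mult_ac inner_commute)
    also have "\<dots> = (\<integral>\<xi>. (\<integral>x. a \<xi> * (cnj (A x) * (cis (\<xi> \<bullet> x) * of_real (?w k x))) \<partial>lborel) \<partial>lborel)"
    proof (rule lborel_pair.Fubini_integral, rule integrable_pair_bound[OF a(1)])
      show "integrable lborel (\<lambda>x. (\<integral>\<xi>. norm (a \<xi>) \<partial>lborel) * ?w k x)"
        using wi by simp
      show "norm (a \<xi> * (cnj (A x) * (cis (\<xi> \<bullet> x) * of_real (?w k x)))) \<le> norm (a \<xi>) * norm ((\<integral>\<xi>. norm (a \<xi>) \<partial>lborel) * ?w k x)" for \<xi> x
        by (auto simp: norm_mult abs_mult intro!: mult_left_mono mult_right_mono order_trans[OF Ab])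
    qed measurable
    also have "\<dots> = (\<integral>\<xi>. a \<xi> * (of_real ?s * ?M k \<xi>) \<partial>lborel)"
      unfolding integral_mult_right_zero cA
      by (subst gaussian_mollified_inversion[OF ia]) auto
    also have "\<dots> = of_real ?s * (\<integral>\<xi>. a \<xi> * ?M k \<xi> \<partial>lborel)"
      by (subst mult.left_commute) simp
    finally show ?thesis .
  qed
  have "(\<lambda>k. \<integral>\<xi>. a \<xi> * ?M k \<xi> \<partial>lborel) \<longlonglongrightarrow> (\<integral>\<xi>. a \<xi> * (cnj (a \<xi>) * of_real ?s) \<partial>lborel)"
  proof (rule integral_dominated_convergence)
    show "integrable lborel (\<lambda>\<xi>. norm (a \<xi>) * (B * ?s))" using a by simp
    show "AE \<xi> in lborel. norm (a \<xi> * ?M k \<xi>) \<le> norm (a \<xi>) * (B * ?s)" for k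
      unfolding norm_mult using B
      by (intro AE_I2 mult_left_mono gaussian_mollifier_bound norm_ge_zero) auto
    show "AE \<xi> in lborel. (\<lambda>k. a \<xi> * ?M k \<xi>) \<longlonglongrightarrow> a \<xi> * (cnj (a \<xi>) * of_real ?s)"
      using B by (intro AE_I2 tendsto_intros gaussian_mollifier_tendsto[of "\<lambda>\<xi>. cnj (a \<xi>)" B] inverse_Suc_tendsto_0 continuous_intros a) auto
  qed measurable
  then have "(\<lambda>k. Re (of_real ?s * (\<integral>\<xi>. a \<xi> * ?M k \<xi> \<partial>lborel))) \<longlonglongrightarrow> Re (of_real ?s * (\<integral>\<xi>. a \<xi> * (cnj (a \<xi>) * of_real ?s) \<partial>lborel))"
    by (intro tendsto_intros)
  also have "(\<integral>\<xi>. a \<xi> * (cnj (a \<xi>) * of_real ?s) \<partial>lborel) = (\<integral>\<xi>. of_real ((norm (a \<xi>))\<^sup>2 * ?s) \<partial>lborel)"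
    by (simp add: complex_norm_square mult_ac del: of_real_power)
  also have "\<dots> = of_real ((\<integral>\<xi>. (norm (a \<xi>))\<^sup>2 \<partial>lborel) * ?s)"
    by (simp del: of_real_mult of_real_power)
  also have "Re (of_real ?s * of_real ((\<integral>\<xi>. (norm (a \<xi>))\<^sup>2 \<partial>lborel) * ?s)) = (2 * pi) ^ DIM('a) * (\<integral>\<xi>. (norm (a \<xi>))\<^sup>2 \<partial>lborel)"
    unfolding sqrt_two_pi_square[symmetric] by simp
  also have "(\<lambda>k. Re (of_real ?s * (\<integral>\<xi>. a \<xi> * ?M k \<xi> \<partial>lborel))) = (\<lambda>k. \<integral>x. (norm (A x))\<^sup>2 * ?w k x \<partial>lborel)"
    unfolding key[symmetric] by (simp del: of_real_mult of_real_power)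
  finally have l1: "(\<lambda>k. ennreal (\<integral>x. (norm (A x))\<^sup>2 * ?w k x \<partial>lborel)) \<longlonglongrightarrow> ennreal ((2 * pi) ^ DIM('a) * (\<integral>\<xi>. (norm (a \<xi>))\<^sup>2 \<partial>lborel))"
    by (rule tendsto_ennrealI)
  have i2: "integrable lborel (\<lambda>\<xi>. (norm (a \<xi>))\<^sup>2)"
    by (rule Bochner_Integration.integrable_bound[OF integrable_mult_right[OF integrable_norm[OF a(1)], of B]])
       (auto simp: power2_eq_square abs_mult B0 intro!: mult_right_mono B)
  have i3: "integrable lborel (\<lambda>x. (norm (A x))\<^sup>2 * ?w k x)" for k
    by (rule Bochner_Integration.integrable_bound[OF integrable_mult_right[OF wi[of k], of "(\<integral>\<xi>. norm (a \<xi>) \<partial>lborel)\<^sup>2"]])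
       (auto simp: abs_mult intro!: AE_I2 mult_right_mono power_mono Ab)
  \<comment> \<open>The Gaussian weights increase to 1, so monotone convergence identifies the limit
    although integrability of |A|^2 is not yet known.\<close>
  have "(\<lambda>k. \<integral>\<^sup>+x. ennreal ((norm (A x))\<^sup>2 * ?w k x) \<partial>lborel) \<longlonglongrightarrow> (\<integral>\<^sup>+x. ennreal ((norm (A x))\<^sup>2) \<partial>lborel)"
  proof (rule nn_integral_LIMSEQ)
    have "?e n \<le> ?e m" if "m \<le> n" for m n
      using that by (simp add: frac_le)
    then have "?w m x \<le> ?w n x" if "m \<le> n" for m n x
      using that by (auto intro!: mult_right_mono power_mono simp del: of_nat_Suc)
    then show "incseq (\<lambda>k x. ennreal ((norm (A x))\<^sup>2 * ?w k x))"
      by (auto simp: mono_def le_fun_def simp del: of_nat_Suc intro!: ennreal_leI mult_left_mono)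
    show "(\<lambda>k. ennreal ((norm (A x))\<^sup>2 * ?w k x)) \<longlonglongrightarrow> ennreal ((norm (A x))\<^sup>2)" for x
      by (rule tendsto_ennrealI) (rule tendsto_eq_intros inverse_Suc_tendsto_0 refl | simp)+
  qed measurable
  then have "(\<lambda>k. ennreal (\<integral>x. (norm (A x))\<^sup>2 * ?w k x \<partial>lborel)) \<longlonglongrightarrow> (\<integral>\<^sup>+x. ennreal ((norm (A x))\<^sup>2) \<partial>lborel)"
    by (subst (asm) nn_integral_eq_integral[OF i3]) auto
  from LIMSEQ_unique[OF this l1] show ?thesis
    unfolding A_def[symmetric] by (subst nn_integral_eq_integral[OF i2]) (auto simp: ennreal_mult)
qed

section \<open>Test functions and decay of their Fourier transforms\<close>

lemma dd_eq: "(g has_derivative D) (at x) \<Longrightarrow> dd v g x = D v"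
  unfolding dd_def by (metis frechet_derivative_at)

lemma has_derivative_dd: "g differentiable at x \<Longrightarrow> (g has_derivative (\<lambda>v. dd v g x)) (at x)"
  unfolding dd_def using frechet_derivative_works by fastforce

lemma iter_pd_Nil [simp]: "iter_pd [] g = g"
  by (simp add: iter_pd_def)

lemma iter_pd_Cons [simp]: "iter_pd (v # vs) g = dd v (iter_pd vs g)"
  by (simp add: iter_pd_def)

lemma iter_pd_append: "iter_pd (vs @ ws) g = iter_pd vs (iter_pd ws g)"
  by (simp add: iter_pd_def)

lemma C_inf_differentiable: "C_inf g \<Longrightarrow> g differentiable at x"
  unfolding C_inf_def by (metis empty_subsetI iter_pd_Nil list.set(1))

lemma C_inf_has_derivative: "C_inf g \<Longrightarrow> (g has_derivative (\<lambda>v. dd v g x)) (at x)"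
  by (intro has_derivative_dd C_inf_differentiable)

lemma C_inf_continuous: "C_inf g \<Longrightarrow> continuous_on UNIV g"
  by (meson C_inf_differentiable continuous_at_imp_continuous_on differentiable_imp_continuous_within)

lemma C_inf_dd:
  assumes "C_inf g" "b \<in> Basis"
  shows "C_inf (dd b g)"
  unfolding C_inf_def
proof safe
  fix vs :: "'a list" and x
  assume "set vs \<subseteq> Basis"
  then have "iter_pd (vs @ [b]) g differentiable at x"
    using assms unfolding C_inf_def by (metis Un_insert_right empty_set insert_subset list.simps(15) set_append sup_bot.right_neutral)
  then show "iter_pd vs (dd b g) differentiable at x"
    by (simp add: iter_pd_append)
qed

lemma iter_pd_lincomb:
  assumes "C_inf g" "C_inf h" "set vs \<subseteq> Basis"
  shows "iter_pd vs (\<lambda>x. a * g x + b * h x) = (\<lambda>x. a * iter_pd vs g x + b * iter_pd vs h x)"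
  using assms(3)
proof (induction vs)
  case (Cons v vs)
  then have "(iter_pd vs g has_derivative (\<lambda>v. dd v (iter_pd vs g) x)) (at x)"
     "(iter_pd vs h has_derivative (\<lambda>v. dd v (iter_pd vs h) x)) (at x)" for x
    using assms unfolding C_inf_def by (auto intro!: has_derivative_dd)
  then have "((\<lambda>x. a * iter_pd vs g x + b * iter_pd vs h x) has_derivative
      (\<lambda>v. a * dd v (iter_pd vs g) x + b * dd v (iter_pd vs h) x)) (at x)" for x
    by (auto intro!: derivative_intros)
  then show ?case
    using Cons by (auto intro!: ext dd_eq)
qed simp

lemma C_inf_lincomb:
  assumes "C_inf g" "C_inf h"
  shows "C_inf (\<lambda>x. a * g x + b * h x)"
  using assms unfolding C_inf_def by (auto simp: iter_pd_lincomb[OF assms])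

lemma C_inf_zero: "C_inf (\<lambda>x. 0)"
proof -
  have "iter_pd vs (\<lambda>x::'a. 0) = (\<lambda>x. 0)" for vs
    by (induction vs) (auto simp: dd_eq[OF has_derivative_const])
  then show ?thesis by (simp add: C_inf_def)
qed

text \<open>Compact support is encoded by a radius because the same radius then serves all
  derivatives, and the larger of two radii serves a sum.\<close>

definition test_fun :: "('a::euclidean_space \<Rightarrow> real) \<Rightarrow> bool" where
  "test_fun g \<longleftrightarrow> C_inf g \<and> (\<exists>R. \<forall>x. R < norm x \<longrightarrow> g x = 0)"

lemma dd_outside_support:
  assumes "\<And>x. R < norm x \<Longrightarrow> g x = 0" "R < norm x"
  shows "dd v g x = 0"
proof -
  have "open {x::'a. R < norm x}"
    by (intro open_Collect_less continuous_intros)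
  then have "(g has_derivative (\<lambda>v. 0)) (at x)"
    using assms by (intro has_derivative_transform_within_open[OF has_derivative_const[of 0]]) auto
  then show ?thesis
    by (rule dd_eq)
qed

lemma test_fun_dd: "test_fun g \<Longrightarrow> b \<in> Basis \<Longrightarrow> test_fun (dd b g)"
  unfolding test_fun_def using dd_outside_support C_inf_dd by metis

lemma test_fun_lincomb:
  assumes "test_fun g" "test_fun h"
  shows "test_fun (\<lambda>x. a * g x + b * h x)"
proof -
  obtain R S where "\<And>x. R < norm x \<Longrightarrow> g x = 0" "\<And>x. S < norm x \<Longrightarrow> h x = 0"
    using assms by (auto simp: test_fun_def)
  then have "\<forall>x. max R S < norm x \<longrightarrow> a * g x + b * h x = 0" by auto
  then show ?thesis
    using assms C_inf_lincomb unfolding test_fun_def by blast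
qed

lemma test_fun_sum:
  assumes "finite A" "\<And>a. a \<in> A \<Longrightarrow> test_fun (g a)"
  shows "test_fun (\<lambda>x. \<Sum>a\<in>A. g a x)"
  using assms
proof (induction A)
  case (insert a A)
  then show ?case
    using test_fun_lincomb[of "g a" "\<lambda>x. \<Sum>a\<in>A. g a x" 1 1] by simp
qed (simp add: test_fun_def C_inf_zero)

lemma continuous_bounded_support:
  fixes g :: "'a::euclidean_space \<Rightarrow> 'b::real_normed_vector"
  assumes "continuous_on UNIV g" "\<And>x. R < norm x \<Longrightarrow> g x = 0"
  obtains M where "0 \<le> M" "\<And>x. norm (g x) \<le> M"
proof -
  have "bounded (g ` cball 0 R)"
    using assms(1) by (intro compact_imp_bounded compact_continuous_image) (auto intro: continuous_on_subset)
  then obtain M where "0 < M" "\<And>x. x \<in> cball 0 R \<Longrightarrow> norm (g x) \<le> M"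
    unfolding bounded_pos by auto
  then have "norm (g x) \<le> M" for x
    using assms(2)[of x] by (cases "x \<in> cball 0 R") auto
  with \<open>0 < M\<close> show thesis by (intro that[of M]) auto
qed

lemma integrable_indicator_cball: "integrable lborel (\<lambda>x. M * indicat_real (cball (0::'a::euclidean_space) R) x)"
  by (intro integrable_mult_right integrable_real_indicator)
     (use emeasure_bounded_finite[OF bounded_cball[of "0::'a" R]] in \<open>auto simp: top.not_eq_extremum\<close>)

lemma integrable_bounded_support:
  fixes g :: "'a::euclidean_space \<Rightarrow> 'b::{banach,second_countable_topology}"
  assumes "continuous_on UNIV g" "\<And>x. R < norm x \<Longrightarrow> g x = 0"
  shows "integrable lborel g"
proof -
  obtain M where M: "0 \<le> M" "\<And>x. norm (g x) \<le> M"
    using continuous_bounded_support[OF assms] by blast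
  have "norm (g x) \<le> M * indicat_real (cball 0 R) x" for x
    using M(2)[of x] assms(2)[of x] by (cases "x \<in> cball 0 R") auto
  then show ?thesis
    using assms(1) M
    by (intro Bochner_Integration.integrable_bound[OF integrable_indicator_cball[of M R]])
       (auto intro!: borel_measurable_continuous_onI AE_I2)
qed

text \<open>By translation invariance every difference quotient of g has integral 0, and dominated
  convergence carries this over to the derivative. The regularity asked for covers both the smooth
  integrands of \<open>FT_dd\<close> and the merely C^1 fluxes in the uniqueness proof for the wave
  equation.\<close>

lemma integral_derivative_eq_0:
  fixes g :: "'a::euclidean_space \<Rightarrow> 'b::{banach,second_countable_topology}"
  assumes D: "\<And>x. (g has_derivative D x) (at x)"
    and c: "continuous_on UNIV (\<lambda>x. D x b)"
    and R: "\<And>x. R < norm x \<Longrightarrow> g x = 0" "\<And>x. R < norm x \<Longrightarrow> D x b = 0"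
  shows "(\<integral>x. D x b \<partial>lborel) = 0"
proof -
  have cg: "continuous_on UNIV g"
    using D by (meson continuous_at_imp_continuous_on has_derivative_continuous)
  obtain M where M: "0 \<le> M" "\<And>x. norm (D x b) \<le> M"
    using continuous_bounded_support[OF c R(2)] by blast
  have [measurable]: "g \<in> borel_measurable borel" "(\<lambda>x. D x b) \<in> borel_measurable borel"
    using c cg by (auto intro!: borel_measurable_continuous_onI)
  let ?e = "\<lambda>k. 1 / real (Suc k)"
  let ?q = "\<lambda>k x. (g (x + ?e k *\<^sub>R b) - g x) /\<^sub>R ?e k"
  have ig: "integrable lborel g"
    by (rule integrable_bounded_support[OF cg R(1)])
  have ig': "integrable lborel (\<lambda>x. g (x + v))" "(\<integral>x. g (x + v) \<partial>lborel) = (\<integral>x. g x \<partial>lborel)" for v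
    using lborel_integrable_affine[OF _ ig, of 1 v] lborel_integral_affine[of 1 g v] by (auto simp: add.commute)
  have q0: "(\<integral>x. ?q k x \<partial>lborel) = 0" for k
    using ig ig' by simp
  have line: "((\<lambda>s. g (x + s *\<^sub>R b)) has_derivative (\<lambda>r. r *\<^sub>R D (x + s *\<^sub>R b) b)) (at s)" for x s
  proof -
    have "((\<lambda>s. g (x + s *\<^sub>R b)) has_derivative (\<lambda>r. D (x + s *\<^sub>R b) (r *\<^sub>R b))) (at s)"
      by (rule has_derivative_compose[of "\<lambda>s. x + s *\<^sub>R b", OF _ D]) (auto intro!: derivative_eq_intros)
    then show ?thesis
      using linear_scale[OF has_derivative_linear[OF D]] by simp
  qed
  \<comment> \<open>The mean value inequality along the segment from x in direction b bounds the
    quotients uniformly in k.\<close>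
  have q_bound: "norm (?q k x) \<le> M" for k x
  proof -
    have "norm (g (x + ?e k *\<^sub>R b) - g (x + 0 *\<^sub>R b)) \<le> M * norm (?e k - 0)"
      by (rule differentiable_bound[of UNIV "\<lambda>s. g (x + s *\<^sub>R b)" "\<lambda>s r. r *\<^sub>R D (x + s *\<^sub>R b) b"])
         (use M line in \<open>auto intro!: onorm_le simp: mult.commute[of M] mult_left_mono\<close>)
    then have "norm (g (x + ?e k *\<^sub>R b) - g x) \<le> M * ?e k"
      by simp
    then show ?thesis
      by (simp only: norm_scaleR norm_inverse) (simp add: divide_simps mult.commute)
  qed
  have "(\<lambda>k. \<integral>x. ?q k x \<partial>lborel) \<longlonglongrightarrow> (\<integral>x. D x b \<partial>lborel)"
  proof (rule integral_dominated_convergence)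
    show "integrable lborel (\<lambda>x. M * indicat_real (cball (0::'a) (R + norm b)) x)"
      by (rule integrable_indicator_cball)
    \<comment> \<open>The steps have length at most \<open>norm b\<close>, so all quotients vanish
      outside the ball of radius \<open>R + norm b\<close>.\<close>
    have "norm (?q k x) \<le> M * indicat_real (cball 0 (R + norm b)) x" for k x
    proof (cases "x \<in> cball 0 (R + norm b)")
      case False
      have "norm (?e k *\<^sub>R b) \<le> norm b"
        by (simp add: field_simps mult_left_le_one_le)
      moreover have "norm x - norm (?e k *\<^sub>R b) \<le> norm (x + ?e k *\<^sub>R b)"
        by (metis add_diff_cancel norm_minus_commute norm_triangle_ineq2 diff_add_cancel norm_diff_ineq)
      ultimately have "R < norm (x + ?e k *\<^sub>R b)" "R < norm x"
        using False norm_ge_zero[of b] by (auto simp del: norm_ge_zero)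
      then show ?thesis using R M(1) by simp
    qed (use q_bound in auto)
    then show "AE x in lborel. norm (?q k x) \<le> M * indicat_real (cball 0 (R + norm b)) x" for k
      by simp
    have "(\<lambda>k. ?q k x) \<longlonglongrightarrow> D x b" for x
    proof -
      have "((\<lambda>h. norm (g (x + h *\<^sub>R b) - g x - h *\<^sub>R D x b) / norm h) \<longlongrightarrow> 0) (at 0)"
        using line[of x 0] unfolding has_derivative_at by simp
      moreover have "\<forall>\<^sub>F h in at 0. norm (g (x + h *\<^sub>R b) - g x - h *\<^sub>R D x b) / norm h
          = norm ((g (x + h *\<^sub>R b) - g x) /\<^sub>R h - D x b)"
      proof (rule eventually_at_filter[THEN iffD2, OF always_eventually], safe)
        fix h :: real
        assume "h \<noteq> 0"
        then have "(g (x + h *\<^sub>R b) - g x) /\<^sub>R h - D x b = (g (x + h *\<^sub>R b) - g x - h *\<^sub>R D x b) /\<^sub>R h"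
          by (simp add: scaleR_diff_right)
        then show "norm (g (x + h *\<^sub>R b) - g x - h *\<^sub>R D x b) / norm h
            = norm ((g (x + h *\<^sub>R b) - g x) /\<^sub>R h - D x b)"
          by (simp only: norm_scaleR) (simp add: divide_inverse mult.commute)
      qed
      ultimately have "((\<lambda>h. norm ((g (x + h *\<^sub>R b) - g x) /\<^sub>R h - D x b)) \<longlongrightarrow> 0) (at 0)"
        by (rule Lim_transform_eventually)
      then have "((\<lambda>h. (g (x + h *\<^sub>R b) - g x) /\<^sub>R h) \<longlongrightarrow> D x b) (at 0)"
        using tendsto_norm_zero_iff LIM_zero_cancel by blast
      moreover have "filterlim ?e (at 0) sequentially"
        using inverse_Suc_tendsto_0 by (auto simp: filterlim_at)
      ultimately show ?thesis
        by (rule filterlim_compose[where f="?e" and g="\<lambda>h. (g (x + h *\<^sub>R b) - g x) /\<^sub>R h"])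
    qed
    then show "AE x in lborel. (\<lambda>k. ?q k x) \<longlonglongrightarrow> D x b"
      by simp
  qed measurable
  then show ?thesis
    using q0 by (simp add: LIMSEQ_const_iff)
qed

lemma test_fun_continuous: "test_fun g \<Longrightarrow> continuous_on UNIV g"
  by (simp add: test_fun_def C_inf_continuous)

lemma test_fun_integrable: "test_fun g \<Longrightarrow> integrable lborel (\<lambda>x. complex_of_real (g x))"
  using integrable_bounded_support[OF C_inf_continuous] unfolding test_fun_def by force

section \<open>Fourier transforms of derivatives and rapid decay\<close>

lemma FT_dd:
  assumes g: "test_fun g" and b: "b \<in> Basis"
  shows "FT (\<lambda>x. complex_of_real (dd b g x)) \<xi> = \<i> * of_real (\<xi> \<bullet> b) * FTR g \<xi>"
proof -
  let ?G = "\<lambda>x. of_real (g x) * cis (- (x \<bullet> \<xi>))"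
  let ?D = "\<lambda>x v. of_real (dd v g x) * cis (- (x \<bullet> \<xi>)) - \<i> * of_real (v \<bullet> \<xi>) * ?G x"
  obtain R where R: "\<And>x. R < norm x \<Longrightarrow> g x = 0"
    using g by (auto simp: test_fun_def)
  have Ci: "C_inf g" using g by (simp add: test_fun_def)
  have d: "(?G has_derivative ?D x) (at x)" for x
    by (rule derivative_eq_intros C_inf_has_derivative[OF Ci] refl)+
       (auto simp: scaleR_conv_of_real algebra_simps)
  \<comment> \<open>Integration by parts: the derivative of g times the character integrates to 0,
    and its two product-rule terms are the two sides of the claim.\<close>
  have "(\<integral>x. ?D x b \<partial>lborel) = 0"
    by (rule integral_derivative_eq_0[OF d, of b R])
       (auto simp: R dd_outside_support[OF R] intro!: continuous_intros C_inf_continuous[OF Ci] C_inf_continuous[OF C_inf_dd[OF Ci b]])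
  moreover have "integrable lborel (\<lambda>x. of_real (dd b g x) * cis (- (x \<bullet> \<xi>)))" "integrable lborel ?G"
    using g b by (auto intro!: integrable_mult_cis test_fun_integrable test_fun_dd)
  ultimately show ?thesis
    by (simp add: FT_def inner_commute)
qed

lemma FT_add: "integrable lborel f \<Longrightarrow> integrable lborel g \<Longrightarrow> FT (\<lambda>x. f x + g x) \<xi> = FT f \<xi> + FT g \<xi>"
  unfolding FT_def by (simp add: ring_distribs integrable_mult_cis)

lemma FT_cmult: "FT (\<lambda>x. c * f x) \<xi> = c * FT f \<xi>"
  unfolding FT_def by (simp add: mult.assoc)

text \<open>The transform of g minus its Laplacian is (1 + |xi|^2) times the transform of g, and it
  is again the transform of a test function. Each induction step gains one such factor, and the
  start is the trivial bound by the integral of |g|.\<close>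

lemma FT_decay:
  assumes "test_fun g"
  shows "\<exists>C. \<forall>\<xi>. (1 + (norm \<xi>)\<^sup>2) ^ N * norm (FTR g \<xi>) \<le> C"
  using assms
proof (induction N arbitrary: g)
  case 0
  then show ?case using norm_FT_le by fastforce
next
  case (Suc N)
  let ?F = "\<lambda>g. FTR g"
  define L where "L = (\<lambda>x. \<Sum>b\<in>Basis. dd b (dd b g) x)"
  have tL: "test_fun L"
    unfolding L_def using Suc.prems by (intro test_fun_sum test_fun_dd) auto
  have t: "test_fun (\<lambda>x. 1 * g x + (- 1) * L x)"
    by (intro test_fun_lincomb Suc.prems tL)
  have "?F L \<xi> = (\<Sum>b\<in>Basis. ?F (dd b (dd b g)) \<xi>)" for \<xi>
    unfolding L_def FT_def using Suc.prems
    by (simp add: sum_distrib_right integrable_mult_cis test_fun_integrable test_fun_dd)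
  also have "\<dots> \<xi> = (\<Sum>b\<in>Basis. - of_real ((\<xi> \<bullet> b)\<^sup>2) * ?F g \<xi>)" for \<xi>
    using Suc.prems by (intro sum.cong) (auto simp: FT_dd test_fun_dd power2_eq_square algebra_simps)
  also have "\<dots> \<xi> = - of_real ((norm \<xi>)\<^sup>2) * ?F g \<xi>" for \<xi>
    by (simp add: norm_sq_Basis sum_distrib_right[symmetric] sum_negf)
  finally have FL: "?F L \<xi> = - of_real ((norm \<xi>)\<^sup>2) * ?F g \<xi>" for \<xi> .
  have "?F (\<lambda>x. 1 * g x + (- 1) * L x) \<xi> = ?F g \<xi> + (-1) * ?F L \<xi>" for \<xi>
    using FT_add[of "\<lambda>x. complex_of_real (g x)" "\<lambda>x. (-1) * complex_of_real (L x)" \<xi>] test_fun_integrable[OF Suc.prems] test_fun_integrable[OF tL]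
    using FT_cmult[of "-1" "\<lambda>x. complex_of_real (L x)" \<xi>] by simp
  then have "?F (\<lambda>x. 1 * g x + (- 1) * L x) \<xi> = of_real (1 + (norm \<xi>)\<^sup>2) * ?F g \<xi>" for \<xi>
    by (simp add: FL algebra_simps)
  moreover have "norm (of_real (1 + (norm \<xi>)\<^sup>2) :: complex) = 1 + (norm \<xi>)\<^sup>2" for \<xi> :: 'a
    unfolding norm_of_real by (simp add: abs_of_nonneg)
  ultimately have "norm (?F (\<lambda>x. 1 * g x + (- 1) * L x) \<xi>) = (1 + (norm \<xi>)\<^sup>2) * norm (?F g \<xi>)" for \<xi>
    by (simp only: norm_mult)
  then show ?case
    using Suc.IH[OF t] by (simp only: power_Suc2 mult.assoc)
qed

lemma FT_le_decay:
  assumes "test_fun g"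
  obtains C where "0 \<le> C" "\<And>\<xi>. norm (FTR g \<xi>) \<le> C / (1 + (norm (\<xi>::'a::euclidean_space))\<^sup>2) ^ N"
proof -
  obtain C where C: "\<And>\<xi>. (1 + (norm \<xi>)\<^sup>2) ^ N * norm (FTR g \<xi>) \<le> C"
    using FT_decay[OF assms] by blast
  have p: "0 < (1 + (norm (\<xi>::'a))\<^sup>2) ^ N" for \<xi>
    by (simp add: add_pos_nonneg)
  have "0 \<le> (1 + (norm \<xi>)\<^sup>2) ^ N * norm (FTR g \<xi>)" for \<xi> :: 'a
    by simp
  then have "0 \<le> C" using C[of 0] by (meson order_trans)
  then show thesis
    using C p by (intro that[of C]) (auto simp: pos_le_divide_eq mult.commute)
qed

lemma FT_continuous:
  fixes f :: "'a::euclidean_space \<Rightarrow> complex"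
  assumes f: "integrable lborel f"
  shows "continuous_on UNIV (FT f)"
proof -
  have [measurable]: "f \<in> borel_measurable borel" using f by auto
  have "(\<lambda>n. FT f (u n)) \<longlonglongrightarrow> FT f l" if u: "u \<longlonglongrightarrow> l" for u l
    unfolding FT_def
  proof (rule integral_dominated_convergence)
    show "integrable lborel (\<lambda>x. norm (f x))" using f by simp
    show "AE x in lborel. (\<lambda>n. f x * cis (- (x \<bullet> u n))) \<longlonglongrightarrow> f x * cis (- (x \<bullet> l))"
      by (intro AE_I2 tendsto_intros u)
  qed (auto simp: norm_mult)
  then show ?thesis
    by (simp add: continuous_on_sequentially o_def)
qed

text \<open>Decay of order N + DIM is used: N powers cancel the weight, and the other DIM powers are
  those of \<open>integrable_decay\<close>.\<close>

lemma integrable_moment_FT: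
  assumes "test_fun g"
  shows "integrable lborel (\<lambda>\<xi>::'a::euclidean_space. (1 + (norm \<xi>)\<^sup>2) ^ N * norm (FTR g \<xi>))"
proof -
  obtain C where C: "0 \<le> C" "\<And>\<xi>. norm (FTR g \<xi>) \<le> C / (1 + (norm (\<xi>::'a))\<^sup>2) ^ (N + DIM('a))"
    using FT_le_decay[OF assms] by blast
  have [measurable]: "(\<lambda>x. complex_of_real (g x)) \<in> borel_measurable borel"
    using test_fun_integrable[OF assms] by auto
  have "(1 + (norm \<xi>)\<^sup>2) ^ N * norm (FTR g \<xi>) \<le> C * (1 / (1 + (norm \<xi>)\<^sup>2) ^ DIM('a))" for \<xi>
  proof -
    have p: "0 < (1 + (norm \<xi>)\<^sup>2)" by (simp add: add_pos_nonneg)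
    have "(1 + (norm \<xi>)\<^sup>2) ^ N * norm (FTR g \<xi>) \<le> (1 + (norm \<xi>)\<^sup>2) ^ N * (C / (1 + (norm \<xi>)\<^sup>2) ^ (N + DIM('a)))"
      using C p by (intro mult_left_mono) auto
    also have "\<dots> = C * (1 / (1 + (norm \<xi>)\<^sup>2) ^ DIM('a))"
      using p by (simp add: power_add)
    finally show ?thesis .
  qed
  then show ?thesis
    using C(1)
    by (intro Bochner_Integration.integrable_bound[OF integrable_mult_right[OF integrable_decay, of C]])
       (auto simp: abs_mult add_pos_nonneg intro!: AE_I2)
qed

lemma integrable_FT: "test_fun g \<Longrightarrow> integrable lborel (FTR g)"
  using integrable_moment_FT[of g 0] test_fun_integrable[of g]
  by (simp add: integrable_norm_iff)

lemma test_fun_fourier_inversion: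
  fixes g :: "'a::euclidean_space \<Rightarrow> real"
  assumes g: "test_fun g"
  shows "(\<integral>\<xi>. FTR g \<xi> * cis (x \<bullet> \<xi>) \<partial>lborel) = of_real ((2 * pi) ^ DIM('a)) * of_real (g x)"
proof -
  obtain R where R: "\<And>x. R < norm x \<Longrightarrow> g x = 0"
    using g by (auto simp: test_fun_def)
  obtain M where "\<And>x. norm (g x) \<le> M"
    using continuous_bounded_support[OF test_fun_continuous[OF g] R] by blast
  then show ?thesis
    using g by (intro fourier_inversion[of _ M] test_fun_integrable integrable_FT continuous_intros test_fun_continuous) auto
qed

section \<open>Oscillatory integrals and solutions of the wave equation\<close>

text \<open>A superposition of plane waves. Keeping the phase map \<Phi> apart from the amplitude q
  makes the family closed under directional derivatives, because a derivative along v only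
  multiplies q by i times the inner product of v and \<Phi>. The real part is taken since
  \<open>dd\<close> acts on real functions.\<close>

definition osc :: "('a::euclidean_space \<Rightarrow> complex) \<Rightarrow> ('a \<Rightarrow> 'e::euclidean_space) \<Rightarrow> 'e \<Rightarrow> real" where
  "osc q \<Phi> z = Re (\<integral>\<xi>. q \<xi> * cis (z \<bullet> \<Phi> \<xi>) \<partial>lborel)"

text \<open>All moments are required because each derivative multiplies the amplitude by a further
  factor of size |\<Phi>|, and the condition has to survive this.\<close>

definition moments :: "('a::euclidean_space \<Rightarrow> complex) \<Rightarrow> ('a \<Rightarrow> 'e::euclidean_space) \<Rightarrow> bool" where
  "moments q \<Phi> \<longleftrightarrow> q \<in> borel_measurable borel \<and> \<Phi> \<in> borel_measurable borel \<and>
     (\<forall>N. integrable lborel (\<lambda>\<xi>. norm (q \<xi>) * norm (\<Phi> \<xi>) ^ N))"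

lemma moments_integrable:
  assumes "moments q \<Phi>"
  shows "integrable lborel q"
proof -
  have "integrable lborel (\<lambda>\<xi>. norm (q \<xi>) * norm (\<Phi> \<xi>) ^ 0)" "q \<in> borel_measurable borel"
    using assms unfolding moments_def by blast+
  then show ?thesis
    by (simp add: integrable_norm_iff)
qed

lemma moments_dd:
  assumes "moments q \<Phi>"
  shows "moments (\<lambda>\<xi>. q \<xi> * (\<i> * of_real (v \<bullet> \<Phi> \<xi>))) \<Phi>"
proof -
  have [measurable]: "q \<in> borel_measurable borel" "\<Phi> \<in> borel_measurable borel"
    using assms by (auto simp: moments_def)
  have "integrable lborel (\<lambda>\<xi>. norm (q \<xi> * (\<i> * of_real (v \<bullet> \<Phi> \<xi>))) * norm (\<Phi> \<xi>) ^ N)" for N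
  proof (rule Bochner_Integration.integrable_bound)
    show "integrable lborel (\<lambda>\<xi>. norm v * (norm (q \<xi>) * norm (\<Phi> \<xi>) ^ Suc N))"
      using assms by (intro integrable_mult_right) (simp only: moments_def)
    have "norm (q \<xi> * (\<i> * of_real (v \<bullet> \<Phi> \<xi>))) * norm (\<Phi> \<xi>) ^ N \<le> norm v * (norm (q \<xi>) * norm (\<Phi> \<xi>) ^ Suc N)" for \<xi>
    proof -
      have "norm (q \<xi>) * \<bar>v \<bullet> \<Phi> \<xi>\<bar> * norm (\<Phi> \<xi>) ^ N \<le> norm (q \<xi>) * (norm v * norm (\<Phi> \<xi>)) * norm (\<Phi> \<xi>) ^ N"
        by (intro mult_right_mono mult_left_mono Cauchy_Schwarz_ineq2) auto
      then show ?thesis by (simp add: norm_mult mult_ac)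
    qed
    then show "AE \<xi> in lborel. norm (norm (q \<xi> * (\<i> * of_real (v \<bullet> \<Phi> \<xi>))) * norm (\<Phi> \<xi>) ^ N)
        \<le> norm (norm v * (norm (q \<xi>) * norm (\<Phi> \<xi>) ^ Suc N))"
      by (intro AE_I2) (auto simp: abs_mult)
  qed measurable
  then show ?thesis
    unfolding moments_def by auto
qed

lemma cis_taylor1: "norm (cis (a + r) - cis a - \<i> * of_real r * cis a) \<le> r\<^sup>2 / 2"
proof -
  have "cis (a + r) - cis a - \<i> * of_real r * cis a = cis a * (iexp r - (\<Sum>k\<le>1. (\<i> * r) ^ k / fact k))"
    by (simp add: cis_mult[symmetric] cis_conv_exp[symmetric] algebra_simps)
  then show ?thesis
    using iexp_approx1[of r 1] by (simp add: norm_mult power2_eq_square)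
qed

text \<open>By \<open>cis_taylor1\<close> the remainder of the first-order expansion at z is at most
  |y - z|^2 times the second moment of the amplitude, hence of smaller order than |y - z|.\<close>

lemma osc_has_derivative:
  fixes \<Phi> :: "'a::euclidean_space \<Rightarrow> 'e::euclidean_space"
  assumes m: "moments q \<Phi>"
  shows "(osc q \<Phi> has_derivative (\<lambda>v. osc (\<lambda>\<xi>. q \<xi> * (\<i> * of_real (v \<bullet> \<Phi> \<xi>))) \<Phi> z)) (at z)"
proof -
  let ?q' = "\<lambda>v \<xi>. q \<xi> * (\<i> * of_real (v \<bullet> \<Phi> \<xi>))"
  have [measurable]: "q \<in> borel_measurable borel" "\<Phi> \<in> borel_measurable borel"
    using m by (auto simp: moments_def)
  have iq: "integrable lborel (\<lambda>\<xi>. q \<xi> * cis (z \<bullet> \<Phi> \<xi>))" for z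
    by (intro integrable_mult_cis moments_integrable[OF m]) measurable
  have iq': "integrable lborel (\<lambda>\<xi>. ?q' v \<xi> * cis (z \<bullet> \<Phi> \<xi>))" for v
    by (intro integrable_mult_cis moments_integrable[OF moments_dd[OF m]]) measurable
  have i1: "integrable lborel (\<lambda>\<xi>. norm (q \<xi>) * norm (\<Phi> \<xi>) ^ N)" for N
    using m by (simp add: moments_def)
  have bl: "bounded_linear (\<lambda>v. osc (?q' v) \<Phi> z)"
  proof (rule bounded_linear_intro)
    show "osc (?q' (v + w)) \<Phi> z = osc (?q' v) \<Phi> z + osc (?q' w) \<Phi> z" for v w
    proof -
      have "?q' (v + w) \<xi> * cis (z \<bullet> \<Phi> \<xi>) = ?q' v \<xi> * cis (z \<bullet> \<Phi> \<xi>) + ?q' w \<xi> * cis (z \<bullet> \<Phi> \<xi>)" for \<xi>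
        by (simp add: inner_add_left ring_distribs)
      then show ?thesis
        unfolding osc_def by (simp only: Bochner_Integration.integral_add[OF iq' iq'] plus_complex.simps)
    qed
    show "osc (?q' (r *\<^sub>R v)) \<Phi> z = r *\<^sub>R osc (?q' v) \<Phi> z" for r v
    proof -
      have "?q' (r *\<^sub>R v) \<xi> * cis (z \<bullet> \<Phi> \<xi>) = of_real r * (?q' v \<xi> * cis (z \<bullet> \<Phi> \<xi>))" for \<xi>
        by simp
      then show ?thesis
        unfolding osc_def by (simp only: integral_mult_right_zero) simp
    qed
    show "norm (osc (?q' v) \<Phi> z) \<le> norm v * (\<integral>\<xi>. norm (q \<xi>) * norm (\<Phi> \<xi>) ^ 1 \<partial>lborel)" for v
    proof -
      have "norm (osc (?q' v) \<Phi> z) \<le> norm (\<integral>\<xi>. ?q' v \<xi> * cis (z \<bullet> \<Phi> \<xi>) \<partial>lborel)"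
        unfolding osc_def by (simp add: abs_Re_le_cmod)
      also have "\<dots> \<le> (\<integral>\<xi>. norm v * (norm (q \<xi>) * norm (\<Phi> \<xi>) ^ 1) \<partial>lborel)"
      proof (rule order_trans[OF integral_norm_bound], rule integral_mono)
        show "integrable lborel (\<lambda>\<xi>. norm v * (norm (q \<xi>) * norm (\<Phi> \<xi>) ^ 1))"
          using i1 by (rule integrable_mult_right)
        have "norm (q \<xi>) * \<bar>v \<bullet> \<Phi> \<xi>\<bar> \<le> norm (q \<xi>) * (norm v * norm (\<Phi> \<xi>))" for \<xi>
          by (intro mult_left_mono Cauchy_Schwarz_ineq2) auto
        then show "norm (?q' v \<xi> * cis (z \<bullet> \<Phi> \<xi>)) \<le> norm v * (norm (q \<xi>) * norm (\<Phi> \<xi>) ^ 1)" for \<xi>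
          by (simp add: norm_mult mult_ac)
      qed (use iq' in simp)
      finally show ?thesis
        by (simp only: integral_mult_right_zero)
    qed
  qed
  let ?C = "\<integral>\<xi>. norm (q \<xi>) * norm (\<Phi> \<xi>) ^ 2 \<partial>lborel"
  have est: "norm (osc q \<Phi> y - osc q \<Phi> z - osc (?q' (y - z)) \<Phi> z) \<le> norm (y - z) ^ 2 * ?C" for y
  proof -
    let ?d = "\<lambda>\<xi>. q \<xi> * cis (y \<bullet> \<Phi> \<xi>) - q \<xi> * cis (z \<bullet> \<Phi> \<xi>) - ?q' (y - z) \<xi> * cis (z \<bullet> \<Phi> \<xi>)"
    have id: "integrable lborel ?d"
      by (intro Bochner_Integration.integrable_diff iq iq')
    have "osc q \<Phi> y - osc q \<Phi> z - osc (?q' (y - z)) \<Phi> z = Re (\<integral>\<xi>. ?d \<xi> \<partial>lborel)"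
      unfolding osc_def
      by (simp only: Bochner_Integration.integral_diff iq iq' Bochner_Integration.integrable_diff minus_complex.simps)
    then have "norm (osc q \<Phi> y - osc q \<Phi> z - osc (?q' (y - z)) \<Phi> z) \<le> norm (\<integral>\<xi>. ?d \<xi> \<partial>lborel)"
      by (simp add: abs_Re_le_cmod)
    also have "\<dots> \<le> (\<integral>\<xi>. norm (y - z) ^ 2 * (norm (q \<xi>) * norm (\<Phi> \<xi>) ^ 2) \<partial>lborel)"
    proof (rule order_trans[OF integral_norm_bound], rule integral_mono)
      show "integrable lborel (\<lambda>\<xi>. norm (y - z) ^ 2 * (norm (q \<xi>) * norm (\<Phi> \<xi>) ^ 2))"
        using i1 by (rule integrable_mult_right)
      show "norm (?d \<xi>) \<le> norm (y - z) ^ 2 * (norm (q \<xi>) * norm (\<Phi> \<xi>) ^ 2)" for \<xi>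
      proof -
        let ?r = "(y - z) \<bullet> \<Phi> \<xi>"
        have "?d \<xi> = q \<xi> * (cis (z \<bullet> \<Phi> \<xi> + ?r) - cis (z \<bullet> \<Phi> \<xi>) - \<i> * of_real ?r * cis (z \<bullet> \<Phi> \<xi>))"
          by (simp add: inner_diff_left algebra_simps)
        then have "norm (?d \<xi>) \<le> norm (q \<xi>) * (?r\<^sup>2 / 2)"
          using cis_taylor1[of "z \<bullet> \<Phi> \<xi>" ?r] by (simp add: norm_mult mult_left_mono del: times_divide_eq_right)
        also have "?r\<^sup>2 / 2 \<le> (norm (y - z) * norm (\<Phi> \<xi>))\<^sup>2"
        proof -
          have "\<bar>?r\<bar>\<^sup>2 \<le> (norm (y - z) * norm (\<Phi> \<xi>))\<^sup>2"
            by (intro power_mono Cauchy_Schwarz_ineq2) auto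
          then show ?thesis
            using zero_le_power2[of ?r] unfolding power2_abs by linarith
        qed
        finally have "norm (?d \<xi>) \<le> norm (q \<xi>) * (norm (y - z) * norm (\<Phi> \<xi>))\<^sup>2"
          by (simp add: mult_left_mono del: times_divide_eq_right)
        then show ?thesis
          by (simp only: power_mult_distrib mult_ac)
      qed
    qed (use id in simp)
    finally show ?thesis
      by (simp only: integral_mult_right_zero)
  qed
  show ?thesis
  proof (rule has_derivativeI_sandwich[where e=1 and H="\<lambda>y. norm (y - z) * ?C"])
    show "norm (osc q \<Phi> y - osc q \<Phi> z - osc (?q' (y - z)) \<Phi> z) / norm (y - z) \<le> norm (y - z) * ?C" if "y \<noteq> z" for y
      using est[of y] that by (simp add: divide_le_eq power2_eq_square mult_ac)
    have "((\<lambda>y. norm (y - z) * ?C) \<longlongrightarrow> norm (z - z) * ?C) (at z)"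
      by (intro tendsto_intros)
    then show "((\<lambda>y. norm (y - z) * ?C) \<longlongrightarrow> 0) (at z)" by simp
  qed (use bl in auto)
qed

lemma dd_osc: "moments q \<Phi> \<Longrightarrow> dd v (osc q \<Phi>) = osc (\<lambda>\<xi>. q \<xi> * (\<i> * of_real (v \<bullet> \<Phi> \<xi>))) \<Phi>"
  by (rule ext, rule dd_eq, rule osc_has_derivative)

lemma C_inf_osc:
  assumes "moments q \<Phi>"
  shows "C_inf (osc q \<Phi>)"
proof -
  have "\<exists>q'. moments q' \<Phi> \<and> iter_pd vs (osc q \<Phi>) = osc q' \<Phi>" for vs
  proof (induction vs)
    case (Cons v vs)
    then show ?case using moments_dd dd_osc by fastforce
  qed (use assms in auto)
  moreover have "osc q' \<Phi> differentiable at x" if "moments q' \<Phi>" for q' x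
    using osc_has_derivative[OF that] by (rule differentiableI)
  ultimately show ?thesis
    unfolding C_inf_def by metis
qed

section \<open>The cosine propagator solves the wave equation\<close>

definition wave :: "('a::euclidean_space \<Rightarrow> real) \<Rightarrow> 'a \<times> real \<Rightarrow> real" where
  "wave f z = Re (\<integral>\<xi>. FTR f \<xi> * of_real (cos (snd z * norm \<xi>)) * cis (fst z \<bullet> \<xi>) \<partial>lborel) / (2 * pi) ^ DIM('a)"

lemma moments_wave:
  assumes "test_fun f" "\<bar>r\<bar> = (1::real)"
  shows "moments (\<lambda>\<xi>::'a::euclidean_space. of_real c * FTR f \<xi>) (\<lambda>\<xi>. (\<xi>, r * norm \<xi>))"
  unfolding moments_def
proof (intro conjI allI)
  have [measurable]: "(\<lambda>x. complex_of_real (f x)) \<in> borel_measurable borel"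
    using test_fun_integrable[OF assms(1)] by auto
  show "(\<lambda>\<xi>. of_real c * FTR f \<xi>) \<in> borel_measurable borel"
    by measurable
  show "(\<lambda>\<xi>::'a. (\<xi>, r * norm \<xi>)) \<in> borel_measurable borel"
    by (intro borel_measurable_continuous_onI continuous_intros)
  fix N
  show "integrable lborel (\<lambda>\<xi>::'a. norm (of_real c * FTR f \<xi>) * norm (\<xi>, r * norm \<xi>) ^ N)"
  proof (rule Bochner_Integration.integrable_bound)
    show "integrable lborel (\<lambda>\<xi>::'a. (\<bar>c\<bar> * 2 ^ N) * ((1 + (norm \<xi>)\<^sup>2) ^ N * norm (FTR f \<xi>)))"
      by (intro integrable_mult_right integrable_moment_FT assms)
    have "norm (\<xi>, r * norm \<xi>) ^ N \<le> (2 * (1 + (norm \<xi>)\<^sup>2)) ^ N" for \<xi> :: 'a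
    proof (rule power_mono)
      have "norm (\<xi>, r * norm \<xi>) \<le> norm \<xi> + norm \<xi>"
        using norm_Pair_le[of \<xi> "r * norm \<xi>"] assms(2) by (simp add: abs_mult)
      also have "norm \<xi> \<le> 1 + (norm \<xi>)\<^sup>2"
        using sum_squares_bound[of 1 "norm \<xi>"] norm_ge_zero[of \<xi>]
        unfolding power2_eq_square by linarith
      finally show "norm (\<xi>, r * norm \<xi>) \<le> 2 * (1 + (norm \<xi>)\<^sup>2)" by simp
    qed simp
    then have "norm (\<xi>, r * norm \<xi>) ^ N \<le> 2 ^ N * (1 + (norm \<xi>)\<^sup>2) ^ N" for \<xi> :: 'a
      by (simp only: power_mult_distrib)
    then have "\<bar>c\<bar> * norm (FTR f \<xi>) * norm (\<xi>, r * norm \<xi>) ^ N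
        \<le> \<bar>c\<bar> * norm (FTR f \<xi>) * (2 ^ N * (1 + (norm \<xi>)\<^sup>2) ^ N)" for \<xi>
      by (intro mult_left_mono) auto
    then show "AE \<xi> in lborel. norm (norm (of_real c * FTR f \<xi>) * norm (\<xi>, r * norm \<xi>) ^ N)
       \<le> norm ((\<bar>c\<bar> * 2 ^ N) * ((1 + (norm (\<xi>::'a))\<^sup>2) ^ N * norm (FTR f \<xi>)))"
      by (intro AE_I2) (simp add: norm_mult abs_mult mult_ac)
    show "(\<lambda>\<xi>::'a. norm (of_real c * FTR f \<xi>) * norm (\<xi>, r * norm \<xi>) ^ N) \<in> borel_measurable lborel"
      by measurable
  qed
qed

text \<open>The multiplier cos(t |xi|) is the half-sum of two half-waves with phases (xi, |xi|) and
  (xi, -|xi|). That |xi| is not smooth at the origin does no harm: smoothness of an oscillatory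
  integral in z depends on moments only.\<close>

lemma wave_eq_osc:
  fixes f :: "'a::euclidean_space \<Rightarrow> real"
  assumes f: "test_fun f"
  defines "q \<equiv> (\<lambda>\<xi>. of_real (1 / (2 * (2 * pi) ^ DIM('a))) * FTR f \<xi>)"
  shows "wave f = (\<lambda>z. 1 * osc q (\<lambda>\<xi>. (\<xi>, 1 * norm \<xi>)) z + 1 * osc q (\<lambda>\<xi>. (\<xi>, -1 * norm \<xi>)) z)"
proof
  fix z :: "'a \<times> real"
  have i: "integrable lborel (\<lambda>\<xi>. q \<xi> * cis (z \<bullet> (\<xi>, r * norm \<xi>)))" if "\<bar>r\<bar> = 1" for r
    using moments_integrable[OF moments_wave[OF f that]] unfolding q_def
    by (rule integrable_mult_cis) (intro borel_measurable_continuous_onI continuous_intros)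
  have "q \<xi> * cis (z \<bullet> (\<xi>, 1 * norm \<xi>)) + q \<xi> * cis (z \<bullet> (\<xi>, -1 * norm \<xi>))
      = of_real (1 / (2 * pi) ^ DIM('a)) * (FTR f \<xi> * of_real (cos (snd z * norm \<xi>)) * cis (fst z \<bullet> \<xi>))" for \<xi>
  proof -
    have "cis (a + b) + cis (a - b) = 2 * of_real (cos b) * cis a" for a b
      by (auto simp: complex_eq_iff cos_add sin_add cos_diff sin_diff)
    from this[of "fst z \<bullet> \<xi>" "snd z * norm \<xi>"]
    have "q \<xi> * cis (z \<bullet> (\<xi>, 1 * norm \<xi>)) + q \<xi> * cis (z \<bullet> (\<xi>, -1 * norm \<xi>))
        = q \<xi> * (2 * of_real (cos (snd z * norm \<xi>)) * cis (fst z \<bullet> \<xi>))"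
      by (simp add: inner_prod_def distrib_left[symmetric])
    then show ?thesis
      by (simp add: q_def)
  qed
  then have "1 * osc q (\<lambda>\<xi>. (\<xi>, 1 * norm \<xi>)) z + 1 * osc q (\<lambda>\<xi>. (\<xi>, -1 * norm \<xi>)) z
     = Re (\<integral>\<xi>. of_real (1 / (2 * pi) ^ DIM('a)) * (FTR f \<xi> * of_real (cos (snd z * norm \<xi>)) * cis (fst z \<bullet> \<xi>)) \<partial>lborel)"
    unfolding osc_def using Bochner_Integration.integral_add[OF i[of 1] i[of "-1"]] by simp
  then show "wave f z = 1 * osc q (\<lambda>\<xi>. (\<xi>, 1 * norm \<xi>)) z + 1 * osc q (\<lambda>\<xi>. (\<xi>, -1 * norm \<xi>)) z"
    by (simp only: wave_def integral_mult_right_zero times_complex.sel Re_complex_of_real Im_complex_of_real) simp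
qed

lemma osc_sum:
  assumes "finite A" "\<And>a. a \<in> A \<Longrightarrow> moments (q a) \<Phi>"
  shows "(\<Sum>a\<in>A. osc (q a) \<Phi> z) = osc (\<lambda>\<xi>. \<Sum>a\<in>A. q a \<xi>) \<Phi> z"
proof (cases "A = {}")
  case False
  then obtain a where "a \<in> A" by blast
  then have [measurable]: "\<Phi> \<in> borel_measurable borel"
    using assms(2) by (auto simp: moments_def)
  have "integrable lborel (\<lambda>\<xi>. q a \<xi> * cis (z \<bullet> \<Phi> \<xi>))" if "a \<in> A" for a
    by (intro integrable_mult_cis moments_integrable[OF assms(2)] that) measurable
  then show ?thesis
    unfolding osc_def by (simp add: sum_distrib_right Bochner_Integration.integral_sum)
qed (simp add: osc_def)

text \<open>The phases lie on the light cone: the squared time frequency equals the sum of the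
  squared space frequencies, so both sides multiply the amplitude by -|xi|^2.\<close>

lemma osc_wave_equation:
  fixes q :: "'a::euclidean_space \<Rightarrow> complex"
  assumes m: "moments q (\<lambda>\<xi>. (\<xi>, r * norm \<xi>))" and r: "\<bar>r\<bar> = 1"
  shows "dd (0, 1) (dd (0, 1) (osc q (\<lambda>\<xi>. (\<xi>, r * norm \<xi>)))) p
     = (\<Sum>b\<in>Basis. dd (b, 0) (dd (b, 0) (osc q (\<lambda>\<xi>. (\<xi>, r * norm \<xi>)))) p)"
proof -
  let ?\<Phi> = "\<lambda>\<xi>::'a. (\<xi>, r * norm \<xi>)"
  have r2: "r * r = 1" using r by (metis abs_mult_self_eq mult_1)
  have "(\<Sum>b\<in>Basis. dd (b, 0) (dd (b, 0) (osc q ?\<Phi>)) p)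
    = (\<Sum>b\<in>Basis. osc (\<lambda>\<xi>. q \<xi> * (\<i> * of_real ((b, 0) \<bullet> ?\<Phi> \<xi>)) * (\<i> * of_real ((b, 0) \<bullet> ?\<Phi> \<xi>))) ?\<Phi> p)"
    by (simp only: dd_osc[OF m] dd_osc[OF moments_dd[OF m]])
  also have "\<dots> = osc (\<lambda>\<xi>. \<Sum>b\<in>Basis. q \<xi> * (\<i> * of_real ((b, 0) \<bullet> ?\<Phi> \<xi>)) * (\<i> * of_real ((b, 0) \<bullet> ?\<Phi> \<xi>))) ?\<Phi> p"
    by (intro osc_sum moments_dd m) simp
  also have "(\<lambda>\<xi>. \<Sum>b\<in>Basis. q \<xi> * (\<i> * of_real ((b, 0) \<bullet> ?\<Phi> \<xi>)) * (\<i> * of_real ((b, 0) \<bullet> ?\<Phi> \<xi>)))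
     = (\<lambda>\<xi>. q \<xi> * (\<i> * of_real ((0, 1) \<bullet> ?\<Phi> \<xi>)) * (\<i> * of_real ((0, 1) \<bullet> ?\<Phi> \<xi>)))"
  proof
    fix \<xi> :: 'a
    have "(\<Sum>b\<in>Basis. q \<xi> * (\<i> * of_real ((b, 0) \<bullet> ?\<Phi> \<xi>)) * (\<i> * of_real ((b, 0) \<bullet> ?\<Phi> \<xi>)))
        = - q \<xi> * of_real (\<Sum>b\<in>Basis. (\<xi> \<bullet> b)\<^sup>2)"
      unfolding of_real_sum sum_distrib_left
      by (rule sum.cong) (simp_all add: inner_prod_def inner_commute[of \<xi>] power2_eq_square algebra_simps)
    also have "\<dots> = - q \<xi> * of_real ((r * r) * (norm \<xi>)\<^sup>2)"
      by (simp add: norm_sq_Basis r2)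
    also have "\<dots> = q \<xi> * (\<i> * of_real ((0, 1) \<bullet> ?\<Phi> \<xi>)) * (\<i> * of_real ((0, 1) \<bullet> ?\<Phi> \<xi>))"
      by (simp add: inner_prod_def power2_eq_square algebra_simps)
    finally show "(\<Sum>b\<in>Basis. q \<xi> * (\<i> * of_real ((b, 0) \<bullet> ?\<Phi> \<xi>)) * (\<i> * of_real ((b, 0) \<bullet> ?\<Phi> \<xi>)))
       = q \<xi> * (\<i> * of_real ((0, 1) \<bullet> ?\<Phi> \<xi>)) * (\<i> * of_real ((0, 1) \<bullet> ?\<Phi> \<xi>))" .
  qed
  also have "osc (\<lambda>\<xi>. q \<xi> * (\<i> * of_real ((0, 1) \<bullet> ?\<Phi> \<xi>)) * (\<i> * of_real ((0, 1) \<bullet> ?\<Phi> \<xi>))) ?\<Phi> p = dd (0, 1) (dd (0, 1) (osc q ?\<Phi>)) p"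
    by (simp only: dd_osc[OF m] dd_osc[OF moments_dd[OF m]])
  finally show ?thesis by simp
qed

lemma dd_lincomb:
  assumes "C_inf g" "C_inf h"
  shows "dd v (\<lambda>x. a * g x + b * h x) = (\<lambda>x. a * dd v g x + b * dd v h x)"
  by (rule ext, rule dd_eq) (auto intro!: derivative_intros C_inf_has_derivative assms)

theorem wave_exists:
  fixes f :: "'a::euclidean_space \<Rightarrow> real"
  assumes f: "test_fun f"
  shows "C_inf (wave f)"
    and "dd (0, 1) (dd (0, 1) (wave f)) p - (\<Sum>b\<in>Basis. dd (b, 0) (dd (b, 0) (wave f)) p) = 0"
    and "wave f (x, 0) = f x"
    and "dd (0, 1) (wave f) (x, 0) = 0"
proof -
  define q where "q = (\<lambda>\<xi>. of_real (1 / (2 * (2 * pi) ^ DIM('a))) * FTR f \<xi>)"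
  let ?P = "\<lambda>r \<xi>::'a. (\<xi>, r * norm \<xi>)"
  let ?o = "\<lambda>r. osc q (?P r)"
  have w: "wave f = (\<lambda>z. 1 * ?o 1 z + 1 * ?o (-1) z)"
    unfolding q_def by (rule wave_eq_osc[OF f])
  have m: "moments q (?P r)" if "\<bar>r\<bar> = 1" for r
    unfolding q_def by (rule moments_wave[OF f that])
  have Ci: "C_inf (?o r)" if "\<bar>r\<bar> = 1" for r
    by (rule C_inf_osc[OF m[OF that]])
  show "C_inf (wave f)"
    unfolding w by (intro C_inf_lincomb Ci) auto
  have d1: "dd v (wave f) = (\<lambda>z. 1 * dd v (?o 1) z + 1 * dd v (?o (-1)) z)" for v
    unfolding w by (intro dd_lincomb Ci) auto
  have Cid: "C_inf (dd v (?o r))" if "\<bar>r\<bar> = 1" for r v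
    unfolding dd_osc[OF m[OF that]] by (intro C_inf_osc moments_dd m that)
  have d2: "dd v (dd v (wave f)) = (\<lambda>z. 1 * dd v (dd v (?o 1)) z + 1 * dd v (dd v (?o (-1))) z)" for v
    unfolding d1 by (intro dd_lincomb Cid) auto
  show "dd (0, 1) (dd (0, 1) (wave f)) p - (\<Sum>b\<in>Basis. dd (b, 0) (dd (b, 0) (wave f)) p) = 0"
    unfolding d2 by (simp add: sum.distrib osc_wave_equation[OF m, of 1, simplified] osc_wave_equation[OF m, of "-1", simplified])
  show "wave f (x, 0) = f x"
    using test_fun_fourier_inversion[OF f, of x] by (simp add: wave_def)
  \<comment> \<open>The two half-waves have opposite time frequencies, so their velocities cancel at
    t = 0.\<close>
  have "dd (0, 1) (wave f) (x, 0) = osc (\<lambda>\<xi>. q \<xi> * (\<i> * of_real (norm \<xi>))) (?P 1) (x, 0) + osc (\<lambda>\<xi>. q \<xi> * (\<i> * of_real (- norm \<xi>))) (?P (-1)) (x, 0)"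
    unfolding d1 by (simp add: dd_osc[OF m, of 1, simplified] dd_osc[OF m, of "-1", simplified] inner_prod_def)
  also have "\<dots> = 0"
    by (simp add: osc_def inner_prod_def)
  finally show "dd (0, 1) (wave f) (x, 0) = 0" .
qed

section \<open>Uniqueness for the wave equation\<close>

lemma has_derivative_line:
  assumes "(g has_derivative g') (at (x + s *\<^sub>R b))"
  shows "((\<lambda>s. g (x + s *\<^sub>R b)) has_derivative (\<lambda>r. r *\<^sub>R g' b)) (at s)"
proof -
  have "((\<lambda>s. g (x + s *\<^sub>R b)) has_derivative (\<lambda>r. g' (r *\<^sub>R b))) (at s)"
    by (rule has_derivative_compose[of "\<lambda>s. x + s *\<^sub>R b", OF _ assms]) (auto intro!: derivative_eq_intros)
  then show ?thesis
    using linear_scale[OF has_derivative_linear[OF assms]] by simp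
qed

lemma C_inf_line_DERIV:
  assumes "C_inf g"
  shows "((\<lambda>s. g (x + s *\<^sub>R b)) has_real_derivative dd b g (x + s *\<^sub>R b)) (at s)"
  unfolding has_field_derivative_def
  by (rule has_derivative_eq_rhs[OF has_derivative_line[OF C_inf_has_derivative[OF assms]]]) (auto simp: mult.commute)

text \<open>The second difference over a parallelogram with sides h u and h v is an increment of an
  increment. One use of the mean value theorem in each direction turns it into a mixed derivative at
  an interior point.\<close>

lemma mixed_difference_mvt:
  assumes g: "C_inf g" and u: "u \<in> Basis" and h: "0 < h"
  obtains s r where "0 < s" "s < h" "0 < r" "r < h"
    "g (p + h *\<^sub>R u + h *\<^sub>R v) - g (p + h *\<^sub>R u) - g (p + h *\<^sub>R v) + g p = h * h * dd v (dd u g) (p + s *\<^sub>R u + r *\<^sub>R v)"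
proof -
  let ?F = "\<lambda>s. g ((p + h *\<^sub>R v) + s *\<^sub>R u) - g (p + s *\<^sub>R u)"
  have "\<exists>s>0. s < h \<and> ?F h - ?F 0 = (h - 0) * (dd u g ((p + h *\<^sub>R v) + s *\<^sub>R u) - dd u g (p + s *\<^sub>R u))"
    using h by (intro MVT2) (auto intro!: DERIV_diff C_inf_line_DERIV g)
  then obtain s where s: "0 < s" "s < h" "?F h - ?F 0 = h * (dd u g ((p + h *\<^sub>R v) + s *\<^sub>R u) - dd u g (p + s *\<^sub>R u))"
    by auto
  let ?G = "\<lambda>r. dd u g ((p + s *\<^sub>R u) + r *\<^sub>R v)"
  have "\<exists>r>0. r < h \<and> ?G h - ?G 0 = (h - 0) * dd v (dd u g) ((p + s *\<^sub>R u) + r *\<^sub>R v)"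
    using h by (intro MVT2) (auto intro!: C_inf_line_DERIV C_inf_dd g u)
  then obtain r where r: "0 < r" "r < h" "?G h - ?G 0 = h * dd v (dd u g) ((p + s *\<^sub>R u) + r *\<^sub>R v)"
    by auto
  from s r show thesis
    by (intro that[of s r]) (auto simp: algebra_simps)
qed

text \<open>The second difference does not depend on the order of the directions, so the two mixed
  derivatives take a common value at points that approach p; continuity gives equality at p.\<close>

lemma dd_commute:
  assumes g: "C_inf g" and u: "u \<in> Basis" and v: "v \<in> Basis"
  shows "dd u (dd v g) p = dd v (dd u g) p"
proof -
  let ?e = "\<lambda>k. 1 / real (Suc k)"
  have "\<exists>s r s' r'. 0 < s \<and> s < ?e k \<and> 0 < r \<and> r < ?e k \<and> 0 < s' \<and> s' < ?e k \<and> 0 < r' \<and> r' < ?e k \<and>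
     dd v (dd u g) (p + s *\<^sub>R u + r *\<^sub>R v) = dd u (dd v g) (p + s' *\<^sub>R v + r' *\<^sub>R u)" for k
  proof -
    have e: "0 < ?e k" by simp
    obtain s r where 1: "0 < s" "s < ?e k" "0 < r" "r < ?e k"
      "g (p + ?e k *\<^sub>R u + ?e k *\<^sub>R v) - g (p + ?e k *\<^sub>R u) - g (p + ?e k *\<^sub>R v) + g p = ?e k * ?e k * dd v (dd u g) (p + s *\<^sub>R u + r *\<^sub>R v)"
      using mixed_difference_mvt[OF g u e] by metis
    obtain s' r' where 2: "0 < s'" "s' < ?e k" "0 < r'" "r' < ?e k"
      "g (p + ?e k *\<^sub>R v + ?e k *\<^sub>R u) - g (p + ?e k *\<^sub>R v) - g (p + ?e k *\<^sub>R u) + g p = ?e k * ?e k * dd u (dd v g) (p + s' *\<^sub>R v + r' *\<^sub>R u)"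
      using mixed_difference_mvt[OF g v e] by metis
    have "p + ?e k *\<^sub>R v + ?e k *\<^sub>R u = p + ?e k *\<^sub>R u + ?e k *\<^sub>R v" by simp
    then have "?e k * ?e k * dd v (dd u g) (p + s *\<^sub>R u + r *\<^sub>R v) = ?e k * ?e k * dd u (dd v g) (p + s' *\<^sub>R v + r' *\<^sub>R u)"
      unfolding 1(5)[symmetric] 2(5)[symmetric] by (simp add: add_ac)
    then have "dd v (dd u g) (p + s *\<^sub>R u + r *\<^sub>R v) = dd u (dd v g) (p + s' *\<^sub>R v + r' *\<^sub>R u)"
      using e by simp
    with 1 2 show ?thesis by blast
  qed
  then obtain s r s' r' where *: "\<And>k. 0 < s k \<and> s k < ?e k \<and> 0 < r k \<and> r k < ?e k \<and> 0 < s' k \<and> s' k < ?e k \<and> 0 < r' k \<and> r' k < ?e k \<and>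
     dd v (dd u g) (p + s k *\<^sub>R u + r k *\<^sub>R v) = dd u (dd v g) (p + s' k *\<^sub>R v + r' k *\<^sub>R u)"
    by metis
  have lim0: "q \<longlonglongrightarrow> 0" if "\<And>k. 0 < q k \<and> q k < ?e k" for q :: "nat \<Rightarrow> real"
    by (rule tendsto_sandwich[OF _ _ tendsto_const inverse_Suc_tendsto_0])
       (use that in \<open>auto intro!: always_eventually less_imp_le\<close>)
  have l: "s \<longlonglongrightarrow> 0" "r \<longlonglongrightarrow> 0" "s' \<longlonglongrightarrow> 0" "r' \<longlonglongrightarrow> 0"
    using * by (auto intro!: lim0)
  have "(\<lambda>k. dd v (dd u g) (p + s k *\<^sub>R u + r k *\<^sub>R v)) \<longlonglongrightarrow> dd v (dd u g) (p + 0 *\<^sub>R u + 0 *\<^sub>R v)"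
    by (rule continuous_on_tendsto_compose[OF C_inf_continuous[OF C_inf_dd[OF C_inf_dd[OF g u] v]]]) ((rule tendsto_eq_intros l refl | simp)+)
  moreover have "(\<lambda>k. dd u (dd v g) (p + s' k *\<^sub>R v + r' k *\<^sub>R u)) \<longlonglongrightarrow> dd u (dd v g) (p + 0 *\<^sub>R v + 0 *\<^sub>R u)"
    by (rule continuous_on_tendsto_compose[OF C_inf_continuous[OF C_inf_dd[OF C_inf_dd[OF g v] u]]]) ((rule tendsto_eq_intros l refl | simp)+)
  ultimately show ?thesis
    using * by (simp add: LIMSEQ_unique)
qed

text \<open>On t = 0 both g and its derivative vanish, so the difference quotient of the truncated
  function is bounded by that of g and tends to 0. Elsewhere the function is locally g or locally 0.
  The sign of \<open>\<sigma>\<close> selects the half space that is kept.\<close>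

lemma has_derivative_half_space:
  fixes g :: "'a::euclidean_space \<times> real \<Rightarrow> real"
  assumes D: "\<And>p. (g has_derivative D p) (at p)"
    and 0: "\<And>x. g (x, 0) = 0" "\<And>x v. D (x, 0) v = 0" and \<sigma>: "\<sigma> \<noteq> 0"
  shows "((\<lambda>p. if - \<sigma> * snd p \<le> 0 then g p else 0) has_derivative (\<lambda>v. if - \<sigma> * snd p \<le> 0 then D p v else 0)) (at p)"
proof -
  consider "- \<sigma> * snd p < 0" | "- \<sigma> * snd p > 0" | "snd p = 0"
    using \<sigma> by (metis linorder_neqE_linordered_idom mult_eq_0_iff neg_equal_0_iff_equal)
  then show ?thesis
  proof cases
    case 1
    have o: "open {q :: 'a \<times> real. - \<sigma> * snd q < 0}"
      by (intro open_Collect_less continuous_intros)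
    have "((\<lambda>p. if - \<sigma> * snd p \<le> 0 then g p else 0) has_derivative D p) (at p)"
      by (rule has_derivative_transform_within_open[OF D o]) (use 1 in auto)
    then show ?thesis using 1 by simp
  next
    case 2
    have o: "open {q :: 'a \<times> real. 0 < - \<sigma> * snd q}"
      by (intro open_Collect_less continuous_intros)
    have "((\<lambda>p. if - \<sigma> * snd p \<le> 0 then g p else 0) has_derivative (\<lambda>v. 0)) (at p)"
      by (rule has_derivative_transform_within_open[OF has_derivative_const o, of _ 0]) (use 2 in auto)
    then show ?thesis using 2 by simp
  next
    case 3
    obtain x where p: "p = (x, 0)" using 3 by (cases p) auto
    have D0: "D p = (\<lambda>v. 0)" using 0 p by auto
    then have d0: "((\<lambda>h. norm (g (p + h) - g p - 0) / norm h) \<longlongrightarrow> 0) (at 0)"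
      using D[of p] unfolding has_derivative_at by simp
    have L: "((\<lambda>h. norm ((if - \<sigma> * snd (p + h) \<le> 0 then g (p + h) else 0) - (if - \<sigma> * snd p \<le> 0 then g p else 0) - 0) / norm h) \<longlongrightarrow> 0) (at 0)"
      by (rule tendsto_sandwich[OF _ _ tendsto_const d0])
         (use 0 p in \<open>auto intro!: always_eventually divide_right_mono\<close>)
    have E: "(\<lambda>v. if - \<sigma> * snd p \<le> 0 then D p v else 0) = (\<lambda>v. 0)"
      using D0 by auto
    show ?thesis
      unfolding E has_derivative_at using L by (simp only: bounded_linear_zero simp_thms)
  qed
qed

lemma continuous_half_space:
  fixes g :: "'a::euclidean_space \<times> real \<Rightarrow> real"
  assumes "continuous_on UNIV g" "\<And>x. g (x, 0) = 0" "\<sigma> \<noteq> 0"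
  shows "continuous_on UNIV (\<lambda>p. if - \<sigma> * snd p \<le> 0 then g p else 0)"
  by (rule continuous_on_cases_le)
     (use assms in \<open>auto intro!: continuous_intros intro: continuous_on_subset\<close>)

text \<open>The function \<open>s \<mapsto> (max 0 s)\<^sup>2\<close> is the \<open>C\<^sup>1\<close> cutoff used to localise the energy to a light cone.\<close>

lemma DERIV_max_sq: "((\<lambda>s::real. (max 0 s)\<^sup>2) has_real_derivative 2 * max 0 s) (at s)"
proof -
  consider "s < 0" | "s > 0" | "s = 0" by linarith
  then show ?thesis
  proof cases
    case 1
    have "((\<lambda>s::real. (max 0 s)\<^sup>2) has_real_derivative 0) (at s)"
      by (rule has_field_derivative_transform_within_open[OF DERIV_const[of 0], where S="{..<0}"]) (use 1 in auto)
    then show ?thesis using 1 by simp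
  next
    case 2
    have "((\<lambda>s::real. (max 0 s)\<^sup>2) has_real_derivative 2 * s) (at s)"
      by (rule has_field_derivative_transform_within_open[where f="\<lambda>s. s\<^sup>2" and S="{0<..}"])
         (use 2 in \<open>auto intro!: derivative_eq_intros\<close>)
    then show ?thesis using 2 by simp
  next
    case 3
    have "((\<lambda>h. ((max 0 h)\<^sup>2 - 0) / h) \<longlongrightarrow> 0) (at (0::real))"
    proof (rule tendsto_0_le[where K=1])
      show "((\<lambda>h::real. h) \<longlongrightarrow> 0) (at 0)" by (rule tendsto_ident_at)
      show "\<forall>\<^sub>F h in at (0::real). norm (((max 0 h)\<^sup>2 - 0) / h) \<le> norm h * 1"
        by (auto intro!: always_eventually simp: power2_eq_square max_def)
    qed
    then show ?thesis unfolding DERIV_def using 3 by simp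
  qed
qed

lemma continuous_nonneg_integral_zero:
  fixes g :: "'a::euclidean_space \<Rightarrow> real"
  assumes c: "continuous_on UNIV g" and i: "integrable lborel g" and n: "\<And>x. 0 \<le> g x"
    and 0: "(\<integral>x. g x \<partial>lborel) = 0"
  shows "g x = 0"
proof -
  have "AE x in lborel. g x = 0"
    using integral_nonneg_eq_0_iff_AE[OF i] n 0 by simp
  then have "AE x in lebesgue. x \<in> {x. g x = 0}"
    by (intro AE_completion) simp
  moreover have "closed {x. g x = 0}"
    by (intro closed_Collect_eq c continuous_intros)
  ultimately show ?thesis
    using mem_closed_if_AE_lebesgue by blast
qed

text \<open>A weighted energy density minus energy flux is a divergence, so it integrates to 0 over
  the half space. The weight \<open>\<psi>'\<close> is supported where \<open>s\<close> is positive,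
  a smoothed backward cone seen from the side of \<open>t0\<close>. The integrand is nonnegative
  because \<open>\<rho>\<close> has slope at most 1, so it vanishes identically; at (x0, t0), where
  \<open>\<rho>'\<close> is 0, it reduces to the full energy density of w.\<close>

lemma wave_unique_point:
  fixes w :: "'a::euclidean_space \<times> real \<Rightarrow> real"
  assumes w: "C_inf w"
    and eq: "\<And>p. dd (0, 1) (dd (0, 1) w) p - (\<Sum>b\<in>Basis. dd (b, 0) (dd (b, 0) w) p) = 0"
    and 0: "\<And>x. w (x, 0) = 0" "\<And>x. dd (0, 1) w (x, 0) = 0" and t0: "t0 \<noteq> 0"
  shows "dd (0, 1) w (x0, t0) = 0"
proof -
  \<comment> \<open>The orientation of time: forward and backward uniqueness are treated at once in
    the half space that contains \<open>t0\<close>.\<close>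
  define \<sigma> where "\<sigma> = sgn t0"
  have \<sigma>: "\<sigma> \<noteq> 0" "\<sigma> * \<sigma> = 1" "\<sigma> * t0 = \<bar>t0\<bar>" using t0 by (auto simp: \<sigma>_def sgn_if)
  \<comment> \<open>Since \<open>\<rho> x0 = 1\<close>, the margin 2 gives
    \<open>s (x0, t0) = 1\<close>, so the cutoff is positive at the point of interest.\<close>
  define T where "T = \<bar>t0\<bar> + 2"
  \<comment> \<open>A smooth substitute for the distance to x0. Its gradient has length at most 1,
    which is what makes the boundary terms of the energy identity favourable.\<close>
  define \<rho> where "\<rho> x = sqrt (1 + (norm (x - x0))\<^sup>2)" for x
  define \<rho>' where "\<rho>' x v = ((x - x0) \<bullet> v) / \<rho> x" for x v
  define s where "s p = T - \<sigma> * snd p - \<rho> (fst p)" for p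
  define wt where "wt = dd (0, 1) w"
  define wb where "wb b = dd (b, 0) w" for b
  define \<psi> where "\<psi> p = (max 0 (s p))\<^sup>2" for p
  define \<psi>' where "\<psi>' p = 2 * max 0 (s p)" for p
  have Bt: "(0, 1) \<in> (Basis :: ('a \<times> real) set)" and Bb: "\<And>b. b \<in> Basis \<Longrightarrow> (b, 0) \<in> (Basis :: ('a \<times> real) set)"
    by (auto simp: Basis_prod_def)
  have \<rho>1: "1 \<le> \<rho> x" for x
    by (simp add: \<rho>_def)
  have \<rho>_ge: "norm (x - x0) \<le> \<rho> x" for x
    unfolding \<rho>_def by (rule real_le_rsqrt) simp
  have d\<rho>: "(\<rho> has_derivative \<rho>' x) (at x)" for x
  proof -
    have pos: "1 + (x - x0) \<bullet> (x - x0) > 0"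
      by (simp add: add_pos_nonneg)
    have e: "\<rho> = (\<lambda>x. sqrt (1 + (x - x0) \<bullet> (x - x0)))"
      by (auto simp: \<rho>_def power2_norm_eq_inner)
    have 1: "((\<lambda>x. 1 + (x - x0) \<bullet> (x - x0)) has_derivative (\<lambda>v. 2 * ((x - x0) \<bullet> v))) (at x)"
      by (auto intro!: derivative_eq_intros simp: inner_commute)
    have 2: "(sqrt has_derivative (*) (inverse (sqrt (1 + (x - x0) \<bullet> (x - x0))) / 2)) (at (1 + (x - x0) \<bullet> (x - x0)))"
      using DERIV_real_sqrt[OF pos] by (simp only: has_field_derivative_def)
    have "(\<rho> has_derivative (\<lambda>v. inverse (sqrt (1 + (x - x0) \<bullet> (x - x0))) / 2 * (2 * ((x - x0) \<bullet> v)))) (at x)"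
      unfolding e by (rule has_derivative_compose[OF 1 2])
    moreover have "(\<lambda>v. inverse (sqrt (1 + (x - x0) \<bullet> (x - x0))) / 2 * (2 * ((x - x0) \<bullet> v))) = \<rho>' x"
    proof
      have h: "inverse r / 2 * (2 * c) = c / r" for r c :: real
        by (simp add: divide_simps)
      show "inverse (sqrt (1 + (x - x0) \<bullet> (x - x0))) / 2 * (2 * ((x - x0) \<bullet> v)) = \<rho>' x v" for v
        unfolding h by (simp add: \<rho>'_def e)
    qed
    ultimately show ?thesis by simp
  qed
  have c\<rho>: "continuous_on UNIV \<rho>"
    using d\<rho> by (meson continuous_at_imp_continuous_on has_derivative_continuous)
  have ds: "(s has_derivative (\<lambda>v. - \<sigma> * snd v - \<rho>' (fst p) (fst v))) (at p)" for p
    unfolding s_def[abs_def]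
    by (auto intro!: derivative_eq_intros has_derivative_compose[OF _ d\<rho>, of fst])
  have d\<psi>: "(\<psi> has_derivative (\<lambda>v. \<psi>' p * (- \<sigma> * snd v - \<rho>' (fst p) (fst v)))) (at p)" for p
    using has_derivative_compose[OF ds DERIV_max_sq[unfolded has_field_derivative_def]]
    unfolding \<psi>_def[abs_def] \<psi>'_def[abs_def] by (simp add: mult.commute)
  have cs: "continuous_on UNIV s"
    using ds by (meson continuous_at_imp_continuous_on has_derivative_continuous)
  have c\<psi>: "continuous_on UNIV \<psi>" "continuous_on UNIV \<psi>'"
    unfolding \<psi>_def[abs_def] \<psi>'_def[abs_def] by (intro continuous_intros cs)+
  have c\<rho>': "continuous_on UNIV (\<lambda>p. \<rho>' (fst p) v)" for v
    unfolding \<rho>'_def using \<rho>1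
    by (intro continuous_intros continuous_on_compose2[OF c\<rho>]) (auto, metis not_one_le_zero)
  define bt where "bt = (0::'a, 1::real)"
  have Cwt: "C_inf wt" and Cwb: "\<And>b. b \<in> Basis \<Longrightarrow> C_inf (wb b)"
    unfolding wt_def wb_def by (intro C_inf_dd w Bt Bb; simp)+
  have wt0: "wt (x, 0) = 0" for x by (simp add: wt_def 0)
  \<comment> \<open>Lines in a space direction stay in the initial plane, where w is 0.\<close>
  have wb0: "wb b (x, 0) = 0" for b x
  proof -
    have "((\<lambda>r. w ((x, 0) + r *\<^sub>R (b, 0))) has_real_derivative dd (b, 0) w ((x, 0) + 0 *\<^sub>R (b, 0))) (at 0)"
      by (rule C_inf_line_DERIV[OF w])
    then have "((\<lambda>r::real. 0::real) has_real_derivative dd (b, 0) w (x, 0)) (at 0)"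
      by (simp add: 0 zero_prod_def[symmetric])
    then show ?thesis
      unfolding wb_def using DERIV_unique[OF _ DERIV_const] by blast
  qed
  text \<open>Products \<open>\<psi> \<alpha> \<beta>\<close> of first derivatives of \<open>w\<close> extend by zero across \<open>t = 0\<close> as \<open>C\<^sup>1\<close> functions
    and have compact support in the half space, so their derivatives integrate to zero.\<close>
  have flux: "integrable lborel (\<lambda>p. if - \<sigma> * snd p \<le> 0 then \<psi>' p * (- \<sigma> * snd v - \<rho>' (fst p) (fst v)) * (\<alpha> p * \<beta> p) + \<psi> p * (\<alpha> p * dd v \<beta> p + dd v \<alpha> p * \<beta> p) else 0)" (is "integrable lborel ?f")
    and flux0: "(\<integral>p. (if - \<sigma> * snd p \<le> 0 then \<psi>' p * (- \<sigma> * snd v - \<rho>' (fst p) (fst v)) * (\<alpha> p * \<beta> p) + \<psi> p * (\<alpha> p * dd v \<beta> p + dd v \<alpha> p * \<beta> p) else 0) \<partial>lborel) = 0"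
    and fluxc: "continuous_on UNIV (\<lambda>p. if - \<sigma> * snd p \<le> 0 then \<psi>' p * (- \<sigma> * snd v - \<rho>' (fst p) (fst v)) * (\<alpha> p * \<beta> p) + \<psi> p * (\<alpha> p * dd v \<beta> p + dd v \<alpha> p * \<beta> p) else 0)"
    if \<alpha>: "C_inf \<alpha>" "\<And>x. \<alpha> (x, 0) = 0" and \<beta>: "C_inf \<beta>" "\<And>x. \<beta> (x, 0) = 0" and v: "v \<in> Basis" for \<alpha> \<beta> v
  proof -
    let ?D = "\<lambda>p v. \<psi>' p * (- \<sigma> * snd v - \<rho>' (fst p) (fst v)) * (\<alpha> p * \<beta> p) + \<psi> p * (\<alpha> p * dd v \<beta> p + dd v \<alpha> p * \<beta> p)"
    have d: "((\<lambda>p. \<psi> p * (\<alpha> p * \<beta> p)) has_derivative ?D p) (at p)" for p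
      by (rule derivative_eq_intros d\<psi> C_inf_has_derivative \<alpha> \<beta> refl)+ (auto simp: algebra_simps)
    have d': "((\<lambda>p. if - \<sigma> * snd p \<le> 0 then \<psi> p * (\<alpha> p * \<beta> p) else 0) has_derivative (\<lambda>v. if - \<sigma> * snd p \<le> 0 then ?D p v else 0)) (at p)" for p
      by (rule has_derivative_half_space[OF d]) (use \<alpha> \<beta> \<sigma> in auto)
    show c: "continuous_on UNIV ?f"
      by (rule continuous_half_space)
         (use \<alpha> \<beta> \<sigma> v in \<open>auto intro!: continuous_intros c\<psi> c\<rho>' C_inf_continuous[OF \<alpha>(1)] C_inf_continuous[OF \<beta>(1)]
             C_inf_continuous[OF C_inf_dd[OF \<alpha>(1) v]] C_inf_continuous[OF C_inf_dd[OF \<beta>(1) v]]\<close>)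
    \<comment> \<open>In the chosen half space \<open>s p \<ge> 0\<close> confines both \<rho> and
      the time to at most T. Without the truncation at t = 0 the set where \<open>s\<close> is
      positive would be unbounded.\<close>
    have s_neg: "s p < 0" if "norm x0 + 2 * T < norm p" "- \<sigma> * snd p \<le> 0" for p
    proof (rule ccontr)
      assume "\<not> s p < 0"
      then have "\<sigma> * snd p + \<rho> (fst p) \<le> T" by (simp add: s_def)
      then have 1: "\<rho> (fst p) \<le> T" "\<sigma> * snd p \<le> T" using that(2) \<rho>1[of "fst p"] by auto
      have "norm (fst p) \<le> norm (fst p - x0) + norm x0"
        by (metis diff_add_cancel norm_triangle_ineq)
      then have 2: "norm (fst p) \<le> T + norm x0" using \<rho>_ge[of "fst p"] 1 by linarith
      have "\<bar>\<sigma>\<bar> = 1" using t0 by (auto simp: \<sigma>_def sgn_if)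
      then have "\<bar>snd p\<bar> = \<bar>\<sigma> * snd p\<bar>" by (simp add: abs_mult)
      then have "\<bar>snd p\<bar> \<le> T" using 1 that(2) by simp
      moreover have "norm p \<le> norm (fst p) + norm (snd p)"
        using norm_Pair_le[of "fst p" "snd p"] by simp
      ultimately show False using 2 that(1) by simp
    qed
    have R0: "(if - \<sigma> * snd p \<le> 0 then \<psi> p * (\<alpha> p * \<beta> p) else 0) = 0" "?f p = 0" if "norm x0 + 2 * T < norm p" for p
      using s_neg[OF that] by (auto simp: \<psi>_def \<psi>'_def)
    show "(\<integral>p. ?f p \<partial>lborel) = 0"
      by (rule integral_derivative_eq_0[OF d' c R0])
    show "integrable lborel ?f"
      by (rule integrable_bounded_support[OF c R0(2)])
  qed
  define Q where "Q p = (\<Sum>b\<in>Basis. \<rho>' (fst p) b * wb b p)" for p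
  define S where "S p = (\<Sum>b\<in>Basis. (wb b p)\<^sup>2)" for p
  define I where "I p = (if - \<sigma> * snd p \<le> 0 then \<psi>' p * (((wt p)\<^sup>2 + S p) / 2 - \<sigma> * wt p * Q p) else 0)" for p
  \<comment> \<open>\<open>?J \<alpha> \<beta> v\<close> is the derivative of \<psi> \<alpha>
    \<beta> along v, cut off to the half space. The combination in \<open>I_eq\<close> is the time
    derivative of \<psi> times the energy density minus the space divergence of \<psi>
    \<open>wt\<close> times the gradient of w. All second derivatives of w cancel, by the wave
    equation and by \<open>dd_commute\<close>, so that only terms with \<open>\<psi>'\<close>
    remain.\<close>
  let ?J = "\<lambda>\<alpha> \<beta> v p. (if - \<sigma> * snd p \<le> 0 then \<psi>' p * (- \<sigma> * snd v - \<rho>' (fst p) (fst v)) * (\<alpha> p * \<beta> p) + \<psi> p * (\<alpha> p * dd v \<beta> p + dd v \<alpha> p * \<beta> p) else 0)"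
  have I_eq: "I p = - \<sigma> * (?J wt wt (0, 1) p / 2 + (\<Sum>b\<in>Basis. ?J (wb b) (wb b) (0, 1) p / 2) - (\<Sum>b\<in>Basis. ?J wt (wb b) (b, 0) p))" for p
  proof (cases "- \<sigma> * snd p \<le> 0")
    case True
    have c: "dd (0, 1) (wb b) p = dd (b, 0) wt p" if "b \<in> Basis" for b
      unfolding wb_def wt_def by (rule dd_commute[OF w Bt Bb[OF that]])
    have r0: "\<rho>' x 0 = 0" for x by (simp add: \<rho>'_def)
    have e: "dd (0, 1) wt p = (\<Sum>b\<in>Basis. dd (b, 0) (wb b) p)"
      using eq[of p] by (simp add: wt_def wb_def)
    have 1: "?J wt wt (0, 1) p / 2 = - \<sigma> * \<psi>' p * (wt p)\<^sup>2 / 2 + \<psi> p * wt p * (\<Sum>b\<in>Basis. dd (b, 0) (wb b) p)"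
      using True e by (simp add: r0 power2_eq_square field_simps)
    have 2: "(\<Sum>b\<in>Basis. ?J (wb b) (wb b) (0, 1) p / 2) = (\<Sum>b\<in>Basis. - \<sigma> * \<psi>' p / 2 * (wb b p)\<^sup>2 + \<psi> p * (wb b p * dd (b, 0) wt p))"
      using True by (intro sum.cong) (auto simp: r0 c power2_eq_square field_simps)
    have 3: "(\<Sum>b\<in>Basis. ?J wt (wb b) (b, 0) p) = (\<Sum>b\<in>Basis. - \<psi>' p * wt p * (\<rho>' (fst p) b * wb b p) + (\<psi> p * wt p * dd (b, 0) (wb b) p + \<psi> p * (wb b p * dd (b, 0) wt p)))"
      using True by (intro sum.cong) (auto simp: algebra_simps)
    have 4: "?J wt wt (0, 1) p / 2 + (\<Sum>b\<in>Basis. ?J (wb b) (wb b) (0, 1) p / 2) - (\<Sum>b\<in>Basis. ?J wt (wb b) (b, 0) p)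
       = - \<sigma> * \<psi>' p * ((wt p)\<^sup>2 + S p) / 2 + \<psi>' p * wt p * Q p"
      unfolding 1 2 3 sum.distrib sum_distrib_left[symmetric] S_def[symmetric] Q_def[symmetric]
      by (simp add: field_simps)
    have "- \<sigma> * (- \<sigma> * c * A / 2 + c * d * q) = (\<sigma> * \<sigma>) * (c * A / 2) - \<sigma> * c * d * q" for c A d q
      by (simp add: algebra_simps)
    then have "- \<sigma> * (- \<sigma> * \<psi>' p * ((wt p)\<^sup>2 + S p) / 2 + \<psi>' p * wt p * Q p) = I p"
      using True by (simp only: \<sigma>(2) I_def if_True) (simp add: algebra_simps)
    then show ?thesis
      unfolding 4 by simp
  next
    case False
    then show ?thesis by (simp add: I_def)
  qed
  have fl: "integrable lborel (?J wt wt (0, 1))" "(\<integral>p. ?J wt wt (0, 1) p \<partial>lborel) = 0" "continuous_on UNIV (?J wt wt (0, 1))"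
    by (rule flux flux0 fluxc; intro Cwt wt0 Bt)+
  have flb: "integrable lborel (?J (wb b) (wb b) (0, 1))" "(\<integral>p. ?J (wb b) (wb b) (0, 1) p \<partial>lborel) = 0" "continuous_on UNIV (?J (wb b) (wb b) (0, 1))" if "b \<in> Basis" for b
    by (rule flux flux0 fluxc; intro Cwb wb0 Bt that)+
  have fltb: "integrable lborel (?J wt (wb b) (b, 0))" "(\<integral>p. ?J wt (wb b) (b, 0) p \<partial>lborel) = 0" "continuous_on UNIV (?J wt (wb b) (b, 0))" if "b \<in> Basis" for b
    by (rule flux flux0 fluxc; intro Cwb wb0 Cwt wt0 Bb that)+
  have I_int: "integrable lborel I"
    unfolding I_eq[abs_def] using fl flb fltb
    by (intro integrable_mult_right Bochner_Integration.integrable_diff Bochner_Integration.integrable_add Bochner_Integration.integrable_sum integrable_divide) auto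
  have I_0: "(\<integral>p. I p \<partial>lborel) = 0"
  proof -
    have "(\<integral>p. I p \<partial>lborel) = - \<sigma> * ((\<integral>p. ?J wt wt (0, 1) p \<partial>lborel) / 2 + (\<Sum>b\<in>Basis. (\<integral>p. ?J (wb b) (wb b) (0, 1) p \<partial>lborel) / 2) - (\<Sum>b\<in>Basis. (\<integral>p. ?J wt (wb b) (b, 0) p \<partial>lborel)))"
      unfolding I_eq using fl(1) flb(1) fltb(1)
      by (simp only: integral_mult_right_zero Bochner_Integration.integral_diff Bochner_Integration.integral_add Bochner_Integration.integral_sum
            Bochner_Integration.integrable_diff Bochner_Integration.integrable_add Bochner_Integration.integrable_sum integrable_divide integral_divide_zero)
    then show ?thesis
      using fl(2) flb(2) fltb(2) by simp
  qed
  have I_c: "continuous_on UNIV I"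
    unfolding I_eq[abs_def] by (intro continuous_intros fl flb fltb; simp)
  \<comment> \<open>Cauchy-Schwarz and the slope bound for \<rho> give that the square of Q is at
    most S; with Q^2 in place of S the quadratic form is half the square of
    \<open>wt p - \<sigma> * Q p\<close>.\<close>
  have I_nonneg: "0 \<le> I p" for p
  proof -
    have "(\<Sum>b\<in>Basis. (\<rho>' (fst p) b)\<^sup>2) = (norm (fst p - x0))\<^sup>2 / (\<rho> (fst p))\<^sup>2"
      by (simp add: \<rho>'_def norm_sq_Basis sum_divide_distrib power_divide)
    also have "\<dots> \<le> 1"
      using \<rho>_ge[of "fst p"] \<rho>1[of "fst p"] by (simp add: divide_le_eq power_mono zero_less_power)
    finally have r1: "(\<Sum>b\<in>Basis. (\<rho>' (fst p) b)\<^sup>2) \<le> 1" .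
    have "(Q p)\<^sup>2 \<le> (\<Sum>b\<in>Basis. (\<rho>' (fst p) b)\<^sup>2) * S p"
      unfolding Q_def S_def by (rule Cauchy_Schwarz_ineq_sum)
    also have "\<dots> \<le> 1 * S p"
      using r1 by (intro mult_right_mono) (auto simp: S_def sum_nonneg)
    finally have QS: "(Q p)\<^sup>2 \<le> S p" by simp
    have "(wt p - \<sigma> * Q p)\<^sup>2 = (wt p)\<^sup>2 - 2 * (\<sigma> * wt p * Q p) + (\<sigma> * \<sigma>) * (Q p)\<^sup>2"
      by (simp add: power2_eq_square algebra_simps)
    then have sq: "0 \<le> (wt p)\<^sup>2 - 2 * (\<sigma> * wt p * Q p) + (Q p)\<^sup>2"
      unfolding \<sigma>(2) by (metis mult_1 zero_le_power2)
    have "0 \<le> (A + B) / 2 - y" if "q \<le> B" "0 \<le> A - 2 * y + q" for A B y q :: real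
      using that by (simp add: field_simps)
    from this[OF QS sq] have "0 \<le> ((wt p)\<^sup>2 + S p) / 2 - \<sigma> * wt p * Q p" .
    then show ?thesis
      by (auto simp: I_def \<psi>'_def)
  qed
  have "I (x0, t0) = 0"
    by (rule continuous_nonneg_integral_zero[OF I_c I_int I_nonneg I_0])
  moreover have "Q (x0, t0) = 0" "\<psi>' (x0, t0) = 2" "- \<sigma> * t0 \<le> 0"
    using \<sigma> by (auto simp: Q_def \<rho>'_def \<psi>'_def s_def T_def \<rho>_def)
  ultimately have "(wt (x0, t0))\<^sup>2 + S (x0, t0) = 0"
    by (simp add: I_def)
  moreover have "0 \<le> S (x0, t0)" by (simp add: S_def sum_nonneg)
  ultimately show ?thesis
    by (simp add: wt_def sum_power2_eq_zero_iff add_nonneg_eq_0_iff)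
qed

text \<open>\<open>wave_unique_point\<close> covers t0 \<noteq> 0, and at t = 0 the velocity is 0 by
  assumption. With zero velocity everywhere, w keeps its zero initial value.\<close>

theorem wave_unique:
  fixes w :: "'a::euclidean_space \<times> real \<Rightarrow> real"
  assumes w: "C_inf w"
    and eq: "\<And>p. dd (0, 1) (dd (0, 1) w) p - (\<Sum>b\<in>Basis. dd (b, 0) (dd (b, 0) w) p) = 0"
    and 0: "\<And>x. w (x, 0) = 0" "\<And>x. dd (0, 1) w (x, 0) = 0"
  shows "w (x, t) = 0"
proof -
  have "dd (0, 1) w (x, r) = 0" for r
    using 0 wave_unique_point[OF w eq 0] by (cases "r = 0") auto
  then have "((\<lambda>r. w ((x, 0) + r *\<^sub>R (0, 1))) has_real_derivative 0) (at r)" for r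
    using C_inf_line_DERIV[OF w, of "(x, 0)" "(0, 1)" r] by simp
  then have "w ((x, 0) + t *\<^sub>R (0, 1)) = w ((x, 0) + 0 *\<^sub>R (0, 1))"
    by (intro DERIV_isconst_all) simp
  then show ?thesis
    using 0(1)[of x] by (simp add: zero_prod_def[symmetric])
qed

section \<open>The one-dimensional energy identity\<close>

lemma exp_decay_tendsto: "0 < c \<Longrightarrow> ((\<lambda>s::real. exp (- s * c)) \<longlongrightarrow> 0) at_top"
  by (rule filterlim_compose[OF exp_at_bot])
     (auto simp: filterlim_uminus_at_bot intro!: filterlim_at_top_mult_tendsto_pos[OF tendsto_const] filterlim_ident)

text \<open>The value is 1/s - s/(s^2 + a^2), the Laplace transform of 1 - cos(a t).
  \<open>?F\<close> is the explicit antiderivative that vanishes at infinity.\<close>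

lemma nn_integral_one_minus_cos_exp:
  assumes s: "0 < s"
  shows "(\<integral>\<^sup>+t. ennreal ((1 - cos (a * t)) * exp (- s * t)) * indicator {0..} t \<partial>lborel) = ennreal (a\<^sup>2 / (s * (s\<^sup>2 + a\<^sup>2)))"
proof -
  let ?q = "s\<^sup>2 + a\<^sup>2"
  let ?F = "\<lambda>t. exp (- s * t) * ((s * cos (a * t) - a * sin (a * t)) / ?q - 1 / s)"
  have q: "?q \<noteq> 0" "0 < ?q" using s by (auto simp: add_pos_nonneg sum_power2_eq_zero_iff)
  have "(\<integral>\<^sup>+t. ennreal ((1 - cos (a * t)) * exp (- s * t)) * indicator {0..} t \<partial>lborel) = ennreal (0 - ?F 0)"
  proof (rule nn_integral_FTC_atLeast)
    fix t :: real
    have "(?F has_real_derivative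
        - s * exp (- s * t) * ((s * cos (a * t) - a * sin (a * t)) / ?q - 1 / s) + exp (- s * t) * ((- s * a * sin (a * t) - a * a * cos (a * t)) / ?q)) (at t)"
    proof -
      have "((\<lambda>t. exp (- s * t) * ((s * cos (a * t) - a * sin (a * t)) * c - d)) has_real_derivative
          - s * exp (- s * t) * ((s * cos (a * t) - a * sin (a * t)) * c - d) + exp (- s * t) * ((- s * a * sin (a * t) - a * a * cos (a * t)) * c)) (at t)" for c d
        by (auto intro!: derivative_eq_intros simp: algebra_simps)
      from this[of "1 / ?q" "1 / s"] show ?thesis by simp
    qed
    moreover have "- s * exp (- s * t) * ((s * cos (a * t) - a * sin (a * t)) / ?q - 1 / s) + exp (- s * t) * ((- s * a * sin (a * t) - a * a * cos (a * t)) / ?q)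
       = (1 - cos (a * t)) * exp (- s * t)"
    proof -
      have "- s * ((s * C - a * S) / ?q - 1 / s) + (- s * a * S - a * a * C) / ?q = 1 - C" for C S
      proof -
        have "- s * ((s * C - a * S) / ?q - 1 / s) + (- s * a * S - a * a * C) / ?q
           = 1 - (s * (s * C - a * S) + s * a * S + a * a * C) / ?q"
          using s by (simp add: algebra_simps add_divide_distrib diff_divide_distrib)
        also have "s * (s * C - a * S) + s * a * S + a * a * C = C * ?q"
          by (simp add: power2_eq_square algebra_simps)
        finally show ?thesis using q(1) by (simp only: nonzero_mult_div_cancel_right simp_thms)
      qed
      from this[of "cos (a * t)" "sin (a * t)"] have
        "exp (- s * t) * (- s * ((s * cos (a * t) - a * sin (a * t)) / ?q - 1 / s) + (- s * a * sin (a * t) - a * a * cos (a * t)) / ?q) = exp (- s * t) * (1 - cos (a * t))"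
        by simp
      then show ?thesis by (simp only: distrib_left mult_ac)
    qed
    ultimately show "(?F has_real_derivative (1 - cos (a * t)) * exp (- s * t)) (at t)"
      by simp
    show "0 \<le> (1 - cos (a * t)) * exp (- s * t)" by simp
  next
    have b: "norm ((s * cos (a * t) - a * sin (a * t)) / ?q - 1 / s) \<le> (s + \<bar>a\<bar>) / ?q + 1 / s" for t
    proof -
      have "\<bar>s * cos (a * t) - a * sin (a * t)\<bar> \<le> \<bar>s * cos (a * t)\<bar> + \<bar>a * sin (a * t)\<bar>" by linarith
      also have "\<dots> \<le> s * 1 + \<bar>a\<bar> * 1"
        using s unfolding abs_mult by (intro add_mono mult_mono) auto
      finally have "\<bar>(s * cos (a * t) - a * sin (a * t)) / ?q\<bar> \<le> (s + \<bar>a\<bar>) / ?q"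
        using q by (simp add: abs_divide divide_right_mono)
      moreover have "\<bar>1 / s\<bar> = 1 / s" using s by simp
      ultimately show ?thesis unfolding real_norm_def by linarith
    qed
    show "(?F \<longlongrightarrow> 0) at_top"
    proof (rule Lim_null_comparison)
      show "\<forall>\<^sub>F t in at_top. norm (?F t) \<le> exp (- t * s) * ((s + \<bar>a\<bar>) / ?q + 1 / s)"
        unfolding norm_mult by (intro always_eventually allI mult_mono b) (auto simp: mult.commute)
      show "((\<lambda>t. exp (- t * s) * ((s + \<bar>a\<bar>) / ?q + 1 / s)) \<longlongrightarrow> 0) at_top"
        by (rule tendsto_mult_left_zero[OF exp_decay_tendsto[OF s]])
    qed
  qed auto
  also have "0 - ?F 0 = a\<^sup>2 / (s * ?q)"
    using s q by (simp add: field_simps power2_eq_square)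
  finally show ?thesis .
qed

text \<open>The factor exp(-eps t)/t is the integral of exp(-s t) over s \<ge> eps. Tonelli
  exchanges the integrals and leaves a^2 / (s (s^2 + a^2)), whose antiderivative is -ln(1 +
  a^2/s^2)/2.\<close>

lemma nn_integral_frullani:
  assumes e: "0 < \<epsilon>"
  shows "(\<integral>\<^sup>+t. ennreal ((1 - cos (a * t)) * (exp (- \<epsilon> * t) / t)) * indicator {0..} t \<partial>lborel) = ennreal (ln (1 + a\<^sup>2 / \<epsilon>\<^sup>2) / 2)"
proof -
  let ?g = "\<lambda>t s. ennreal ((1 - cos (a * t)) * exp (- s * t)) * indicator {0..} t * indicator {\<epsilon>..} s"
  have inner: "ennreal ((1 - cos (a * t)) * (exp (- \<epsilon> * t) / t)) * indicator {0..} t = (\<integral>\<^sup>+s. ?g t s \<partial>lborel)" for t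
  proof (cases "0 < t")
    case True
    have "(\<integral>\<^sup>+s. ennreal ((1 - cos (a * t)) * exp (- s * t)) * indicator {\<epsilon>..} s \<partial>lborel)
        = ennreal (0 - (- ((1 - cos (a * t)) / t) * exp (- \<epsilon> * t)))"
    proof (rule nn_integral_FTC_atLeast)
      fix s
      have "((\<lambda>s. c * exp (- s * t)) has_real_derivative c * (- t * exp (- s * t))) (at s)" for c
        by (auto intro!: derivative_eq_intros)
      from this[of "- ((1 - cos (a * t)) / t)"]
      show "((\<lambda>s. - ((1 - cos (a * t)) / t) * exp (- s * t)) has_real_derivative (1 - cos (a * t)) * exp (- s * t)) (at s)"
        using True by simp
    next
      show "((\<lambda>s. - ((1 - cos (a * t)) / t) * exp (- s * t)) \<longlongrightarrow> 0) at_top"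
        by (rule tendsto_mult_right_zero[OF exp_decay_tendsto[OF True]])
    qed (use True in auto)
    then show ?thesis using True by simp
  next
    \<comment> \<open>At t = 0 the factor \<open>1 - cos (a * t)\<close> is 0, which makes the value
      of the quotient by t irrelevant; for negative t the indicator is 0.\<close>
    case False
    then show ?thesis by (cases "t = 0") auto
  qed
  have "(\<integral>\<^sup>+t. ennreal ((1 - cos (a * t)) * (exp (- \<epsilon> * t) / t)) * indicator {0..} t \<partial>lborel) = (\<integral>\<^sup>+t. (\<integral>\<^sup>+s. ?g t s \<partial>lborel) \<partial>lborel)"
    by (simp only: inner)
  also have "\<dots> = (\<integral>\<^sup>+s. (\<integral>\<^sup>+t. ?g t s \<partial>lborel) \<partial>lborel)"
    by (rule lborel_pair.Fubini'[symmetric]) measurable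
  also have "\<dots> = (\<integral>\<^sup>+s. ennreal (a\<^sup>2 / (s * (s\<^sup>2 + a\<^sup>2))) * indicator {\<epsilon>..} s \<partial>lborel)"
  proof (rule nn_integral_cong)
    fix s :: real
    show "(\<integral>\<^sup>+t. ?g t s \<partial>lborel) = ennreal (a\<^sup>2 / (s * (s\<^sup>2 + a\<^sup>2))) * indicator {\<epsilon>..} s"
      using nn_integral_one_minus_cos_exp[of s a] e by (cases "\<epsilon> \<le> s") auto
  qed
  also have "\<dots> = ennreal (0 - (- ln (1 + a\<^sup>2 / \<epsilon>\<^sup>2) / 2))"
  proof (rule nn_integral_FTC_atLeast)
    fix s assume "\<epsilon> \<le> s"
    then have s: "0 < s" using e by simp
    have p: "0 < 1 + a\<^sup>2 / s\<^sup>2" by (simp add: add_pos_nonneg)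
    have p2: "s * s + a * a > 0" "s * s + a * a \<noteq> 0" using s by (auto simp: add_pos_nonneg)
    have "((\<lambda>s. - ln (1 + a\<^sup>2 / s\<^sup>2) / 2) has_real_derivative - (1 / (1 + a\<^sup>2 / s\<^sup>2) * (- a\<^sup>2 * (2 * s) / (s\<^sup>2 * s\<^sup>2))) / 2) (at s)"
      using s p by (auto intro!: derivative_eq_intros)
    moreover have "- (1 / (1 + a\<^sup>2 / s\<^sup>2) * (- a\<^sup>2 * (2 * s) / (s\<^sup>2 * s\<^sup>2))) / 2 = a\<^sup>2 / (s * (s\<^sup>2 + a\<^sup>2))"
      using s p p2 by (simp add: divide_simps power2_eq_square)
    ultimately show "((\<lambda>s. - ln (1 + a\<^sup>2 / s\<^sup>2) / 2) has_real_derivative a\<^sup>2 / (s * (s\<^sup>2 + a\<^sup>2))) (at s)"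
      by simp
    show "0 \<le> a\<^sup>2 / (s * (s\<^sup>2 + a\<^sup>2))" using s by simp
  next
    have "((\<lambda>s::real. a\<^sup>2 / s\<^sup>2) \<longlongrightarrow> 0) at_top"
      by (intro tendsto_divide_0[OF tendsto_const] filterlim_at_top_imp_at_infinity filterlim_pow_at_top filterlim_ident) auto
    then have "((\<lambda>s. - ln (1 + a\<^sup>2 / s\<^sup>2) / 2) \<longlongrightarrow> - ln (1 + 0) / 2) at_top"
      by (intro tendsto_intros) auto
    then show "((\<lambda>s. - ln (1 + a\<^sup>2 / s\<^sup>2) / 2) \<longlongrightarrow> 0) at_top" by simp
  qed auto
  finally show ?thesis by simp
qed

lemma
  fixes a \<epsilon> :: real
  assumes e: "0 < \<epsilon>"
  shows frullani_integrable: "integrable lborel (\<lambda>t. (1 - cos (a * t)) * (exp (- \<epsilon> * t) / t * indicator {0..} t))"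
    and frullani_integral: "(\<integral>t. (1 - cos (a * t)) * (exp (- \<epsilon> * t) / t * indicator {0..} t) \<partial>lborel) = ln (1 + a\<^sup>2 / \<epsilon>\<^sup>2) / 2"
proof -
  have 0: "0 \<le> (1 - cos (a * t)) * (exp (- \<epsilon> * t) / t * indicator {0..} t)" for t
    by (cases "0 \<le> t") (auto intro!: mult_nonneg_nonneg)
  have "(\<integral>\<^sup>+t. ennreal ((1 - cos (a * t)) * (exp (- \<epsilon> * t) / t * indicator {0..} t)) \<partial>lborel)
     = (\<integral>\<^sup>+t. ennreal ((1 - cos (a * t)) * (exp (- \<epsilon> * t) / t)) * indicator {0..} t \<partial>lborel)"
    by (intro nn_integral_cong) (auto simp: indicator_def)
  also have "\<dots> = ennreal (ln (1 + a\<^sup>2 / \<epsilon>\<^sup>2) / 2)"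
    by (rule nn_integral_frullani[OF e])
  finally have "has_bochner_integral lborel (\<lambda>t. (1 - cos (a * t)) * (exp (- \<epsilon> * t) / t * indicator {0..} t)) (ln (1 + a\<^sup>2 / \<epsilon>\<^sup>2) / 2)"
    by (intro has_bochner_integral_nn_integral) (use 0 in \<open>auto\<close>)
  then show "integrable lborel (\<lambda>t. (1 - cos (a * t)) * (exp (- \<epsilon> * t) / t * indicator {0..} t))"
    "(\<integral>t. (1 - cos (a * t)) * (exp (- \<epsilon> * t) / t * indicator {0..} t) \<partial>lborel) = ln (1 + a\<^sup>2 / \<epsilon>\<^sup>2) / 2"
    by (auto simp: has_bochner_integral_iff)
qed

text \<open>The product-to-sum formula splits the kernel 1 - cos(t p) cos(t p') into the frequencies
  p - p' and p + p'. One factor 1/2 comes from this average, the other from the Frullani integral.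
  For fixed distinct p^2 and p'^2 and small eps, the value is ln|p^2 - p'^2|/2 - ln eps up to a
  vanishing error.\<close>

definition log_kernel :: "real \<Rightarrow> real \<Rightarrow> real \<Rightarrow> real" where
  "log_kernel \<epsilon> p p' = ln ((1 + (p - p')\<^sup>2 / \<epsilon>\<^sup>2) * (1 + (p + p')\<^sup>2 / \<epsilon>\<^sup>2)) / 4"

lemma log_kernel_integral:
  assumes e: "0 < \<epsilon>"
  shows "(\<integral>t. (1 - cos (t * p) * cos (t * p')) * (exp (- \<epsilon> * t) / t * indicator {0..} t) \<partial>lborel) = log_kernel \<epsilon> p p'"
proof -
  let ?W = "\<lambda>t. exp (- \<epsilon> * t) / t * indicator {0..} t"
  have h: "(1 - (x + y) / 2) * w = ((1 - x) * w + (1 - y) * w) / 2" for x y w :: real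
    by (simp add: field_simps)
  have "cos (t * p) * cos (t * p') = (cos ((p - p') * t) + cos ((p + p') * t)) / 2" for t
    by (simp add: cos_times_cos algebra_simps)
  then have "(1 - cos (t * p) * cos (t * p')) * ?W t
      = ((1 - cos ((p - p') * t)) * ?W t + (1 - cos ((p + p') * t)) * ?W t) / 2" for t
    using h by (simp only:)
  then have "(\<integral>t. (1 - cos (t * p) * cos (t * p')) * ?W t \<partial>lborel) = (ln (1 + (p - p')\<^sup>2 / \<epsilon>\<^sup>2) / 2 + ln (1 + (p + p')\<^sup>2 / \<epsilon>\<^sup>2) / 2) / 2"
    using frullani_integrable[OF e] frullani_integral[OF e]
    by (simp only: integral_divide_zero Bochner_Integration.integral_add)
  also have "\<dots> = log_kernel \<epsilon> p p'"
    unfolding log_kernel_def by (subst ln_mult_pos) (auto simp: add_pos_nonneg)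
  finally show ?thesis .
qed

text \<open>With a = t p and b = t p' this linear bound cancels the 1/t in the weight, at the price
  of one moment of H.\<close>

lemma one_minus_cos_cos_bound: "\<bar>1 - cos a * cos b\<bar> \<le> \<bar>a\<bar> + \<bar>b :: real\<bar>"
proof -
  have c: "\<bar>1 - cos x\<bar> \<le> \<bar>x\<bar>" for x :: real
  proof -
    have "\<bar>Re (iexp x - 1)\<bar> \<le> cmod (iexp x - 1)"
      by (rule abs_Re_le_cmod)
    also have "\<dots> \<le> \<bar>x\<bar>"
      using iexp_approx1[of x 0] by simp
    finally show ?thesis
      by (simp add: Re_exp)
  qed
  have "1 - cos a * cos b = (1 - cos a) + cos a * (1 - cos b)" by (simp add: algebra_simps)
  then have "\<bar>1 - cos a * cos b\<bar> \<le> \<bar>1 - cos a\<bar> + \<bar>cos a\<bar> * \<bar>1 - cos b\<bar>"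
    by (metis abs_mult abs_triangle_ineq)
  also have "\<dots> \<le> \<bar>a\<bar> + 1 * \<bar>b\<bar>"
    by (intro add_mono mult_mono c) auto
  finally show ?thesis by simp
qed

section \<open>The regularised energy as a double integral against the logarithmic kernel\<close>

lemma integral_pair_product:
  fixes f :: "'a::euclidean_space \<Rightarrow> complex" and g :: "'b::euclidean_space \<Rightarrow> complex"
  assumes f: "integrable lborel f" and g: "integrable lborel g"
  shows integrable_pair_product: "integrable lborel (\<lambda>z. f (fst z) * g (snd z))"
    and "(\<integral>z. f (fst z) * g (snd z) \<partial>lborel) = (\<integral>x. f x \<partial>lborel) * (\<integral>y. g y \<partial>lborel)"
proof -
  have [measurable]: "f \<in> borel_measurable borel" "g \<in> borel_measurable borel"
    using f g by auto
  have i: "integrable (lborel \<Otimes>\<^sub>M lborel) (\<lambda>(x, y). f x * g y)"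
    by (rule integrable_pair_bound[OF f g]) (auto simp: norm_mult)
  then show "integrable lborel (\<lambda>z. f (fst z) * g (snd z))"
    by (simp add: lborel_prod case_prod_unfold)
  have "(\<integral>z. f (fst z) * g (snd z) \<partial>lborel) = (\<integral>x. (\<integral>y. f x * g y \<partial>lborel) \<partial>lborel)"
    using lborel_pair.integral_fst'[OF i] by (simp add: lborel_prod case_prod_unfold)
  then show "(\<integral>z. f (fst z) * g (snd z) \<partial>lborel) = (\<integral>x. f x \<partial>lborel) * (\<integral>y. g y \<partial>lborel)"
    by simp
qed

text \<open>The square |B t|^2 is a double integral of H and its conjugate against cos cos.
  Subtracting the same double integral with kernel 1 changes nothing since H has integral 0, and the
  kernel becomes -(1 - cos cos). Integrating in t first then yields minus
  \<open>log_kernel\<close>.\<close>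

lemma
  fixes H :: "real \<Rightarrow> complex" and p :: "real \<Rightarrow> real"
  assumes H: "integrable lborel H" and [measurable]: "p \<in> borel_measurable borel"
    and Hp: "integrable lborel (\<lambda>\<eta>. H \<eta> * of_real (p \<eta>))"
    and H0: "(\<integral>\<eta>. H \<eta> \<partial>lborel) = 0" and e: "0 < \<epsilon>"
  shows cos_transform_energy_integrable:
      "integrable lborel (\<lambda>t. (norm (\<integral>\<eta>. H \<eta> * of_real (cos (t * p \<eta>)) \<partial>lborel))\<^sup>2 * (exp (- \<epsilon> * t) / t * indicator {0..} t))" (is ?A)
    and log_kernel_integrable:
      "integrable lborel (\<lambda>z. H (fst z) * cnj (H (snd z)) * of_real (log_kernel \<epsilon> (p (fst z)) (p (snd z))))" (is ?B)
    and cos_transform_energy: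
      "of_real (\<integral>t. (norm (\<integral>\<eta>. H \<eta> * of_real (cos (t * p \<eta>)) \<partial>lborel))\<^sup>2 * (exp (- \<epsilon> * t) / t * indicator {0..} t) \<partial>lborel)
        = - (\<integral>z. H (fst z) * cnj (H (snd z)) * of_real (log_kernel \<epsilon> (p (fst z)) (p (snd z))) \<partial>lborel)" (is ?C)
proof -
  define W where "W t = exp (- \<epsilon> * t) / t * indicator {0..} t" for t :: real
  define B where "B t = (\<integral>\<eta>. H \<eta> * of_real (cos (t * p \<eta>)) \<partial>lborel)" for t
  let ?K = "\<lambda>(z :: real \<times> real) t. H (fst z) * cnj (H (snd z)) * of_real ((1 - cos (t * p (fst z)) * cos (t * p (snd z))) * W t)"
  \<comment> \<open>The majorant of \<open>?K\<close> in z = (\<eta>, \<eta>') that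
    \<open>one_minus_cos_cos_bound\<close> gives; the matching factor in t is exp(-eps t) on t \<ge>
    0.\<close>
  let ?F = "\<lambda>z :: real \<times> real. norm (H (fst z) * of_real (p (fst z))) * norm (H (snd z)) + norm (H (fst z)) * norm (H (snd z) * of_real (p (snd z)))"
  have [measurable]: "H \<in> borel_measurable borel" using H by auto
  have [measurable]: "W \<in> borel_measurable borel" unfolding W_def[abs_def] by measurable
  have F: "integrable lborel ?F"
  proof (rule Bochner_Integration.integrable_add)
    have "integrable (lborel \<Otimes>\<^sub>M lborel) (\<lambda>(x :: real, y :: real). norm (H x * of_real (p x)) * norm (H y))"
      by (rule integrable_pair_bound[OF Hp H]) (auto simp: abs_mult norm_mult)
    then show "integrable lborel (\<lambda>z. norm (H (fst z) * of_real (p (fst z))) * norm (H (snd z)))"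
      by (simp add: lborel_prod case_prod_unfold)
    have "integrable (lborel \<Otimes>\<^sub>M lborel) (\<lambda>(x :: real, y :: real). norm (H x) * norm (H y * of_real (p y)))"
      by (rule integrable_pair_bound[OF H Hp]) (auto simp: abs_mult norm_mult)
    then show "integrable lborel (\<lambda>z. norm (H (fst z)) * norm (H (snd z) * of_real (p (snd z))))"
      by (simp add: lborel_prod case_prod_unfold)
  qed
  have G: "integrable lborel (\<lambda>t. exp (- \<epsilon> * t) * indicator {0..} t)"
  proof -
    have "(\<integral>\<^sup>+t. ennreal (exp (- \<epsilon> * t)) * indicator {0..} t \<partial>lborel) = ennreal (0 - (- exp (- \<epsilon> * 0) / \<epsilon>))"
    proof (rule nn_integral_FTC_atLeast)
      show "((\<lambda>t. - exp (- \<epsilon> * t) / \<epsilon>) has_real_derivative exp (- \<epsilon> * t)) (at t)" for t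
        using e by (auto intro!: derivative_eq_intros)
      have "((\<lambda>t. exp (- t * \<epsilon>)) \<longlongrightarrow> 0) at_top"
        by (rule exp_decay_tendsto[OF e])
      then have "((\<lambda>t. - exp (- t * \<epsilon>) / \<epsilon>) \<longlongrightarrow> - 0 / \<epsilon>) at_top"
        using e by (intro tendsto_intros) auto
      then show "((\<lambda>t. - exp (- \<epsilon> * t) / \<epsilon>) \<longlongrightarrow> 0) at_top"
        by (simp add: mult.commute)
    qed auto
    moreover have "(\<integral>\<^sup>+t. ennreal (exp (- \<epsilon> * t) * indicator {0..} t) \<partial>lborel) = (\<integral>\<^sup>+t. ennreal (exp (- \<epsilon> * t)) * indicator {0..} t \<partial>lborel)"
      by (intro nn_integral_cong) (auto simp: indicator_def)
    ultimately have "has_bochner_integral lborel (\<lambda>t. exp (- \<epsilon> * t) * indicator {0..} t) (1 / \<epsilon>)"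
      using e by (intro has_bochner_integral_nn_integral) auto
    then show ?thesis by (auto simp: has_bochner_integral_iff)
  qed
  have W_bound: "\<bar>(1 - cos (t * a) * cos (t * b)) * W t\<bar> \<le> (\<bar>a\<bar> + \<bar>b\<bar>) * (exp (- \<epsilon> * t) * indicator {0..} t)" for t a b
  proof (cases "0 < t")
    case True
    have "\<bar>(1 - cos (t * a) * cos (t * b)) * W t\<bar> \<le> (\<bar>t * a\<bar> + \<bar>t * b\<bar>) * W t"
      using one_minus_cos_cos_bound[of "t * a" "t * b"] True
      by (simp add: abs_mult W_def mult_right_mono divide_right_mono)
    also have "\<dots> = (\<bar>a\<bar> + \<bar>b\<bar>) * (exp (- \<epsilon> * t) * indicator {0..} t)"
      using True by (simp add: abs_mult W_def field_simps)
    finally show ?thesis .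
  next
    case False
    then show ?thesis by (cases "t = 0") (auto simp: W_def)
  qed
  have K: "integrable (lborel \<Otimes>\<^sub>M lborel) (\<lambda>(z, t). ?K z t)"
  proof (rule integrable_pair_bound[OF F G])
    fix z :: "real \<times> real" and t :: real
    have "norm (?K z t) \<le> norm (H (fst z)) * norm (H (snd z)) * ((\<bar>p (fst z)\<bar> + \<bar>p (snd z)\<bar>) * (exp (- \<epsilon> * t) * indicator {0..} t))"
      unfolding norm_mult norm_of_real complex_mod_cnj using W_bound by (intro mult_left_mono) (auto simp: abs_mult)
    also have "\<dots> = norm (?F z) * norm (exp (- \<epsilon> * t) * indicator {0..} t)"
      by (simp add: norm_mult algebra_simps abs_mult)
    finally show "norm (?K z t) \<le> norm (?F z) * norm (exp (- \<epsilon> * t) * indicator {0..} t)" .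
    show "(\<lambda>(z, t). ?K z t) \<in> borel_measurable (borel \<Otimes>\<^sub>M borel)"
      by (subst borel_prod[symmetric]) measurable
  qed
  have Ht: "integrable lborel (\<lambda>\<eta>. H \<eta> * of_real (cos (t * p \<eta>)))" for t
    by (rule Bochner_Integration.integrable_bound[OF H]) (auto simp: norm_mult intro!: mult_left_le)
  \<comment> \<open>The constant 1 in the kernel contributes the squared modulus of the integral of
    H, which is 0 by \<open>H0\<close>.\<close>
  have int_z: "(\<integral>z. ?K z t \<partial>lborel) = - of_real ((norm (B t))\<^sup>2 * W t)" for t
  proof -
    let ?a = "\<lambda>\<eta>. H \<eta> * of_real (cos (t * p \<eta>))"
    have cH: "integrable lborel (\<lambda>\<eta>. cnj (H \<eta>))" "integrable lborel (\<lambda>\<eta>. cnj (?a \<eta>))"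
      using H Ht by (simp_all only: integrable_cnj)
    have "?K z t = of_real (W t) * (H (fst z) * cnj (H (snd z)) - ?a (fst z) * cnj (?a (snd z)))" for z
      by (simp add: algebra_simps)
    then have "(\<integral>z. ?K z t \<partial>lborel) = of_real (W t) * ((\<integral>z. H (fst z) * cnj (H (snd z)) \<partial>lborel) - (\<integral>z. ?a (fst z) * cnj (?a (snd z)) \<partial>lborel))"
      using integrable_pair_product[OF H cH(1)] integrable_pair_product[OF Ht cH(2)]
      by (simp only: integral_mult_right_zero Bochner_Integration.integral_diff)
    also have "\<dots> = of_real (W t) * (- (B t * cnj (B t)))"
      using integral_pair_product(2)[OF H cH(1)] integral_pair_product(2)[OF Ht cH(2)]
      by (simp only: Bochner_Integration.integral_cnj H0 B_def) simp
    finally show ?thesis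
      by (simp add: complex_norm_square mult.commute del: of_real_power)
  qed
  have int_t: "(\<integral>t. ?K z t \<partial>lborel) = H (fst z) * cnj (H (snd z)) * of_real (log_kernel \<epsilon> (p (fst z)) (p (snd z)))" for z
    using log_kernel_integral[OF e, of "p (fst z)" "p (snd z)"]
    by (simp only: integral_mult_right_zero integral_complex_of_real W_def)
  have "integrable lborel (\<lambda>t. - of_real ((norm (B t))\<^sup>2 * W t) :: complex)"
    using lborel_pair.integrable_snd[OF K] unfolding int_z .
  then have "integrable lborel (\<lambda>t. - (- of_real ((norm (B t))\<^sup>2 * W t)) :: complex)"
    by (rule Bochner_Integration.integrable_minus)
  then have "integrable lborel (\<lambda>t. Re (- (- of_real ((norm (B t))\<^sup>2 * W t))))"
    by (rule integrable_Re)
  then show ?A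
    by (simp add: B_def W_def)
  show ?B
    using lborel_pair.integrable_fst[OF K] unfolding int_t .
  have "(\<integral>t. - of_real ((norm (B t))\<^sup>2 * W t) \<partial>lborel) = (\<integral>z. H (fst z) * cnj (H (snd z)) * of_real (log_kernel \<epsilon> (p (fst z)) (p (snd z))) \<partial>lborel)"
    using lborel_pair.Fubini_integral[OF K] unfolding int_z int_t .
  then show ?C
    unfolding B_def[symmetric] W_def[symmetric] Bochner_Integration.integral_minus integral_complex_of_real
    by (metis minus_minus)
qed

text \<open>In this form p and q enter only through p^2 + q^2 and p^2 - q^2. Adding k^2 to both
  squares therefore changes the middle term alone, by 4 k^2 / eps^2.\<close>

lemma log_kernel_product:
  "0 < \<epsilon> \<Longrightarrow> (1 + (p - q)\<^sup>2 / \<epsilon>\<^sup>2) * (1 + (p + q)\<^sup>2 / \<epsilon>\<^sup>2) = 1 + 2 * (p\<^sup>2 + q\<^sup>2) / \<epsilon>\<^sup>2 + (p\<^sup>2 - q\<^sup>2)\<^sup>2 / (\<epsilon>\<^sup>2 * \<epsilon>\<^sup>2)" for p q :: real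
  by (simp add: field_simps power2_eq_square)

text \<open>The bound follows from 1 + x \<le> (1 + sqrt x)^2. The square root matters: for the
  kernel difference it yields 1 / sqrt(|x| |y|), which is locally integrable, whereas ln(1 + x)
  \<le> x would only yield 1 / (|x| |y|).\<close>

lemma ln_one_plus_le_sqrt:
  assumes "0 \<le> (x::real)"
  shows "ln (1 + x) \<le> 2 * sqrt x"
proof -
  have "1 + x \<le> (1 + sqrt x)\<^sup>2"
    using assms by (simp add: power2_sum)
  then have "ln (1 + x) \<le> ln ((1 + sqrt x)\<^sup>2)"
    using assms by (subst ln_le_cancel_iff) auto
  also have "\<dots> = 2 * ln (1 + sqrt x)"
    using assms by (subst ln_realpow) (auto simp: add_pos_nonneg)
  also have "\<dots> \<le> 2 * sqrt x"
    using assms ln_add_one_self_le_self[of "sqrt x"] by simp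
  finally show ?thesis .
qed

text \<open>Since \<open>p\<^sup>2 - q\<^sup>2\<close> is the same for \<open>p = \<eta>\<close> and \<open>p = sqrt (k\<^sup>2 + \<eta>\<^sup>2)\<close>, the two kernels have the same limit
  as \<open>\<epsilon> \<rightarrow> 0\<close>.\<close>

lemma
  fixes k x y :: real
  assumes e: "0 < \<epsilon>" and k: "0 \<le> k"
  shows log_kernel_diff_nonneg: "0 \<le> log_kernel \<epsilon> (sqrt (k\<^sup>2 + x\<^sup>2)) (sqrt (k\<^sup>2 + y\<^sup>2)) - log_kernel \<epsilon> x y"
    and log_kernel_diff_bound: "x \<noteq> 0 \<Longrightarrow> y \<noteq> 0 \<Longrightarrow>
      log_kernel \<epsilon> (sqrt (k\<^sup>2 + x\<^sup>2)) (sqrt (k\<^sup>2 + y\<^sup>2)) - log_kernel \<epsilon> x y \<le> k * (1 / sqrt \<bar>x\<bar>) * (1 / sqrt \<bar>y\<bar>)"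
    and log_kernel_diff_small: "x\<^sup>2 \<noteq> y\<^sup>2 \<Longrightarrow>
      log_kernel \<epsilon> (sqrt (k\<^sup>2 + x\<^sup>2)) (sqrt (k\<^sup>2 + y\<^sup>2)) - log_kernel \<epsilon> x y \<le> k\<^sup>2 * \<epsilon>\<^sup>2 / (x\<^sup>2 - y\<^sup>2)\<^sup>2"
proof -
  define Q where "Q = 1 + 2 * (x\<^sup>2 + y\<^sup>2) / \<epsilon>\<^sup>2 + (x\<^sup>2 - y\<^sup>2)\<^sup>2 / (\<epsilon>\<^sup>2 * \<epsilon>\<^sup>2)"
  have Q1: "1 \<le> Q" unfolding Q_def using e by simp
  have "log_kernel \<epsilon> (sqrt (k\<^sup>2 + x\<^sup>2)) (sqrt (k\<^sup>2 + y\<^sup>2)) = ln (Q + 4 * k\<^sup>2 / \<epsilon>\<^sup>2) / 4"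
    unfolding log_kernel_def log_kernel_product[OF e] Q_def by (simp add: add_divide_distrib algebra_simps)
  moreover have "log_kernel \<epsilon> x y = ln Q / 4"
    unfolding log_kernel_def log_kernel_product[OF e] Q_def ..
  moreover have "ln (Q + 4 * k\<^sup>2 / \<epsilon>\<^sup>2) - ln Q = ln ((Q + 4 * k\<^sup>2 / \<epsilon>\<^sup>2) / Q)"
  proof -
    have "0 < Q + 4 * k\<^sup>2 / \<epsilon>\<^sup>2"
      using Q1 by (intro add_pos_nonneg) auto
    then show ?thesis
      using Q1 by (subst ln_div) auto
  qed
  moreover have "(Q + 4 * k\<^sup>2 / \<epsilon>\<^sup>2) / Q = 1 + 4 * k\<^sup>2 / (\<epsilon>\<^sup>2 * Q)"
    using Q1 by (simp add: add_divide_distrib)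
  ultimately have D: "log_kernel \<epsilon> (sqrt (k\<^sup>2 + x\<^sup>2)) (sqrt (k\<^sup>2 + y\<^sup>2)) - log_kernel \<epsilon> x y = ln (1 + 4 * k\<^sup>2 / (\<epsilon>\<^sup>2 * Q)) / 4"
    by (metis diff_divide_distrib)
  have nn: "0 \<le> 4 * k\<^sup>2 / (\<epsilon>\<^sup>2 * Q)" using Q1 by simp
  then show "0 \<le> log_kernel \<epsilon> (sqrt (k\<^sup>2 + x\<^sup>2)) (sqrt (k\<^sup>2 + y\<^sup>2)) - log_kernel \<epsilon> x y"
    unfolding D by simp
  have eQ: "\<epsilon>\<^sup>2 * Q = \<epsilon>\<^sup>2 + 2 * (x\<^sup>2 + y\<^sup>2) + (x\<^sup>2 - y\<^sup>2)\<^sup>2 / \<epsilon>\<^sup>2"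
  proof -
    have h: "c * (1 + 2 * A / c + D / (c * c)) = c + 2 * A + D / c" if "c \<noteq> 0" for A D c :: real
      using that by (simp add: field_simps)
    show ?thesis
      unfolding Q_def by (rule h) (use e in simp)
  qed
  {
    assume xy: "x \<noteq> 0" "y \<noteq> 0"
    \<comment> \<open>The middle term of \<open>eQ\<close> is kept, bounded below by the
      arithmetic-geometric mean inequality; the resulting bound is uniform in \<epsilon>.\<close>
    have "4 * (\<bar>x\<bar> * \<bar>y\<bar>) \<le> 2 * (x\<^sup>2 + y\<^sup>2)"
      using sum_squares_bound[of "\<bar>x\<bar>" "\<bar>y\<bar>"] by simp
    also have "\<dots> \<le> \<epsilon>\<^sup>2 * Q" unfolding eQ by simp
    finally have "4 * k\<^sup>2 / (\<epsilon>\<^sup>2 * Q) \<le> 4 * k\<^sup>2 / (4 * (\<bar>x\<bar> * \<bar>y\<bar>))"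
      using xy by (intro divide_left_mono mult_pos_pos) (use e Q1 in auto)
    then have "sqrt (4 * k\<^sup>2 / (\<epsilon>\<^sup>2 * Q)) \<le> sqrt (k\<^sup>2 / (\<bar>x\<bar> * \<bar>y\<bar>))" by simp
    also have "\<dots> = k * (1 / sqrt \<bar>x\<bar>) * (1 / sqrt \<bar>y\<bar>)"
      using k by (simp add: real_sqrt_divide real_sqrt_mult)
    finally have s: "sqrt (4 * k\<^sup>2 / (\<epsilon>\<^sup>2 * Q)) \<le> k * (1 / sqrt \<bar>x\<bar>) * (1 / sqrt \<bar>y\<bar>)" .
    moreover have "0 \<le> sqrt (4 * k\<^sup>2 / (\<epsilon>\<^sup>2 * Q))" using nn by simp
    ultimately show "log_kernel \<epsilon> (sqrt (k\<^sup>2 + x\<^sup>2)) (sqrt (k\<^sup>2 + y\<^sup>2)) - log_kernel \<epsilon> x y \<le> k * (1 / sqrt \<bar>x\<bar>) * (1 / sqrt \<bar>y\<bar>)"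
      unfolding D using ln_one_plus_le_sqrt[OF nn] by linarith
  }
  {
    assume xy: "x\<^sup>2 \<noteq> y\<^sup>2"
    \<comment> \<open>Now the last term of \<open>eQ\<close> is kept. The bound degenerates near the
      diagonals but tends to 0 with \<epsilon> away from them.\<close>
    have "(x\<^sup>2 - y\<^sup>2)\<^sup>2 / \<epsilon>\<^sup>2 \<le> \<epsilon>\<^sup>2 * Q" unfolding eQ by simp
    then have "4 * k\<^sup>2 / (\<epsilon>\<^sup>2 * Q) \<le> 4 * k\<^sup>2 / ((x\<^sup>2 - y\<^sup>2)\<^sup>2 / \<epsilon>\<^sup>2)"
      by (intro divide_left_mono mult_pos_pos) (use e Q1 xy in auto)
    also have "\<dots> = 4 * (k\<^sup>2 * \<epsilon>\<^sup>2 / (x\<^sup>2 - y\<^sup>2)\<^sup>2)" by simp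
    finally show "log_kernel \<epsilon> (sqrt (k\<^sup>2 + x\<^sup>2)) (sqrt (k\<^sup>2 + y\<^sup>2)) - log_kernel \<epsilon> x y \<le> k\<^sup>2 * \<epsilon>\<^sup>2 / (x\<^sup>2 - y\<^sup>2)\<^sup>2"
      unfolding D using ln_add_one_self_le_self[OF nn] by linarith
  }
qed

text \<open>On [-1, 1] the boundedness of H is combined with the integrability of |x|^(-1/2);
  outside, that factor is at most 1. Two copies of this function form the majorant for the limit of
  vanishing regularisation.\<close>

lemma integrable_mult_inverse_sqrt:
  fixes H :: "real \<Rightarrow> complex"
  assumes H: "integrable lborel H" and C: "\<And>x. norm (H x) \<le> C"
  shows "integrable lborel (\<lambda>x. H x * of_real (1 / sqrt \<bar>x\<bar>))"
proof -
  have [measurable]: "H \<in> borel_measurable borel" using H by auto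
  have "(\<integral>\<^sup>+x. ennreal (x powr (- 1 / 2)) * indicator {0..1} x \<partial>lborel) = ennreal (1 powr (- 1 / 2 + 1) / (- 1 / 2 + 1))"
    by (rule nn_integral_has_integral_lebesgue'[OF _ has_integral_powr_from_0]) auto
  moreover have "(\<integral>\<^sup>+x. ennreal (x powr (- 1 / 2) * indicator {0..1} x) \<partial>lborel) = (\<integral>\<^sup>+x. ennreal (x powr (- 1 / 2)) * indicator {0..1} x \<partial>lborel)"
    by (intro nn_integral_cong) (auto simp: indicator_def)
  ultimately have "has_bochner_integral lborel (\<lambda>x::real. x powr (- 1 / 2) * indicator {0..1} x) 2"
    by (intro has_bochner_integral_nn_integral) auto
  then have i1: "integrable lborel (\<lambda>x::real. x powr (- 1 / 2) * indicator {0..1} x)"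
    by (auto simp: has_bochner_integral_iff)
  have i2: "integrable lborel (\<lambda>x::real. (0 + (- 1) * x) powr (- 1 / 2) * indicator {0..1} (0 + (- 1) * x))"
    by (rule lborel_integrable_real_affine[OF i1]) simp
  have "integrable lborel (\<lambda>x. C * (x powr (- 1 / 2) * indicator {0..1} x) + C * ((0 + (- 1) * x) powr (- 1 / 2) * indicator {0..1} (0 + (- 1) * x)) + norm (H x))"
    by (intro Bochner_Integration.integrable_add integrable_mult_right i1 i2 integrable_norm H)
  then show ?thesis
  proof (rule Bochner_Integration.integrable_bound)
    have C0: "0 \<le> C" using C[of 0] norm_ge_zero order_trans by blast
    have "norm (H x * of_real (1 / sqrt \<bar>x\<bar>)) \<le> C * (x powr (- 1 / 2) * indicator {0..1} x) + C * ((0 + (- 1) * x) powr (- 1 / 2) * indicator {0..1} (0 + (- 1) * x)) + norm (H x)" for x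
    proof (cases "\<bar>x\<bar> \<le> 1")
      case True
      have "norm (H x) * (1 / sqrt \<bar>x\<bar>) \<le> C * (1 / sqrt \<bar>x\<bar>)"
        by (intro mult_right_mono C) simp
      moreover have "norm (H x * of_real (1 / sqrt \<bar>x\<bar>)) = norm (H x) * (1 / sqrt \<bar>x\<bar>)"
        by (simp add: norm_mult norm_divide)
      moreover have "0 \<le> C * (x powr (- 1 / 2) * indicator {0..1} x)" "0 \<le> C * ((0 + (- 1) * x) powr (- 1 / 2) * indicator {0..1} (0 + (- 1) * x))"
        using C0 by auto
      moreover have "C * (1 / sqrt \<bar>x\<bar>) = C * (x powr (- 1 / 2) * indicator {0..1} x)" if "0 \<le> x"
        using that True by (simp add: powr_minus_divide powr_half_sqrt)
      moreover have "C * (1 / sqrt \<bar>x\<bar>) = C * ((0 + (- 1) * x) powr (- 1 / 2) * indicator {0..1} (0 + (- 1) * x))" if "x < 0"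
        using that True by (simp add: powr_minus_divide powr_half_sqrt)
      moreover have "0 \<le> norm (H x)" by simp
      ultimately show ?thesis
        by (cases "0 \<le> x") linarith+
    next
      case False
      then have "1 / sqrt \<bar>x\<bar> \<le> 1" by simp
      then have "norm (H x) * (1 / sqrt \<bar>x\<bar>) \<le> norm (H x)"
        by (intro mult_left_le) auto
      then show ?thesis
        using False C0 by (auto simp: norm_mult norm_divide indicator_def)
    qed
    then show "AE x in lborel. norm (H x * of_real (1 / sqrt \<bar>x\<bar>)) \<le> norm (C * (x powr (- 1 / 2) * indicator {0..1} x) + C * ((0 + (- 1) * x) powr (- 1 / 2) * indicator {0..1} (0 + (- 1) * x)) + norm (H x))"
      unfolding real_norm_def by (intro AE_I2 order_trans[OF _ abs_ge_self])
  qed measurable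
qed

lemma AE_pair_squares_neq: "AE z in (lborel :: (real \<times> real) measure). (fst z)\<^sup>2 \<noteq> (snd z)\<^sup>2 \<and> fst z \<noteq> 0 \<and> snd z \<noteq> 0"
proof -
  have "AE y in lborel. x\<^sup>2 \<noteq> y\<^sup>2 \<and> x \<noteq> 0 \<and> y \<noteq> 0" if "x \<noteq> 0" for x :: real
  proof -
    have "AE y in lborel. y \<noteq> x" "AE y in lborel. y \<noteq> - x" "AE y in lborel. y \<noteq> (0 :: real)"
      by (rule AE_lborel_singleton)+
    then show ?thesis
      by eventually_elim (use that in \<open>auto simp: power2_eq_iff\<close>)
  qed
  moreover have "AE x in lborel. x \<noteq> (0 :: real)"
    by (rule AE_lborel_singleton)
  ultimately have a: "AE x in lborel. AE y in lborel. x\<^sup>2 \<noteq> y\<^sup>2 \<and> x \<noteq> 0 \<and> y \<noteq> (0 :: real)"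
    by (auto elim: eventually_mono)
  have "open {z :: real \<times> real. (fst z)\<^sup>2 \<noteq> (snd z)\<^sup>2 \<and> fst z \<noteq> 0 \<and> snd z \<noteq> 0}"
    by (intro open_Collect_conj open_Collect_neq continuous_intros)
  then have m: "{z \<in> space (lborel \<Otimes>\<^sub>M lborel). (fst z)\<^sup>2 \<noteq> (snd z)\<^sup>2 \<and> fst z \<noteq> 0 \<and> snd z \<noteq> (0 :: real)} \<in> sets (lborel \<Otimes>\<^sub>M lborel)"
    unfolding lborel_prod by simp
  have "AE z in lborel \<Otimes>\<^sub>M lborel. (fst z)\<^sup>2 \<noteq> (snd z)\<^sup>2 \<and> fst z \<noteq> 0 \<and> snd z \<noteq> (0 :: real)"
    by (rule lborel_pair.AE_pair_measure[OF m]) (use a in simp)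
  then show ?thesis
    unfolding lborel_prod .
qed

text \<open>A and B may be infinite and cannot be subtracted, so the smaller sequence is enlarged by
  |a n - b n| instead. Applied in both directions, the comparison yields equality of two energies
  not known to be finite.\<close>

lemma ennreal_lim_eq:
  fixes a b :: "nat \<Rightarrow> real"
  assumes a: "(\<lambda>n. ennreal (a n)) \<longlonglongrightarrow> A" and b: "(\<lambda>n. ennreal (b n)) \<longlonglongrightarrow> B"
    and d: "(\<lambda>n. a n - b n) \<longlonglongrightarrow> 0"
  shows "A \<le> B"
proof (rule LIMSEQ_le[OF a])
  have "(\<lambda>n. ennreal \<bar>a n - b n\<bar>) \<longlonglongrightarrow> ennreal 0"
    using tendsto_rabs_zero[OF d] by (rule tendsto_ennrealI)
  then have "(\<lambda>n. ennreal (b n) + ennreal \<bar>a n - b n\<bar>) \<longlonglongrightarrow> B + 0"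
    by (intro tendsto_add b) simp
  then show "(\<lambda>n. ennreal (b n) + ennreal \<bar>a n - b n\<bar>) \<longlonglongrightarrow> B" by simp
  have "ennreal (a n) \<le> ennreal (b n) + ennreal \<bar>a n - b n\<bar>" for n
  proof -
    have "ennreal (a n) \<le> ennreal (max 0 (b n) + \<bar>a n - b n\<bar>)"
      by (intro ennreal_leI) linarith
    also have "\<dots> = ennreal (max 0 (b n)) + ennreal \<bar>a n - b n\<bar>"
      by (intro ennreal_plus) auto
    also have "ennreal (max 0 (b n)) = ennreal (b n)"
      by (auto simp: max_def ennreal_neg)
    finally show ?thesis .
  qed
  then show "\<exists>N. \<forall>n\<ge>N. ennreal (a n) \<le> ennreal (b n) + ennreal \<bar>a n - b n\<bar>" by blast
qed

text \<open>The two closed half-lines overlap at 0, where \<open>g 0 = 0\<close> makes the double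
  count harmless. Integrands with the weight 1/|t| satisfy this by the convention for division by
  zero.\<close>

lemma nn_integral_even:
  fixes g :: "real \<Rightarrow> ennreal"
  assumes [measurable]: "g \<in> borel_measurable borel" and even: "\<And>t. g (- t) = g t" and 0: "g 0 = 0"
  shows "(\<integral>\<^sup>+t. g t \<partial>lborel) = 2 * (\<integral>\<^sup>+t. g t * indicator {0..} t \<partial>lborel)"
proof -
  have "(\<integral>\<^sup>+t. g t \<partial>lborel) = (\<integral>\<^sup>+t. g t * indicator {0..} t + g t * indicator {..0} t \<partial>lborel)"
  proof (intro nn_integral_cong)
    fix t :: real
    show "g t = g t * indicator {0..} t + g t * indicator {..0} t"
      using 0 by (cases t "0 :: real" rule: linorder_cases) auto
  qed
  also have "\<dots> = (\<integral>\<^sup>+t. g t * indicator {0..} t \<partial>lborel) + (\<integral>\<^sup>+t. g t * indicator {..0} t \<partial>lborel)"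
    by (rule nn_integral_add) measurable
  also have "(\<integral>\<^sup>+t. g t * indicator {..0} t \<partial>lborel) = ennreal \<bar>- 1\<bar> * (\<integral>\<^sup>+t. g (0 + (- 1) * t) * indicator {..0} (0 + (- 1) * t) \<partial>lborel)"
    by (rule nn_integral_real_affine[of "\<lambda>t. g t * indicator {..0} t" "- 1" 0])
       (auto intro!: borel_measurable_times_ennreal borel_measurable_indicator)
  also have "\<dots> = (\<integral>\<^sup>+t. g t * indicator {0..} t \<partial>lborel)"
    by (auto simp: even indicator_def intro!: nn_integral_cong)
  finally show ?thesis
    by (simp add: mult_2)
qed

text \<open>For t \<ge> 0 the factors exp(-t/(n+1)) increase to 1, so monotone convergence applies
  even if the limit is infinite.\<close>

lemma cos_transform_energy_LIMSEQ:
  fixes H :: "real \<Rightarrow> complex" and p :: "real \<Rightarrow> real"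
  assumes [measurable]: "H \<in> borel_measurable borel" "p \<in> borel_measurable borel"
    and i: "\<And>\<epsilon>. 0 < \<epsilon> \<Longrightarrow> integrable lborel (\<lambda>t. (norm (\<integral>\<eta>. H \<eta> * of_real (cos (t * p \<eta>)) \<partial>lborel))\<^sup>2 * (exp (- \<epsilon> * t) / t * indicator {0..} t))"
  shows "(\<lambda>n. ennreal (\<integral>t. (norm (\<integral>\<eta>. H \<eta> * of_real (cos (t * p \<eta>)) \<partial>lborel))\<^sup>2 * (exp (- (1 / real (Suc n)) * t) / t * indicator {0..} t) \<partial>lborel))
     \<longlonglongrightarrow> (\<integral>\<^sup>+t. ennreal ((norm (\<integral>\<eta>. H \<eta> * of_real (cos (t * p \<eta>)) \<partial>lborel))\<^sup>2 / \<bar>t\<bar>) * indicator {0..} t \<partial>lborel)"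
proof -
  define B where "B t = (\<integral>\<eta>. H \<eta> * of_real (cos (t * p \<eta>)) \<partial>lborel)" for t
  have [measurable]: "B \<in> borel_measurable borel"
    unfolding B_def[abs_def] by measurable
  let ?f = "\<lambda>n t. (norm (B t))\<^sup>2 * (exp (- (1 / real (Suc n)) * t) / t * indicator {0..} t)"
  have i': "integrable lborel (?f n)" for n
    unfolding B_def by (rule i) simp
  have nn: "0 \<le> ?f n t" for n t
    by (cases "0 \<le> t") (auto intro!: mult_nonneg_nonneg)
  have "(\<lambda>n. \<integral>\<^sup>+t. ennreal (?f n t) \<partial>lborel) \<longlonglongrightarrow> (\<integral>\<^sup>+t. ennreal ((norm (B t))\<^sup>2 / \<bar>t\<bar>) * indicator {0..} t \<partial>lborel)"
  proof (rule nn_integral_LIMSEQ)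
    have "?f m t \<le> ?f n t" if "m \<le> n" for m n t
    proof (cases "0 \<le> t")
      case True
      have "1 / real (Suc n) \<le> 1 / real (Suc m)"
        using that by (simp add: frac_le)
      then have "exp (- (1 / real (Suc m)) * t) \<le> exp (- (1 / real (Suc n)) * t)"
        using mult_right_mono[OF _ True] by (simp only: exp_le_cancel_iff mult_minus_left neg_le_iff_le)
      then show ?thesis
        using True by (intro mult_left_mono mult_right_mono divide_right_mono) auto
    qed simp
    then show "incseq (\<lambda>n t. ennreal (?f n t))"
      by (auto simp: mono_def le_fun_def simp del: of_nat_Suc intro!: ennreal_leI)
    fix t :: real
    have x1: "(\<lambda>n. exp (- (1 / real (Suc n)) * t)) \<longlonglongrightarrow> exp (- 0 * t)"
      by (intro tendsto_intros inverse_Suc_tendsto_0)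
    have "(\<lambda>n. (norm (B t))\<^sup>2 * (exp (- (1 / real (Suc n)) * t) * (1 / t) * indicator {0..} t)) \<longlonglongrightarrow> (norm (B t))\<^sup>2 * (exp (- 0 * t) * (1 / t) * indicator {0..} t)"
      by (intro tendsto_mult tendsto_const x1)
    then have "(\<lambda>n. ennreal (?f n t)) \<longlonglongrightarrow> ennreal ((norm (B t))\<^sup>2 * (exp (- 0 * t) * (1 / t) * indicator {0..} t))"
      by (intro tendsto_ennrealI) (simp del: of_nat_Suc)
    also have "ennreal ((norm (B t))\<^sup>2 * (exp (- 0 * t) * (1 / t) * indicator {0..} t)) = ennreal ((norm (B t))\<^sup>2 / \<bar>t\<bar>) * indicator {0..} t"
      by (auto simp: indicator_def)
    finally show "(\<lambda>n. ennreal (?f n t)) \<longlonglongrightarrow> ennreal ((norm (B t))\<^sup>2 / \<bar>t\<bar>) * indicator {0..} t" .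
  qed measurable
  then show ?thesis
    unfolding B_def[symmetric]
    by (subst (asm) nn_integral_eq_integral[OF i']) (use nn in auto)
qed

theorem energy_identity_1d:
  fixes H :: "real \<Rightarrow> complex"
  assumes H: "integrable lborel H" and C: "\<And>x. norm (H x) \<le> C"
    and H1: "integrable lborel (\<lambda>\<eta>. H \<eta> * of_real \<eta>)"
    and H0: "(\<integral>\<eta>. H \<eta> \<partial>lborel) = 0" and k: "0 \<le> k"
  shows "(\<integral>\<^sup>+t. ennreal ((norm (\<integral>\<eta>. H \<eta> * of_real (cos (t * \<eta>)) \<partial>lborel))\<^sup>2 / \<bar>t\<bar>) \<partial>lborel)
    = (\<integral>\<^sup>+t. ennreal ((norm (\<integral>\<eta>. H \<eta> * of_real (cos (t * sqrt (k\<^sup>2 + \<eta>\<^sup>2))) \<partial>lborel))\<^sup>2 / \<bar>t\<bar>) \<partial>lborel)"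
proof -
  let ?p = "\<lambda>\<eta>. sqrt (k\<^sup>2 + \<eta>\<^sup>2)"
  let ?e = "\<lambda>n. 1 / real (Suc n)"
  let ?E = "\<lambda>p \<epsilon>. \<integral>t. (norm (\<integral>\<eta>. H \<eta> * of_real (cos (t * p \<eta>)) \<partial>lborel))\<^sup>2 * (exp (- \<epsilon> * t) / t * indicator {0..} t) \<partial>lborel"
  have [measurable]: "H \<in> borel_measurable borel" using H by auto
  have Hp: "integrable lborel (\<lambda>\<eta>. H \<eta> * of_real (?p \<eta>))"
  proof (rule Bochner_Integration.integrable_bound)
    show "integrable lborel (\<lambda>\<eta>. norm (H \<eta>) * k + norm (H \<eta> * of_real \<eta>))"
      using H H1 by simp
    have "?p \<eta> \<le> k + \<bar>\<eta>\<bar>" for \<eta>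
      using k by (intro real_le_lsqrt) (auto simp: power2_sum)
    then have "norm (H \<eta>) * ?p \<eta> \<le> norm (H \<eta>) * (k + \<bar>\<eta>\<bar>)" for \<eta>
      by (intro mult_left_mono) auto
    then show "AE \<eta> in lborel. norm (H \<eta> * of_real (?p \<eta>)) \<le> norm (norm (H \<eta>) * k + norm (H \<eta> * of_real \<eta>))"
      using k by (intro AE_I2) (simp add: norm_mult algebra_simps)
  qed measurable
  have m0: "(\<lambda>\<eta>::real. \<eta>) \<in> borel_measurable borel" and m1: "?p \<in> borel_measurable borel"
    by measurable
  note E0 = cos_transform_energy_integrable[OF H m0 H1 H0] log_kernel_integrable[OF H m0 H1 H0] cos_transform_energy[OF H m0 H1 H0]
  note E1 = cos_transform_energy_integrable[OF H m1 Hp H0] log_kernel_integrable[OF H m1 Hp H0] cos_transform_energy[OF H m1 Hp H0]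
  let ?d = "\<lambda>\<epsilon> z. log_kernel \<epsilon> (?p (fst z)) (?p (snd z)) - log_kernel \<epsilon> (fst z) (snd z)"
  have diff: "of_real (?E ?p \<epsilon> - ?E (\<lambda>\<eta>. \<eta>) \<epsilon>) = - (\<integral>z. H (fst z) * cnj (H (snd z)) * of_real (?d \<epsilon> z) \<partial>lborel)" if e: "0 < \<epsilon>" for \<epsilon>
  proof -
    have "H (fst z) * cnj (H (snd z)) * of_real (?d \<epsilon> z) = H (fst z) * cnj (H (snd z)) * of_real (log_kernel \<epsilon> (?p (fst z)) (?p (snd z)))
       - H (fst z) * cnj (H (snd z)) * of_real (log_kernel \<epsilon> (fst z) (snd z))" for z
      by (simp add: algebra_simps)
    then have "(\<integral>z. H (fst z) * cnj (H (snd z)) * of_real (?d \<epsilon> z) \<partial>lborel)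
      = (\<integral>z. H (fst z) * cnj (H (snd z)) * of_real (log_kernel \<epsilon> (?p (fst z)) (?p (snd z))) \<partial>lborel)
       - (\<integral>z. H (fst z) * cnj (H (snd z)) * of_real (log_kernel \<epsilon> (fst z) (snd z)) \<partial>lborel)"
      by (simp only: Bochner_Integration.integral_diff[OF E1(2)[OF e] E0(2)[OF e]])
    moreover have "of_real (?E ?p \<epsilon>) = - (\<integral>z. H (fst z) * cnj (H (snd z)) * of_real (log_kernel \<epsilon> (?p (fst z)) (?p (snd z))) \<partial>lborel)"
      by (rule E1(3)[OF e])
    moreover have "of_real (?E (\<lambda>\<eta>. \<eta>) \<epsilon>) = - (\<integral>z. H (fst z) * cnj (H (snd z)) * of_real (log_kernel \<epsilon> (fst z) (snd z)) \<partial>lborel)"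
      by (rule E0(3)[OF e])
    ultimately show ?thesis by simp
  qed
  have en: "0 < ?e n" for n by simp
  let ?M = "\<lambda>\<eta>. H \<eta> * of_real (1 / sqrt \<bar>\<eta>\<bar>)"
  have m: "(\<lambda>z. H (fst z) * cnj (H (snd z)) * of_real (?d \<epsilon> z)) \<in> borel_measurable borel" for \<epsilon>
    unfolding log_kernel_def by (subst borel_prod[symmetric]) measurable
  \<comment> \<open>\<open>log_kernel_diff_bound\<close> supplies a majorant uniform in n, and
    \<open>log_kernel_diff_small\<close> the pointwise limit; both estimates hold off the null set
    of diagonals and axes.\<close>
  have "(\<lambda>n. \<integral>z. H (fst z) * cnj (H (snd z)) * of_real (?d (?e n) z) \<partial>lborel) \<longlonglongrightarrow> (\<integral>z. 0 \<partial>(lborel :: (real \<times> real) measure))"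
  proof (rule integral_dominated_convergence)
    have "integrable (lborel \<Otimes>\<^sub>M lborel) (\<lambda>(x, y). norm (?M x) * norm (?M y))"
      by (rule integrable_pair_bound[OF integrable_mult_inverse_sqrt[OF H C] integrable_mult_inverse_sqrt[OF H C]]) (auto simp: abs_mult)
    then show "integrable lborel (\<lambda>z. k * (norm (?M (fst z)) * norm (?M (snd z))))"
      by (intro integrable_mult_right) (simp only: lborel_prod case_prod_unfold)
    show "AE z in lborel. norm (H (fst z) * cnj (H (snd z)) * of_real (?d (?e n) z)) \<le> k * (norm (?M (fst z)) * norm (?M (snd z)))" for n
      using AE_pair_squares_neq
    proof eventually_elim
      case (elim z)
      have "0 \<le> ?d (?e n) z"
        by (rule log_kernel_diff_nonneg[OF en k])
      moreover have "?d (?e n) z \<le> k * (1 / sqrt \<bar>fst z\<bar>) * (1 / sqrt \<bar>snd z\<bar>)"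
        by (rule log_kernel_diff_bound[OF en k]) (use elim in auto)
      ultimately have "norm (H (fst z)) * norm (H (snd z)) * \<bar>?d (?e n) z\<bar> \<le> norm (H (fst z)) * norm (H (snd z)) * (k * (1 / sqrt \<bar>fst z\<bar>) * (1 / sqrt \<bar>snd z\<bar>))"
        by (intro mult_left_mono) (auto simp del: of_nat_Suc)
      then show ?case
        unfolding norm_mult norm_of_real complex_mod_cnj by (simp add: mult_ac del: of_nat_Suc)
    qed
    show "AE z in lborel. (\<lambda>n. H (fst z) * cnj (H (snd z)) * of_real (?d (?e n) z)) \<longlonglongrightarrow> 0"
      using AE_pair_squares_neq
    proof eventually_elim
      case (elim z)
      have "(\<lambda>n. k\<^sup>2 * (?e n)\<^sup>2 / ((fst z)\<^sup>2 - (snd z)\<^sup>2)\<^sup>2) \<longlonglongrightarrow> k\<^sup>2 * 0\<^sup>2 / ((fst z)\<^sup>2 - (snd z)\<^sup>2)\<^sup>2"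
        using elim by (intro tendsto_intros inverse_Suc_tendsto_0) simp
      then have x: "(\<lambda>n. k\<^sup>2 * (?e n)\<^sup>2 / ((fst z)\<^sup>2 - (snd z)\<^sup>2)\<^sup>2) \<longlonglongrightarrow> 0" by simp
      have l: "0 \<le> ?d (?e n) z" for n
        by (rule log_kernel_diff_nonneg[OF en k])
      have u: "?d (?e n) z \<le> k\<^sup>2 * (?e n)\<^sup>2 / ((fst z)\<^sup>2 - (snd z)\<^sup>2)\<^sup>2" for n
        by (rule log_kernel_diff_small[OF en k]) (use elim in auto)
      have "(\<lambda>n. ?d (?e n) z) \<longlonglongrightarrow> 0"
        by (rule tendsto_sandwich[OF always_eventually[OF allI[OF l]] always_eventually[OF allI[OF u]] tendsto_const x])
      then have "(\<lambda>n. H (fst z) * cnj (H (snd z)) * of_real (?d (?e n) z)) \<longlonglongrightarrow> H (fst z) * cnj (H (snd z)) * of_real 0"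
        by (intro tendsto_intros)
      then show ?case by simp
    qed
  qed (use m in auto)
  then have "(\<lambda>n. - (\<integral>z. H (fst z) * cnj (H (snd z)) * of_real (?d (?e n) z) \<partial>lborel)) \<longlonglongrightarrow> - 0"
    by (intro tendsto_minus) simp
  also have "(\<lambda>n. - (\<integral>z. H (fst z) * cnj (H (snd z)) * of_real (?d (?e n) z) \<partial>lborel)) = (\<lambda>n. of_real (?E ?p (?e n) - ?E (\<lambda>\<eta>. \<eta>) (?e n)))"
    by (rule ext, rule diff[symmetric]) simp
  finally have lim: "(\<lambda>n. ?E ?p (?e n) - ?E (\<lambda>\<eta>. \<eta>) (?e n)) \<longlonglongrightarrow> 0"
    by (simp only: minus_zero tendsto_of_real_iff[of _ 0, where 'a = complex, unfolded of_real_0])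
  let ?J = "\<lambda>p. \<integral>\<^sup>+t. ennreal ((norm (\<integral>\<eta>. H \<eta> * of_real (cos (t * p \<eta>)) \<partial>lborel))\<^sup>2 / \<bar>t\<bar>) * indicator {0..} t \<partial>lborel"
  have l0: "(\<lambda>n. ennreal (?E (\<lambda>\<eta>. \<eta>) (?e n))) \<longlonglongrightarrow> ?J (\<lambda>\<eta>. \<eta>)"
    by (rule cos_transform_energy_LIMSEQ[OF _ m0 E0(1)]) auto
  have l1: "(\<lambda>n. ennreal (?E ?p (?e n))) \<longlonglongrightarrow> ?J ?p"
    by (rule cos_transform_energy_LIMSEQ[OF _ m1 E1(1)]) auto
  have "(\<lambda>n. ?E (\<lambda>\<eta>. \<eta>) (?e n) - ?E ?p (?e n)) \<longlonglongrightarrow> 0"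
    using tendsto_minus[OF lim] by simp
  then have J: "?J (\<lambda>\<eta>. \<eta>) = ?J ?p"
    using ennreal_lim_eq[OF l0 l1] ennreal_lim_eq[OF l1 l0 lim] by (intro antisym)
  have "(\<integral>\<^sup>+t. ennreal ((norm (\<integral>\<eta>. H \<eta> * of_real (cos (t * p \<eta>)) \<partial>lborel))\<^sup>2 / \<bar>t\<bar>) \<partial>lborel) = 2 * ?J p"
    if [measurable]: "p \<in> borel_measurable borel" for p
    by (rule nn_integral_even) auto
  from this[of "\<lambda>\<eta>. \<eta>"] this[of ?p] show ?thesis
    using J by simp
qed

section \<open>The isometry on test functions\<close>

text \<open>P is the frequency conjugate to the last variable: up to a constant,
  \<open>P = snd\<close> reproduces f and \<open>P = norm\<close> its wave trace. Holding \<xi>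
  fixed isolates the one-dimensional problem to which \<open>energy_identity_1d\<close>
  applies.\<close>

definition cos_transform :: "('a::euclidean_space \<times> real \<Rightarrow> complex) \<Rightarrow> ('a \<times> real \<Rightarrow> real) \<Rightarrow> 'a \<Rightarrow> real \<Rightarrow> complex" where
  "cos_transform h P \<xi> t = (\<integral>\<eta>. h (\<xi>, \<eta>) * of_real (cos (t * P (\<xi>, \<eta>))) \<partial>lborel)"

definition cos_synthesis :: "('a::euclidean_space \<times> real \<Rightarrow> complex) \<Rightarrow> ('a \<times> real \<Rightarrow> real) \<Rightarrow> 'a \<Rightarrow> real \<Rightarrow> complex" where
  "cos_synthesis h P x t = (\<integral>\<zeta>. h \<zeta> * of_real (cos (t * P \<zeta>)) * cis (x \<bullet> fst \<zeta>) \<partial>lborel)"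

lemma integrable_decay_1d: "integrable lborel (\<lambda>\<eta>::real. 1 / (1 + \<eta>\<^sup>2))"
  using integrable_decay[where 'a = real] by simp

lemma one_plus_sq_pos: "0 < 1 + (x::real)\<^sup>2"
  by (simp add: add_pos_nonneg)

lemma one_le_one_plus_sq_power: "1 \<le> (1 + (x::real)\<^sup>2) ^ n"
  by (rule one_le_power) simp

lemma one_plus_sq_power_pos: "0 < (1 + (x::real)\<^sup>2) ^ n"
  by (rule zero_less_power[OF one_plus_sq_pos])

lemma inverse_one_plus_sq_power_le: "1 / (1 + (x::real)\<^sup>2) ^ n \<le> 1"
  by (subst divide_le_eq_1_pos[OF one_plus_sq_power_pos]) (rule one_le_one_plus_sq_power)

text \<open>The bound separates the variables. The power DIM makes it integrable in \<xi>, and the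
  square in \<eta> leaves room for the first moment that the one-dimensional identity asks
  for.\<close>

locale decaying =
  fixes h :: "'a::euclidean_space \<times> real \<Rightarrow> complex" and C :: real
  assumes cont: "continuous_on UNIV h" and C0: "0 \<le> C"
    and bound: "norm (h (\<xi>, \<eta>)) \<le> C / (1 + (norm \<xi>)\<^sup>2) ^ DIM('a) / (1 + \<eta>\<^sup>2)\<^sup>2"
begin

lemma h_measurable [measurable]: "h \<in> borel_measurable borel"
  using cont by (rule borel_measurable_continuous_onI)

lemma h_slice_measurable [measurable]: "(\<lambda>\<eta>. h (\<xi>, \<eta>)) \<in> borel_measurable borel"
  by measurable

lemma bound_1: "norm (h (\<xi>, \<eta>)) \<le> C * (1 / (1 + (norm \<xi>)\<^sup>2) ^ DIM('a)) * (1 / (1 + \<eta>\<^sup>2))"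
proof -
  have "1 * (1 + \<eta>\<^sup>2) \<le> (1 + \<eta>\<^sup>2) * (1 + \<eta>\<^sup>2)"
    by (rule mult_right_mono) auto
  then have "1 + \<eta>\<^sup>2 \<le> (1 + \<eta>\<^sup>2)\<^sup>2"
    by (simp only: power2_eq_square[of "1 + \<eta>\<^sup>2"] mult_1)
  then have "C / (1 + (norm \<xi>)\<^sup>2) ^ DIM('a) / (1 + \<eta>\<^sup>2)\<^sup>2 \<le> C / (1 + (norm \<xi>)\<^sup>2) ^ DIM('a) / (1 + \<eta>\<^sup>2)"
    using C0 one_plus_sq_pos[of \<eta>] one_plus_sq_pos[of "norm \<xi>"] by (intro divide_left_mono) auto
  with bound[of \<xi> \<eta>] show ?thesis by simp
qed

lemma bound_2: "norm (h (\<xi>, \<eta>)) \<le> C * (1 / (1 + \<eta>\<^sup>2))"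
proof -
  have "1 / (1 + (norm \<xi>)\<^sup>2) ^ DIM('a) \<le> 1"
    by (rule inverse_one_plus_sq_power_le)
  then have "C * (1 / (1 + (norm \<xi>)\<^sup>2) ^ DIM('a)) * (1 / (1 + \<eta>\<^sup>2)) \<le> C * 1 * (1 / (1 + \<eta>\<^sup>2))"
    using C0 by (intro mult_right_mono mult_left_mono) auto
  with bound_1[of \<xi> \<eta>] show ?thesis by simp
qed

lemma slice_integrable: "integrable lborel (\<lambda>\<eta>. h (\<xi>, \<eta>))"
  by (rule Bochner_Integration.integrable_bound[OF integrable_mult_right[OF integrable_decay_1d, of C]])
     (use bound_2 C0 in \<open>auto intro!: AE_I2\<close>)

lemma slice_bounded: "norm (h (\<xi>, \<eta>)) \<le> C"
proof -
  have "1 / (1 + \<eta>\<^sup>2) \<le> 1"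
    by (subst divide_le_eq_1_pos[OF one_plus_sq_pos]) simp
  then have "C * (1 / (1 + \<eta>\<^sup>2)) \<le> C * 1"
    using C0 by (intro mult_left_mono)
  with bound_2[of \<xi> \<eta>] show ?thesis by simp
qed

lemma slice_moment_integrable: "integrable lborel (\<lambda>\<eta>. h (\<xi>, \<eta>) * of_real \<eta>)"
proof (rule Bochner_Integration.integrable_bound[OF integrable_mult_right[OF integrable_decay_1d, of C]])
  have "norm (h (\<xi>, \<eta>) * of_real \<eta>) \<le> C * (1 / (1 + \<eta>\<^sup>2))" for \<eta>
  proof -
    have "\<bar>\<eta>\<bar> \<le> 1 + \<eta>\<^sup>2"
      using sum_squares_bound[of 1 "\<bar>\<eta>\<bar>"] abs_ge_zero[of \<eta>] unfolding power2_abs power_one by linarith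
    moreover have "norm (h (\<xi>, \<eta>)) \<le> C / (1 + \<eta>\<^sup>2)\<^sup>2"
    proof -
      have "C / (1 + (norm \<xi>)\<^sup>2) ^ DIM('a) \<le> C / 1"
        using C0 by (intro divide_left_mono one_le_one_plus_sq_power) (simp_all only: mult_1_right one_plus_sq_power_pos)
      then have "C / (1 + (norm \<xi>)\<^sup>2) ^ DIM('a) / (1 + \<eta>\<^sup>2)\<^sup>2 \<le> C / (1 + \<eta>\<^sup>2)\<^sup>2"
        by (intro divide_right_mono) auto
      with bound[of \<xi> \<eta>] show ?thesis by simp
    qed
    ultimately have "norm (h (\<xi>, \<eta>)) * \<bar>\<eta>\<bar> \<le> C / (1 + \<eta>\<^sup>2)\<^sup>2 * (1 + \<eta>\<^sup>2)"
      using C0 by (intro mult_mono) auto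
    also have "\<dots> = C * (1 / (1 + \<eta>\<^sup>2))"
      using one_plus_sq_pos[of \<eta>] by (simp add: power2_eq_square[of "1 + \<eta>\<^sup>2"])
    finally show ?thesis by (simp add: norm_mult)
  qed
  then show "AE \<eta> in lborel. norm (h (\<xi>, \<eta>) * of_real \<eta>) \<le> norm (C * (1 / (1 + \<eta>\<^sup>2)))"
    using C0 by (intro AE_I2) simp
qed measurable

context
  fixes P :: "'a \<times> real \<Rightarrow> real"
  assumes P: "continuous_on UNIV P"
begin

lemma P_measurable [measurable]: "P \<in> borel_measurable borel"
  using P by (rule borel_measurable_continuous_onI)

lemma integrand_norm: "norm (h (\<xi>, \<eta>) * of_real (cos (t * P (\<xi>, \<eta>)))) \<le> norm (h (\<xi>, \<eta>))"
  by (auto simp: norm_mult intro!: mult_left_le)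

lemma cos_transform_continuous: "continuous_on UNIV (\<lambda>\<xi>. cos_transform h P \<xi> t)"
proof -
  have "(\<lambda>n. cos_transform h P (u n) t) \<longlonglongrightarrow> cos_transform h P l t" if u: "u \<longlonglongrightarrow> l" for u l
    unfolding cos_transform_def
  proof (rule integral_dominated_convergence)
    show "integrable lborel (\<lambda>\<eta>::real. C * (1 / (1 + \<eta>\<^sup>2)))"
      by (rule integrable_mult_right[OF integrable_decay_1d])
    show "AE \<eta> in lborel. norm (h (u n, \<eta>) * of_real (cos (t * P (u n, \<eta>)))) \<le> C * (1 / (1 + \<eta>\<^sup>2))" for n
      by (intro AE_I2 order_trans[OF integrand_norm] bound_2)
    have hl: "(\<lambda>n. h (u n, \<eta>)) \<longlonglongrightarrow> h (l, \<eta>)" and Pl: "(\<lambda>n. P (u n, \<eta>)) \<longlonglongrightarrow> P (l, \<eta>)" for \<eta>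
      by (rule continuous_on_tendsto_compose[OF cont] continuous_on_tendsto_compose[OF P]; auto intro!: tendsto_intros u)+
    show "AE \<eta> in lborel. (\<lambda>n. h (u n, \<eta>) * of_real (cos (t * P (u n, \<eta>)))) \<longlonglongrightarrow> h (l, \<eta>) * of_real (cos (t * P (l, \<eta>)))"
      by (intro AE_I2 tendsto_intros hl Pl)
  qed measurable
  then show ?thesis
    by (simp add: continuous_on_sequentially o_def)
qed

lemma cos_transform_bound: "norm (cos_transform h P \<xi> t) \<le> C * (\<integral>\<eta>. 1 / (1 + \<eta>\<^sup>2) \<partial>lborel) * (1 / (1 + (norm \<xi>)\<^sup>2) ^ DIM('a))"
proof -
  have "norm (cos_transform h P \<xi> t) \<le> (\<integral>\<eta>. C * (1 / (1 + (norm \<xi>)\<^sup>2) ^ DIM('a)) * (1 / (1 + \<eta>\<^sup>2)) \<partial>lborel)"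
    unfolding cos_transform_def
  proof (rule order_trans[OF integral_norm_bound], rule integral_mono)
    show "integrable lborel (\<lambda>\<eta>. C * (1 / (1 + (norm \<xi>)\<^sup>2) ^ DIM('a)) * (1 / (1 + \<eta>\<^sup>2)))"
      by (rule integrable_mult_right[OF integrable_decay_1d])
    show "integrable lborel (\<lambda>\<eta>. norm (h (\<xi>, \<eta>) * of_real (cos (t * P (\<xi>, \<eta>)))))"
      by (intro integrable_norm Bochner_Integration.integrable_bound[OF slice_integrable[of \<xi>]] AE_I2 integrand_norm) measurable
    show "norm (h (\<xi>, \<eta>) * of_real (cos (t * P (\<xi>, \<eta>)))) \<le> C * (1 / (1 + (norm \<xi>)\<^sup>2) ^ DIM('a)) * (1 / (1 + \<eta>\<^sup>2))" for \<eta>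
      by (rule order_trans[OF integrand_norm bound_1])
  qed
  then show ?thesis
    by (simp only: integral_mult_right_zero) (simp only: mult_ac)
qed

lemma cos_transform_integrable: "integrable lborel (\<lambda>\<xi>. cos_transform h P \<xi> t)"
proof (rule Bochner_Integration.integrable_bound[OF integrable_mult_right[OF integrable_decay]])
  show "AE \<xi> in lborel. norm (cos_transform h P \<xi> t) \<le> norm (C * (\<integral>\<eta>. 1 / (1 + \<eta>\<^sup>2) \<partial>lborel) * (1 / (1 + (norm (\<xi>::'a))\<^sup>2) ^ DIM('a)))"
    unfolding real_norm_def by (intro AE_I2 order_trans[OF cos_transform_bound abs_ge_self])
  show "(\<lambda>\<xi>. cos_transform h P \<xi> t) \<in> borel_measurable lborel"
    using borel_measurable_continuous_onI[OF cos_transform_continuous] by simp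
qed

lemma cos_transform_bounded: "norm (cos_transform h P \<xi> t) \<le> C * (\<integral>\<eta>. 1 / (1 + \<eta>\<^sup>2) \<partial>lborel)"
proof -
  have "C * (\<integral>\<eta>. 1 / (1 + (\<eta>::real)\<^sup>2) \<partial>lborel) * (1 / (1 + (norm \<xi>)\<^sup>2) ^ DIM('a)) \<le> C * (\<integral>\<eta>. 1 / (1 + (\<eta>::real)\<^sup>2) \<partial>lborel) * 1"
    using C0 by (intro mult_left_mono inverse_one_plus_sq_power_le mult_nonneg_nonneg integral_nonneg_AE) auto
  then show ?thesis using cos_transform_bound[of \<xi> t] by simp
qed

lemma cos_synthesis_eq: "cos_synthesis h P x t = (\<integral>\<xi>. cos_transform h P \<xi> t * cis (x \<bullet> \<xi>) \<partial>lborel)"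
proof -
  have i: "integrable (lborel \<Otimes>\<^sub>M lborel) (\<lambda>(\<xi>, \<eta>). h (\<xi>, \<eta>) * of_real (cos (t * P (\<xi>, \<eta>))) * cis (x \<bullet> \<xi>))"
  proof (rule integrable_pair_bound[OF integrable_mult_right[OF integrable_decay, of C] integrable_decay_1d])
    show "norm (h (\<xi>, \<eta>) * of_real (cos (t * P (\<xi>, \<eta>))) * cis (x \<bullet> \<xi>)) \<le> norm (C * (1 / (1 + (norm \<xi>)\<^sup>2) ^ DIM('a))) * norm (1 / (1 + \<eta>\<^sup>2))" for \<xi> \<eta>
    proof -
      have "norm (h (\<xi>, \<eta>) * of_real (cos (t * P (\<xi>, \<eta>))) * cis (x \<bullet> \<xi>)) = norm (h (\<xi>, \<eta>) * of_real (cos (t * P (\<xi>, \<eta>))))"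
        by (simp add: norm_mult)
      also have "\<dots> \<le> C * (1 / (1 + (norm \<xi>)\<^sup>2) ^ DIM('a)) * (1 / (1 + \<eta>\<^sup>2))"
        by (rule order_trans[OF integrand_norm bound_1])
      finally show ?thesis using C0 by (simp add: abs_mult)
    qed
  qed measurable
  have "cos_synthesis h P x t = (\<integral>\<xi>. (\<integral>\<eta>. h (\<xi>, \<eta>) * of_real (cos (t * P (\<xi>, \<eta>))) * cis (x \<bullet> \<xi>) \<partial>lborel) \<partial>lborel)"
    using lborel_pair.integral_fst'[OF i] unfolding cos_synthesis_def lborel_prod by (simp add: case_prod_unfold)
  then show ?thesis
    by (simp add: cos_transform_def)
qed

lemma cos_synthesis_plancherel:
  "(\<integral>\<^sup>+x. ennreal ((norm (cos_synthesis h P x t))\<^sup>2) \<partial>lborel)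
    = ennreal ((2 * pi) ^ DIM('a)) * (\<integral>\<^sup>+\<xi>. ennreal ((norm (cos_transform h P \<xi> t))\<^sup>2) \<partial>lborel)"
  unfolding cos_synthesis_eq
  by (rule plancherel[OF cos_transform_integrable cos_transform_continuous cos_transform_bounded])

lemma cos_transform_measurable [measurable (raw)]:
  assumes "f \<in> borel_measurable M" "g \<in> borel_measurable M"
  shows "(\<lambda>z. cos_transform h P (f z) (g z)) \<in> borel_measurable M"
proof -
  have "(\<lambda>z. cos_transform h P (fst z) (snd z)) \<in> borel_measurable (borel \<Otimes>\<^sub>M borel)"
    unfolding cos_transform_def by measurable
  from measurable_compose[OF measurable_Pair[OF assms] this] show ?thesis by simp
qed

lemma cos_synthesis_measurable [measurable (raw)]:
  assumes "f \<in> borel_measurable M" "g \<in> borel_measurable M"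
  shows "(\<lambda>z. cos_synthesis h P (f z) (g z)) \<in> borel_measurable M"
proof -
  have "(\<lambda>z. cos_synthesis h P (fst z) (snd z)) \<in> borel_measurable (borel \<Otimes>\<^sub>M borel)"
    unfolding cos_synthesis_eq by measurable
  from measurable_compose[OF measurable_Pair[OF assms] this] show ?thesis by simp
qed

text \<open>For fixed t the weight is a constant, so Plancherel in x applies slice by slice. Tonelli
  then moves the t-integral inside, at fixed \<xi>.\<close>

lemma cos_synthesis_wnorm2:
  "(\<integral>\<^sup>+z. ennreal ((norm (cos_synthesis h P (fst z) (snd z)))\<^sup>2 / \<bar>snd z\<bar>) \<partial>lborel)
    = ennreal ((2 * pi) ^ DIM('a)) * (\<integral>\<^sup>+\<xi>. (\<integral>\<^sup>+t. ennreal ((norm (cos_transform h P \<xi> t))\<^sup>2 / \<bar>t\<bar>) \<partial>lborel) \<partial>lborel)"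
proof -
  have d: "ennreal (a / \<bar>t\<bar>) = ennreal (1 / \<bar>t\<bar>) * ennreal a" if "0 \<le> a" for a t :: real
    using that by (simp flip: ennreal_mult)
  have m1: "(\<lambda>z. ennreal ((norm (cos_synthesis h P (fst z) (snd z)))\<^sup>2 / \<bar>snd z\<bar>)) \<in> borel_measurable (lborel \<Otimes>\<^sub>M lborel)"
    by measurable
  have m2: "(\<lambda>(\<xi>, t). ennreal ((norm (cos_transform h P \<xi> t))\<^sup>2 / \<bar>t\<bar>)) \<in> borel_measurable (lborel \<Otimes>\<^sub>M lborel)"
    unfolding case_prod_unfold by measurable
  have "(\<integral>\<^sup>+z. ennreal ((norm (cos_synthesis h P (fst z) (snd z)))\<^sup>2 / \<bar>snd z\<bar>) \<partial>lborel)
     = (\<integral>\<^sup>+t. (\<integral>\<^sup>+x. ennreal ((norm (cos_synthesis h P x t))\<^sup>2 / \<bar>t\<bar>) \<partial>lborel) \<partial>lborel)"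
    using lborel_pair.nn_integral_snd[OF m1] unfolding lborel_prod by simp
  also have "\<dots> = (\<integral>\<^sup>+t. ennreal (1 / \<bar>t\<bar>) * (ennreal ((2 * pi) ^ DIM('a)) * (\<integral>\<^sup>+\<xi>. ennreal ((norm (cos_transform h P \<xi> t))\<^sup>2) \<partial>lborel)) \<partial>lborel)"
    unfolding cos_synthesis_plancherel[symmetric]
    unfolding d[OF zero_le_power2] by (subst nn_integral_cmult) measurable
  also have "\<dots> = (\<integral>\<^sup>+t. ennreal ((2 * pi) ^ DIM('a)) * (\<integral>\<^sup>+\<xi>. ennreal ((norm (cos_transform h P \<xi> t))\<^sup>2 / \<bar>t\<bar>) \<partial>lborel) \<partial>lborel)"
  proof (rule nn_integral_cong)
    fix t :: real
    have [measurable]: "(\<lambda>\<xi>. cos_transform h P \<xi> t) \<in> borel_measurable borel"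
      by (rule borel_measurable_continuous_onI[OF cos_transform_continuous])
    show "ennreal (1 / \<bar>t\<bar>) * (ennreal ((2 * pi) ^ DIM('a)) * (\<integral>\<^sup>+\<xi>. ennreal ((norm (cos_transform h P \<xi> t))\<^sup>2) \<partial>lborel))
      = ennreal ((2 * pi) ^ DIM('a)) * (\<integral>\<^sup>+\<xi>. ennreal ((norm (cos_transform h P \<xi> t))\<^sup>2 / \<bar>t\<bar>) \<partial>lborel)"
      unfolding d[OF zero_le_power2] by (subst nn_integral_cmult) (measurable, simp only: mult_ac)
  qed
  also have "\<dots> = ennreal ((2 * pi) ^ DIM('a)) * (\<integral>\<^sup>+t. (\<integral>\<^sup>+\<xi>. ennreal ((norm (cos_transform h P \<xi> t))\<^sup>2 / \<bar>t\<bar>) \<partial>lborel) \<partial>lborel)"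
    by (rule nn_integral_cmult) measurable
  also have "(\<integral>\<^sup>+t. (\<integral>\<^sup>+\<xi>. ennreal ((norm (cos_transform h P \<xi> t))\<^sup>2 / \<bar>t\<bar>) \<partial>lborel) \<partial>lborel)
      = (\<integral>\<^sup>+\<xi>. (\<integral>\<^sup>+t. ennreal ((norm (cos_transform h P \<xi> t))\<^sup>2 / \<bar>t\<bar>) \<partial>lborel) \<partial>lborel)"
    by (rule lborel_pair.Fubini'[OF m2])
  finally show ?thesis .
qed

end

lemma snd_continuous: "continuous_on UNIV (snd :: 'a \<times> real \<Rightarrow> real)"
  and norm_continuous: "continuous_on UNIV (norm :: 'a \<times> real \<Rightarrow> real)"
  by (intro continuous_intros)+

text \<open>At t = 0 the cosine transform is the plain integral of h over \<eta>. By Plancherel the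
  vanishing of the synthesis there makes this integral 0 for almost every \<xi>, which is the
  mean-zero condition of \<open>energy_identity_1d\<close>.\<close>

theorem cos_synthesis_isometry:
  assumes 0: "\<And>x. cos_synthesis h snd x 0 = 0"
  shows "(\<integral>\<^sup>+z. ennreal ((norm (cos_synthesis h snd (fst z) (snd z)))\<^sup>2 / \<bar>snd z\<bar>) \<partial>lborel)
    = (\<integral>\<^sup>+z. ennreal ((norm (cos_synthesis h norm (fst z) (snd z)))\<^sup>2 / \<bar>snd z\<bar>) \<partial>lborel)"
proof -
  have "(\<integral>\<^sup>+\<xi>. ennreal ((norm (cos_transform h snd \<xi> 0))\<^sup>2) \<partial>lborel) = 0"
    using cos_synthesis_plancherel[OF snd_continuous, of 0] by (simp add: 0)
  then have "AE \<xi> in lborel. cos_transform h snd \<xi> 0 = 0"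
    using borel_measurable_continuous_onI[OF cos_transform_continuous[OF snd_continuous, of 0]]
    by (subst (asm) nn_integral_0_iff_AE) auto
  then have "AE \<xi> in lborel. (\<integral>\<^sup>+t. ennreal ((norm (cos_transform h snd \<xi> t))\<^sup>2 / \<bar>t\<bar>) \<partial>lborel)
      = (\<integral>\<^sup>+t. ennreal ((norm (cos_transform h norm \<xi> t))\<^sup>2 / \<bar>t\<bar>) \<partial>lborel)"
  proof eventually_elim
    case (elim \<xi>)
    have "(\<integral>\<eta>. h (\<xi>, \<eta>) \<partial>lborel) = 0"
      using elim by (simp add: cos_transform_def)
    \<comment> \<open>With k = |xi| the shifted frequency sqrt(k^2 + eta^2) is the norm of (\<xi>,
      \<eta>).\<close>
    from energy_identity_1d[OF slice_integrable slice_bounded slice_moment_integrable this, of "norm \<xi>"]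
    show ?case
      by (simp add: cos_transform_def norm_Pair)
  qed
  then show ?thesis
    unfolding cos_synthesis_wnorm2[OF snd_continuous] cos_synthesis_wnorm2[OF norm_continuous]
    by (intro arg_cong2[where f = "(*)"] nn_integral_cong_AE refl)
qed

end

section \<open>From cosine synthesis back to a test function and its wave trace\<close>

lemma decaying_FT:
  fixes f :: "'a::euclidean_space \<times> real \<Rightarrow> real"
  assumes f: "test_fun f"
  obtains C where "decaying (FTR f) C"
proof -
  \<comment> \<open>Since 1 + |zeta|^2 dominates both 1 + |xi|^2 and 1 + eta^2, DIM powers are spent
    on \<xi> and two on \<eta>.\<close>
  let ?N = "DIM('a) + 2"
  obtain C where C: "0 \<le> C" "\<And>\<zeta>. norm (FTR f \<zeta>) \<le> C / (1 + (norm (\<zeta> :: 'a \<times> real))\<^sup>2) ^ ?N"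
    using FT_le_decay[OF f] by blast
  show thesis
  proof (rule that[of C], unfold_locales)
    show "continuous_on UNIV (FTR f)"
      by (intro FT_continuous test_fun_integrable f)
    fix \<xi> :: 'a and \<eta> :: real
    have n: "(norm (\<xi>, \<eta>))\<^sup>2 = (norm \<xi>)\<^sup>2 + \<eta>\<^sup>2"
      by (simp add: norm_Pair)
    have "(1 + (norm \<xi>)\<^sup>2) ^ DIM('a) * (1 + \<eta>\<^sup>2)\<^sup>2 \<le> (1 + (norm (\<xi>, \<eta>))\<^sup>2) ^ DIM('a) * (1 + (norm (\<xi>, \<eta>))\<^sup>2)\<^sup>2"
      unfolding n by (intro mult_mono power_mono) auto
    also have "\<dots> = (1 + (norm (\<xi>, \<eta>))\<^sup>2) ^ ?N"
      by (simp only: power_add)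
    finally have "C / (1 + (norm (\<xi>, \<eta>))\<^sup>2) ^ ?N \<le> C / ((1 + (norm \<xi>)\<^sup>2) ^ DIM('a) * (1 + \<eta>\<^sup>2)\<^sup>2)"
      using C(1) one_plus_sq_pos[of \<eta>] one_plus_sq_pos[of "norm \<xi>"] one_plus_sq_pos[of "norm (\<xi>, \<eta>)"]
      by (intro divide_left_mono mult_pos_pos zero_less_power) auto
    then show "norm (FTR f (\<xi>, \<eta>)) \<le> C / (1 + (norm \<xi>)\<^sup>2) ^ DIM('a) / (1 + \<eta>\<^sup>2)\<^sup>2"
      using C(2)[of "(\<xi>, \<eta>)"] by (simp only: divide_divide_eq_left)
  qed (use C in auto)
qed

text \<open>The cosine averages the inversion formula at (x, s) and (x, -s), and evenness makes the
  two values equal.\<close>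

lemma cos_synthesis_snd_FT:
  fixes f :: "'a::euclidean_space \<times> real \<Rightarrow> real"
  assumes f: "test_fun f" and even: "\<And>x s. f (x, - s) = f (x, s)"
  shows "cos_synthesis (FTR f) snd x s = of_real ((2 * pi) ^ DIM('a \<times> real) * f (x, s))"
proof -
  let ?h = "FTR f"
  have i: "integrable lborel (\<lambda>\<zeta>. ?h \<zeta> * cis ((x, r) \<bullet> \<zeta>))" for r
    by (intro integrable_mult_cis integrable_FT f) measurable
  have c: "of_real (cos b) * cis a = (cis (a + b) + cis (a - b)) / 2" for a b
    by (auto simp: complex_eq_iff cos_add sin_add cos_diff sin_diff)
  have "?h \<zeta> * of_real (cos (s * snd \<zeta>)) * cis (x \<bullet> fst \<zeta>) = (?h \<zeta> * cis ((x, s) \<bullet> \<zeta>) + ?h \<zeta> * cis ((x, - s) \<bullet> \<zeta>)) / 2" for \<zeta>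
    unfolding mult.assoc c by (simp add: inner_prod_def algebra_simps)
  then have "cos_synthesis ?h snd x s = ((\<integral>\<zeta>. ?h \<zeta> * cis ((x, s) \<bullet> \<zeta>) \<partial>lborel) + (\<integral>\<zeta>. ?h \<zeta> * cis ((x, - s) \<bullet> \<zeta>) \<partial>lborel)) / 2"
    unfolding cos_synthesis_def by (simp only: integral_divide_zero Bochner_Integration.integral_add[OF i i])
  also have "\<dots> = of_real ((2 * pi) ^ DIM('a \<times> real) * f (x, s))"
    unfolding test_fun_fourier_inversion[OF f] even by simp
  finally show ?thesis .
qed

text \<open>\<open>wave\<close> takes a real part and the synthesis does not. For real f the
  transform at -\<zeta> is the conjugate of that at \<zeta>, and the other factors of the integrand
  have the same symmetry; so reflecting the variable conjugates the integral, which is therefore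
  real.\<close>

lemma cos_synthesis_norm_FT:
  fixes f :: "'a::euclidean_space \<times> real \<Rightarrow> real"
  assumes f: "test_fun f"
  shows "cos_synthesis (FTR f) norm x t = of_real ((2 * pi) ^ DIM('a \<times> real) * wave f ((x, 0), t))"
proof -
  let ?h = "FTR f"
  let ?g = "\<lambda>\<zeta>. ?h \<zeta> * of_real (cos (t * norm \<zeta>)) * cis (x \<bullet> fst \<zeta>)"
  have [measurable]: "(\<lambda>x. complex_of_real (f x)) \<in> borel_measurable borel"
    using test_fun_integrable[OF f] by auto
  have mg: "?g \<in> borel_measurable borel"
    by (intro borel_measurable_times FT_measurable borel_measurable_continuous_onI[of "\<lambda>\<zeta>. complex_of_real (cos (t * norm \<zeta>))"]
          borel_measurable_continuous_onI[of "\<lambda>\<zeta>. cis (x \<bullet> fst \<zeta>)"] continuous_intros) measurable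
  have ch: "cnj (?h \<zeta>) = ?h (- \<zeta>)" for \<zeta>
    unfolding FT_def by (subst Bochner_Integration.integral_cnj[symmetric]) (simp add: cis_cnj)
  have "cnj (\<integral>\<zeta>. ?g \<zeta> \<partial>lborel) = (\<integral>\<zeta>. cnj (?g \<zeta>) \<partial>lborel)"
    by (rule Bochner_Integration.integral_cnj[symmetric])
  also have "\<dots> = (\<integral>\<zeta>. ?g (0 + (- 1) *\<^sub>R \<zeta>) \<partial>lborel)"
    by (simp add: ch cis_cnj)
  also have "\<dots> = (\<integral>\<zeta>. ?g \<zeta> \<partial>lborel)"
    by (subst lborel_integral_affine[OF _ mg, of "- 1" 0]) simp_all
  finally have real: "cnj (\<integral>\<zeta>. ?g \<zeta> \<partial>lborel) = (\<integral>\<zeta>. ?g \<zeta> \<partial>lborel)" .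
  have "z = of_real (Re z)" if "cnj z = z" for z
    using that by (simp add: complex_eq_iff)
  from this[OF real] have "(\<integral>\<zeta>. ?g \<zeta> \<partial>lborel) = of_real (Re (\<integral>\<zeta>. ?g \<zeta> \<partial>lborel))" .
  also have "Re (\<integral>\<zeta>. ?g \<zeta> \<partial>lborel) = (2 * pi) ^ DIM('a \<times> real) * wave f ((x, 0), t)"
    by (simp add: wave_def inner_prod_def)
  finally show ?thesis
    by (simp add: cos_synthesis_def)
qed

theorem wave_trace_isometry:
  fixes f :: "'a::euclidean_space \<times> real \<Rightarrow> real"
  assumes f: "test_fun f" and even: "\<And>x s. f (x, - s) = f (x, s)" and 0: "\<And>x. f (x, 0) = 0"
  shows "(\<integral>\<^sup>+z. ennreal ((f z)\<^sup>2 / \<bar>snd z\<bar>) \<partial>lborel)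
    = (\<integral>\<^sup>+z. ennreal ((wave f ((fst z, 0), snd z))\<^sup>2 / \<bar>snd z\<bar>) \<partial>lborel)"
proof -
  let ?h = "FTR f"
  let ?c = "(2 * pi) ^ DIM('a \<times> real)"
  obtain C where C: "decaying ?h C"
    using decaying_FT[OF f] by blast
  have c: "0 < ?c" by simp
  have scale: "(\<integral>\<^sup>+z. ennreal ((norm (complex_of_real (?c * g z)))\<^sup>2 / \<bar>snd z\<bar>) \<partial>lborel) = ennreal (?c\<^sup>2) * (\<integral>\<^sup>+z. ennreal ((g z)\<^sup>2 / \<bar>snd z\<bar>) \<partial>lborel)"
    if [measurable]: "g \<in> borel_measurable borel" for g :: "'a \<times> real \<Rightarrow> real"
  proof -
    have "ennreal ((norm (complex_of_real (?c * g z)))\<^sup>2 / \<bar>snd z\<bar>) = ennreal (?c\<^sup>2) * ennreal ((g z)\<^sup>2 / \<bar>snd z\<bar>)" for z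
      unfolding norm_of_real power2_abs power_mult_distrib
      by (subst ennreal_mult[symmetric]) auto
    moreover have "(\<lambda>z. (g z)\<^sup>2 / \<bar>snd z\<bar>) \<in> borel_measurable borel"
      by (intro borel_measurable_divide borel_measurable_power that borel_measurable_continuous_onI continuous_intros)
    ultimately show ?thesis
      by (simp only:) (rule nn_integral_cmult, simp)
  qed
  have mf: "f \<in> borel_measurable borel"
    by (rule borel_measurable_continuous_onI[OF test_fun_continuous[OF f]])
  have mw: "(\<lambda>z. wave f ((fst z, 0), snd z)) \<in> borel_measurable borel"
    by (intro borel_measurable_continuous_onI continuous_on_compose2[OF C_inf_continuous[OF wave_exists(1)[OF f]]] continuous_intros) auto
  have "ennreal (?c\<^sup>2) * (\<integral>\<^sup>+z. ennreal ((f z)\<^sup>2 / \<bar>snd z\<bar>) \<partial>lborel)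
     = ennreal (?c\<^sup>2) * (\<integral>\<^sup>+z. ennreal ((wave f ((fst z, 0), snd z))\<^sup>2 / \<bar>snd z\<bar>) \<partial>lborel)"
    using decaying.cos_synthesis_isometry[OF C] scale[OF mf] scale[OF mw]
    by (simp only: cos_synthesis_snd_FT[OF f even] cos_synthesis_norm_FT[OF f] prod.collapse 0 mult_zero_right of_real_0)
  then show ?thesis
    using c by (subst (asm) ennreal_mult_cancel_left) auto
qed

section \<open>Smooth bump functions\<close>

text \<open>In \<open>iter_pd\<close> the head of the list is the outermost derivative, while
  product and chain rules rewrite the innermost one. Recursion on \<open>dd b g\<close> peels off
  the innermost derivative, so closure properties follow by induction with the function
  generalised.\<close>

fun Cn :: "nat \<Rightarrow> ('a::euclidean_space \<Rightarrow> real) \<Rightarrow> bool" where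
  "Cn 0 g \<longleftrightarrow> (\<forall>x. g differentiable at x)"
| "Cn (Suc n) g \<longleftrightarrow> (\<forall>x. g differentiable at x) \<and> (\<forall>b\<in>Basis. Cn n (dd b g))"

lemma Cn_differentiable: "Cn n g \<Longrightarrow> g differentiable at x"
  by (cases n) auto

lemma Cn_Suc: "Cn (Suc n) g \<Longrightarrow> Cn n g"
proof (induction n arbitrary: g)
  case (Suc n)
  then show ?case by (simp only: Cn.simps(2)) blast
qed simp

lemma Cn_iter_pd: "Cn n g \<Longrightarrow> set vs \<subseteq> Basis \<Longrightarrow> length vs = n \<Longrightarrow> iter_pd vs g differentiable at x"
proof (induction vs arbitrary: n g rule: rev_induct)
  case (snoc b vs)
  then obtain m where m: "n = Suc m" by (cases n) auto
  then have "Cn m (dd b g)" using snoc.prems by simp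
  then have "iter_pd vs (dd b g) differentiable at x"
    using snoc.prems m by (intro snoc.IH[of m]) auto
  then show ?case by (simp add: iter_pd_append)
qed simp

lemma C_inf_iff_Cn: "C_inf g \<longleftrightarrow> (\<forall>n. Cn n g)"
proof
  assume "C_inf g"
  have "Cn n g" if "C_inf g" for n
    using that by (induction n arbitrary: g) (auto simp: C_inf_differentiable C_inf_dd)
  then show "\<forall>n. Cn n g" using \<open>C_inf g\<close> by blast
next
  assume "\<forall>n. Cn n g"
  then show "C_inf g"
    unfolding C_inf_def using Cn_iter_pd by blast
qed

lemma Cn_add: "Cn n f \<Longrightarrow> Cn n g \<Longrightarrow> Cn n (\<lambda>x. f x + g x)"
proof (induction n arbitrary: f g)
  case (Suc n)
  have "dd b (\<lambda>x. f x + g x) = (\<lambda>x. dd b f x + dd b g x)" for b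
    by (rule ext, rule dd_eq) (intro has_derivative_add has_derivative_dd Cn_differentiable[OF Suc.prems(1)] Cn_differentiable[OF Suc.prems(2)])
  then show ?case
    using Suc by auto
qed auto

lemma Cn_mult: "Cn n f \<Longrightarrow> Cn n g \<Longrightarrow> Cn n (\<lambda>x. f x * g x)"
proof (induction n arbitrary: f g)
  case (Suc n)
  have "dd b (\<lambda>x. f x * g x) = (\<lambda>x. f x * dd b g x + dd b f x * g x)" for b
    by (rule ext, rule dd_eq) (intro has_derivative_mult has_derivative_dd Cn_differentiable[OF Suc.prems(1)] Cn_differentiable[OF Suc.prems(2)])
  moreover have "Cn n (\<lambda>x. f x * dd b g x + dd b f x * g x)" if "b \<in> Basis" for b
    using Suc.prems that by (intro Cn_add Suc.IH) (auto intro: Cn_Suc)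
  ultimately show ?case
    using Suc.prems by auto
qed auto

lemma C_inf_mult: "C_inf f \<Longrightarrow> C_inf g \<Longrightarrow> C_inf (\<lambda>x. f x * g x)"
  by (simp add: C_inf_iff_Cn Cn_mult)

lemma C_inf_const: "C_inf (\<lambda>x. c)"
proof -
  have "Cn n (\<lambda>x::'a. c)" for n and c :: real
  proof (induction n arbitrary: c)
    case (Suc n)
    have "dd b (\<lambda>x::'a. c) = (\<lambda>x. 0)" for b
      by (rule ext, rule dd_eq) (rule has_derivative_const)
    then show ?case using Suc by simp
  qed simp
  then show ?thesis by (simp add: C_inf_iff_Cn)
qed

lemma C_inf_prod: "finite A \<Longrightarrow> (\<And>a. a \<in> A \<Longrightarrow> C_inf (g a)) \<Longrightarrow> C_inf (\<lambda>x. \<Prod>a\<in>A. g a x)"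
  by (induction A rule: finite_induct) (auto intro: C_inf_const C_inf_mult)

lemma C_inf_affine:
  assumes "bounded_linear L"
  shows "C_inf (\<lambda>x. L x + c)"
proof -
  have d: "((\<lambda>x. L x + c) has_derivative L) (at x)" for x
    by (intro has_derivative_add_const bounded_linear_imp_has_derivative assms)
  then have "dd b (\<lambda>x. L x + c) = (\<lambda>x. L b)" for b
    by (intro ext dd_eq)
  then have "Cn n (\<lambda>x. L x + c)" for n
    using d C_inf_const[of "L _"] by (cases n) (auto simp: C_inf_iff_Cn intro: differentiableI)
  then show ?thesis by (simp add: C_inf_iff_Cn)
qed

text \<open>The functions \<open>s \<mapsto> p(1/s) exp(-1/s)\<close>, extended by zero to \<open>s \<le> 0\<close>, form a family closed under
  differentiation that contains the standard flat function (\<open>p = 1\<close>).\<close>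

definition flat :: "real poly \<Rightarrow> real \<Rightarrow> real" where
  "flat p s = (if 0 < s then poly p (1 / s) * exp (- (1 / s)) else 0)"

lemma poly_exp_tendsto_0: "((\<lambda>y. poly p y * exp (- y)) \<longlongrightarrow> (0::real)) at_top"
proof -
  have "((\<lambda>y. \<Sum>i\<le>degree p. coeff p i * (y ^ i / exp y)) \<longlongrightarrow> (\<Sum>i\<le>degree p. coeff p i * 0)) at_top"
    by (intro tendsto_sum tendsto_mult tendsto_const tendsto_power_div_exp_0)
  then show ?thesis
    by (simp add: poly_altdef sum_distrib_right exp_minus divide_inverse mult.assoc)
qed

lemma flat_tendsto_0: "(flat p \<longlongrightarrow> 0) (at 0)"
proof -
  have "((\<lambda>s. poly p (inverse s) * exp (- inverse s)) \<longlongrightarrow> 0) (at_right 0)"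
    by (rule filterlim_compose[OF poly_exp_tendsto_0 filterlim_inverse_at_top_right])
  then have "(flat p \<longlongrightarrow> 0) (at_right 0)"
    by (rule Lim_transform_eventually) (auto simp: flat_def eventually_at_filter inverse_eq_divide)
  moreover have "(flat p \<longlongrightarrow> 0) (at_left 0)"
    by (rule Lim_transform_eventually[OF tendsto_const]) (auto simp: flat_def eventually_at_filter)
  ultimately show ?thesis
    by (simp add: filterlim_split_at)
qed

text \<open>With X = 1/s, differentiation in s is -X^2 times differentiation in X, so p(X) exp(-X)
  becomes X^2 (p - p')(X) exp(-X).\<close>

lemma flat_DERIV: "(flat p has_real_derivative flat (monom 1 2 * (p - pderiv p)) s) (at s)"
proof -
  consider "s < 0" | "s = 0" | "0 < s" by linarith
  then show ?thesis
  proof cases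
    case 1
    have "(flat p has_real_derivative 0) (at s)"
      by (rule has_field_derivative_transform_within_open[OF DERIV_const[of 0], where S = "{..<0}"])
         (use 1 in \<open>auto simp: flat_def\<close>)
    then show ?thesis using 1 by (simp add: flat_def)
  next
    case 2
    \<comment> \<open>At s = 0 the difference quotient divides by the step, that is, it replaces p
      by X p and is again a member of the family.\<close>
    have "(flat (pCons 0 p) \<longlongrightarrow> 0) (at 0)"
      by (rule flat_tendsto_0)
    moreover have "flat (pCons 0 p) = (\<lambda>h. (flat p (0 + h) - flat p 0) / h)"
      by (rule ext) (simp add: flat_def)
    ultimately have "((\<lambda>h. (flat p (0 + h) - flat p 0) / h) \<longlongrightarrow> 0) (at 0)"
      by (simp only:)
    then show ?thesis unfolding DERIV_def using 2 by (simp add: flat_def)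
  next
    case 3
    have "((\<lambda>s. poly p (1 / s) * exp (- (1 / s))) has_real_derivative
        (poly (pderiv p) (1 / s) * (- 1 / (s * s))) * exp (- (1 / s)) + poly p (1 / s) * (exp (- (1 / s)) * (1 / (s * s)))) (at s)"
      using 3 by (auto intro!: derivative_eq_intros DERIV_chain2[OF poly_DERIV])
    moreover have "(poly (pderiv p) (1 / s) * (- 1 / (s * s))) * exp (- (1 / s)) + poly p (1 / s) * (exp (- (1 / s)) * (1 / (s * s)))
       = flat (monom 1 2 * (p - pderiv p)) s"
      using 3 by (simp add: flat_def poly_monom power2_eq_square field_simps)
    ultimately have "((\<lambda>s. poly p (1 / s) * exp (- (1 / s))) has_real_derivative flat (monom 1 2 * (p - pderiv p)) s) (at s)"
      by simp
    then show ?thesis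
      by (rule has_field_derivative_transform_within_open[where S = "{0<..}"]) (use 3 in \<open>auto simp: flat_def\<close>)
  qed
qed

lemma C_inf_flat:
  assumes g: "C_inf g"
  shows "C_inf (\<lambda>x. flat p (g x))"
proof -
  have d: "((\<lambda>x. flat p (g x)) has_derivative (\<lambda>v. flat (monom 1 2 * (p - pderiv p)) (g x) * dd v g x)) (at x)" for x p
    using has_derivative_compose[OF C_inf_has_derivative[OF g] flat_DERIV[unfolded has_field_derivative_def]] .
  have df: "(\<lambda>x. flat p (g x)) differentiable at x" for x p
    using d by (rule differentiableI)
  have "Cn n (\<lambda>x. flat p (g x))" for n
  proof (induction n arbitrary: p)
    case 0
    then show ?case using df by simp
  next
    case (Suc n)
    have "dd b (\<lambda>x. flat p (g x)) = (\<lambda>x. flat (monom 1 2 * (p - pderiv p)) (g x) * dd b g x)" for b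
      by (intro ext dd_eq d)
    moreover have "Cn n (dd b g)" if "b \<in> Basis" for b
      using C_inf_dd[OF g that] by (simp add: C_inf_iff_Cn)
    ultimately show ?case
      using df Suc by (simp add: Cn_mult)
  qed
  then show ?thesis by (simp add: C_inf_iff_Cn)
qed

text \<open>A smooth function supported on the box from l to u. The parameter k is the steepness:
  for growing k the functions converge pointwise to the indicator of the open box while staying
  below it.\<close>

definition bump :: "real \<Rightarrow> 'a::euclidean_space \<Rightarrow> 'a \<Rightarrow> 'a \<Rightarrow> real" where
  "bump k l u z = (\<Prod>b\<in>Basis. flat 1 (k * (z \<bullet> b - l \<bullet> b)) * flat 1 (k * (u \<bullet> b - z \<bullet> b)))"

lemma flat_1_nonneg: "0 \<le> flat 1 s" and flat_1_le: "flat 1 s \<le> 1" and flat_1_nonpos: "s \<le> 0 \<Longrightarrow> flat 1 s = 0"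
  by (auto simp: flat_def)

lemma flat_1_tendsto: "0 < s \<Longrightarrow> (\<lambda>k. flat 1 (real (Suc k) * s)) \<longlonglongrightarrow> 1"
proof -
  assume s: "0 < s"
  have "(\<lambda>k. exp (- (1 / real (Suc k) * (1 / s)))) \<longlonglongrightarrow> exp (- (0 * (1 / s)))"
    by (intro tendsto_intros inverse_Suc_tendsto_0)
  then show ?thesis
    using s by (simp add: flat_def zero_less_mult_iff del: of_nat_Suc)
qed

lemma C_inf_bump:
  fixes L :: "'a::euclidean_space \<Rightarrow> 'b::euclidean_space"
  assumes L: "bounded_linear L"
  shows "C_inf (\<lambda>z. bump k l u (L z))"
proof -
  have "C_inf (\<lambda>z. k * (L z \<bullet> b) + (- k * (l \<bullet> b)))" "C_inf (\<lambda>z. (- k) * (L z \<bullet> b) + k * (u \<bullet> b))" for b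
    by (intro C_inf_affine bounded_linear_const_mult bounded_linear_inner_left_comp L)+
  then have "C_inf (\<lambda>z. k * (L z \<bullet> b - l \<bullet> b))" "C_inf (\<lambda>z. k * (u \<bullet> b - L z \<bullet> b))" for b
    by (simp_all add: algebra_simps)
  then have "C_inf (\<lambda>z. flat 1 (k * (L z \<bullet> b - l \<bullet> b)) * flat 1 (k * (u \<bullet> b - L z \<bullet> b)))" for b
    by (rule C_inf_mult[OF C_inf_flat C_inf_flat])
  then show ?thesis
    unfolding bump_def by (intro C_inf_prod finite_Basis)
qed

lemma bump_outside: "z \<notin> box l u \<Longrightarrow> bump k l u z = 0" if "0 < k"
proof -
  assume "z \<notin> box l u"
  then obtain b where b: "b \<in> Basis" "z \<bullet> b \<le> l \<bullet> b \<or> u \<bullet> b \<le> z \<bullet> b"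
    by (auto simp: mem_box not_less)
  then have "flat 1 (k * (z \<bullet> b - l \<bullet> b)) * flat 1 (k * (u \<bullet> b - z \<bullet> b)) = 0"
    using that by (auto simp: flat_1_nonpos mult_nonneg_nonpos)
  then show ?thesis
    unfolding bump_def using b(1) by (intro prod_zero) auto
qed

lemma bump_bounds: "0 \<le> bump k l u z" "bump k l u z \<le> 1"
proof -
  have "0 \<le> flat 1 x * flat 1 y \<and> flat 1 x * flat 1 y \<le> 1" for x y
    by (simp add: flat_1_nonneg flat_1_le mult_le_one)
  then show "0 \<le> bump k l u z" "bump k l u z \<le> 1"
    unfolding bump_def by (auto intro!: prod_nonneg prod_le_1)
qed

lemma bump_tendsto: "(\<lambda>k. bump (real (Suc k)) l u z) \<longlonglongrightarrow> indicator (box l u) z"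
proof (cases "z \<in> box l u")
  case True
  then have "(\<lambda>k. bump (real (Suc k)) l u z) \<longlonglongrightarrow> (\<Prod>b\<in>(Basis::'a set). 1 * 1)"
    unfolding bump_def by (intro tendsto_prod tendsto_mult flat_1_tendsto) (auto simp: mem_box)
  then show ?thesis using True by simp
next
  case False
  then show ?thesis by (simp add: bump_outside del: of_nat_Suc)
qed

lemma iter_pd_zero_open:
  assumes U: "open U" and g: "\<And>x. x \<in> U \<Longrightarrow> g x = 0" and x: "x \<in> U"
  shows "iter_pd vs g x = 0"
  using x
proof (induction vs arbitrary: x)
  case (Cons v vs)
  have "(iter_pd vs g has_derivative (\<lambda>v. 0)) (at x)"
    by (rule has_derivative_transform_within_open[OF has_derivative_const[of 0] U Cons.prems]) (simp add: Cons.IH)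
  then show ?case by (simp add: dd_eq)
qed (simp add: g)

definition refl_last :: "'a::real_vector \<times> real \<Rightarrow> 'a \<times> real" where
  "refl_last z = (fst z, - snd z)"

lemma bounded_linear_refl_last: "bounded_linear (refl_last :: 'a::euclidean_space \<times> real \<Rightarrow> _)"
  unfolding refl_last_def[abs_def]
  by (intro bounded_linear_Pair bounded_linear_minus bounded_linear_fst bounded_linear_snd)

text \<open>With \<open>0 < snd l\<close> the box and its mirror image stay away from x_n = 0, so
  the function is 0 near that hyperplane and all its derivatives vanish there. Adding the reflected
  bump makes it even.\<close>

lemma even_bump_Ctilde0e:
  fixes l u :: "(real^'m) \<times> real"
  assumes k: "0 < k" and l: "0 < snd l"
  shows "(\<lambda>z. bump k l u z + bump k l u (refl_last z)) \<in> Ctilde0e"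
proof -
  let ?f = "\<lambda>z. bump k l u z + bump k l u (refl_last z)"
  have i: "bounded_linear (\<lambda>z :: (real^'m) \<times> real. z)" by (rule bounded_linear_ident)
  have C: "C_inf ?f"
    using C_inf_lincomb[OF C_inf_bump[OF i, of k l u] C_inf_bump[OF bounded_linear_refl_last, of k l u], of 1 1] by simp
  have out: "bump k l u z = 0" if "snd z \<le> snd l" for z
  proof (rule bump_outside[OF k])
    have "(0, 1) \<in> (Basis :: ((real^'m) \<times> real) set)" by (simp add: Basis_prod_def)
    then have "z \<in> box l u \<Longrightarrow> l \<bullet> (0, 1) < z \<bullet> (0, 1)"
      unfolding mem_box by blast
    then show "z \<notin> box l u"
      using that by (auto simp: inner_prod_def)
  qed
  have z0: "iter_pd vs ?f (x', 0) = 0" for vs x'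
  proof (rule iter_pd_zero_open[where U = "{z. \<bar>snd z\<bar> < snd l}"])
    show "open {z :: (real^'m) \<times> real. \<bar>snd z\<bar> < snd l}"
      by (intro open_Collect_less continuous_intros)
  qed (use l in \<open>auto simp: out refl_last_def\<close>)
  have sub: "{z. ?f z \<noteq> 0} \<subseteq> box l u \<union> refl_last -` box l u"
  proof
    fix z assume z: "z \<in> {z. ?f z \<noteq> 0}"
    show "z \<in> box l u \<union> refl_last -` box l u"
    proof (rule ccontr)
      assume "z \<notin> box l u \<union> refl_last -` box l u"
      then have "bump k l u z = 0" "bump k l u (refl_last z) = 0"
        by (auto intro!: bump_outside[OF k])
      with z show False by simp
    qed
  qed
  have "refl_last -` box l u = refl_last ` box l u"
    by (auto simp: refl_last_def image_iff) (metis fst_conv minus_minus snd_conv)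
  then have "bounded {z. ?f z \<noteq> 0}"
    using bounded_subset[OF _ sub] bounded_linear_image[OF bounded_box[of l u] bounded_linear_refl_last]
    by (simp add: bounded_Un)
  then have "compact (closure {z. ?f z \<noteq> 0})"
    by (simp add: compact_closure)
  then show ?thesis
    unfolding Ctilde0e_def using C z0 by (auto simp: refl_last_def)
qed

section \<open>Density in the weighted space\<close>

lemma weight_measurable [measurable (raw)]:
  fixes g :: "(real^'m) \<times> real \<Rightarrow> real"
  assumes "g \<in> borel_measurable borel"
  shows "(\<lambda>x. ennreal ((g x)\<^sup>2 / \<bar>snd x\<bar>)) \<in> borel_measurable borel"
proof -
  have "(\<lambda>x. (g x)\<^sup>2 / \<bar>snd x\<bar>) \<in> borel_measurable borel"
    by (intro borel_measurable_divide borel_measurable_power assms borel_measurable_continuous_onI continuous_intros)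
  then show ?thesis by simp
qed

lemma weight_measurable_lborel:
  fixes g :: "(real^'m) \<times> real \<Rightarrow> real"
  assumes "g \<in> borel_measurable borel"
  shows "(\<lambda>x. ennreal ((g x)\<^sup>2 / \<bar>snd x\<bar>)) \<in> borel_measurable lborel"
  using weight_measurable[OF assms] by simp

lemma wnorm2_cmult:
  assumes "g \<in> borel_measurable borel"
  shows "wnorm2 (\<lambda>x. a * g x) = ennreal (a\<^sup>2) * wnorm2 g"
proof -
  have "ennreal ((a * g x)\<^sup>2 / \<bar>snd x\<bar>) = ennreal (a\<^sup>2) * ennreal ((g x)\<^sup>2 / \<bar>snd x\<bar>)" for x
    by (subst ennreal_mult[symmetric]) (auto simp: power_mult_distrib)
  then show ?thesis
    unfolding wnorm2_def by (simp only:) (rule nn_integral_cmult[OF weight_measurable_lborel[OF assms]])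
qed

lemma wnorm2_cong_AE:
  assumes "AE x in lborel. g x = h x"
  shows "wnorm2 g = wnorm2 h"
  unfolding wnorm2_def by (rule nn_integral_cong_AE) (use assms in \<open>eventually_elim, simp\<close>)

lemma ennreal_lincomb:
  assumes "0 \<le> a" "0 \<le> b" "0 \<le> x" "0 \<le> y"
  shows "ennreal (a * x + b * y) = ennreal a * ennreal x + ennreal b * ennreal y"
  using assms by (simp add: ennreal_plus ennreal_mult)

text \<open>Young's inequality 2 a b \<le> \<delta> a^2 + b^2/\<delta> gives a triangle estimate
  directly for squared, possibly infinite norms. The free \<delta> brings the factor of
  \<open>wnorm2 g\<close> arbitrarily close to 1.\<close>

lemma wnorm2_triangle:
  assumes g: "g \<in> borel_measurable borel" and h: "h \<in> borel_measurable borel" and d: "0 < \<delta>"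
  shows "wnorm2 (\<lambda>x. g x + h x) \<le> ennreal (1 + \<delta>) * wnorm2 g + ennreal (1 + 1 / \<delta>) * wnorm2 h"
proof -
  have "(a + b)\<^sup>2 \<le> (1 + \<delta>) * a\<^sup>2 + (1 + 1 / \<delta>) * b\<^sup>2" for a b
  proof -
    have "0 \<le> (\<delta> * a - b)\<^sup>2 / \<delta>" using d by simp
    also have "\<dots> = \<delta> * a\<^sup>2 - 2 * a * b + b\<^sup>2 / \<delta>"
      using d by (simp add: power2_eq_square field_simps)
    finally show ?thesis by (simp add: power2_sum algebra_simps)
  qed
  then have "(g x + h x)\<^sup>2 / \<bar>snd x\<bar> \<le> ((1 + \<delta>) * (g x)\<^sup>2 + (1 + 1 / \<delta>) * (h x)\<^sup>2) / \<bar>snd x\<bar>" for x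
    by (intro divide_right_mono) auto
  then have "ennreal ((g x + h x)\<^sup>2 / \<bar>snd x\<bar>) \<le> ennreal ((1 + \<delta>) * ((g x)\<^sup>2 / \<bar>snd x\<bar>) + (1 + 1 / \<delta>) * ((h x)\<^sup>2 / \<bar>snd x\<bar>))" for x
    by (intro ennreal_leI) (simp add: add_divide_distrib)
  also have "\<dots> x = ennreal (1 + \<delta>) * ennreal ((g x)\<^sup>2 / \<bar>snd x\<bar>) + ennreal (1 + 1 / \<delta>) * ennreal ((h x)\<^sup>2 / \<bar>snd x\<bar>)" for x
    by (rule ennreal_lincomb) (use d in auto)
  finally have "wnorm2 (\<lambda>x. g x + h x) \<le> (\<integral>\<^sup>+x. ennreal (1 + \<delta>) * ennreal ((g x)\<^sup>2 / \<bar>snd x\<bar>) + ennreal (1 + 1 / \<delta>) * ennreal ((h x)\<^sup>2 / \<bar>snd x\<bar>) \<partial>lborel)"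
    unfolding wnorm2_def by (rule nn_integral_mono)
  also have "\<dots> = ennreal (1 + \<delta>) * wnorm2 g + ennreal (1 + 1 / \<delta>) * wnorm2 h"
    unfolding wnorm2_def using weight_measurable_lborel[OF g] weight_measurable_lborel[OF h]
    by (subst nn_integral_add) (auto simp: nn_integral_cmult)
  finally show ?thesis .
qed

lemma wnorm2_triangle_diff:
  assumes "g \<in> borel_measurable borel" "f \<in> borel_measurable borel" "h \<in> borel_measurable borel"
  shows "wnorm2 (\<lambda>x. g x - h x) \<le> 2 * wnorm2 (\<lambda>x. g x - f x) + 2 * wnorm2 (\<lambda>x. f x - h x)"
  using wnorm2_triangle[of "\<lambda>x. g x - f x" "\<lambda>x. f x - h x" 1] assms by simp

lemma wnorm2_minus_commute: "wnorm2 (\<lambda>x. g x - h x) = wnorm2 (\<lambda>x. h x - g x)"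
  unfolding wnorm2_def by (simp add: power2_commute)

text \<open>By the convention for division the weight is 0 on x_n = 0, so \<open>wnorm2\<close>
  carries no information there; statements that hold almost everywhere may ignore this null
  set.\<close>

lemma AE_snd_nonzero: "AE x in (lborel :: ('a::euclidean_space \<times> real) measure). snd x \<noteq> 0"
proof -
  have "(0, 1) \<in> (Basis :: ('a \<times> real) set)" by (simp add: Basis_prod_def)
  from AE_lborel_inner_neq[OF this, of 0] show ?thesis
    by (simp add: inner_prod_def)
qed

lemma wnorm2_eq_0:
  assumes g: "g \<in> borel_measurable borel" and 0: "wnorm2 g = 0"
  shows "AE x in lborel. g x = 0"
proof -
  have "AE x in lborel. ennreal ((g x)\<^sup>2 / \<bar>snd x\<bar>) = 0"
    using 0 weight_measurable_lborel[OF g] unfolding wnorm2_def by (subst (asm) nn_integral_0_iff_AE) auto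
  then show ?thesis
    using AE_snd_nonzero
  proof eventually_elim
    case (elim x)
    have "(g x)\<^sup>2 / \<bar>snd x\<bar> \<le> 0"
      using elim(1) by (simp only: ennreal_eq_0_iff)
    then show ?case
      using elim(2) by (simp add: divide_le_0_iff)
  qed
qed

lemma wnorm2_dominated:
  assumes g: "g \<in> borel_measurable borel" and h: "\<And>n. h n \<in> borel_measurable borel" and w: "w \<in> borel_measurable borel"
    and b: "\<And>n x. \<bar>g x - h n x\<bar> \<le> w x" and fin: "wnorm2 w < \<infinity>"
    and l: "AE x in lborel. (\<lambda>n. h n x) \<longlonglongrightarrow> g x"
  shows "(\<lambda>n. wnorm2 (\<lambda>x. g x - h n x)) \<longlonglongrightarrow> 0"
proof -
  have "(\<lambda>n. \<integral>\<^sup>+x. ennreal ((g x - h n x)\<^sup>2 / \<bar>snd x\<bar>) \<partial>lborel) \<longlonglongrightarrow> (\<integral>\<^sup>+(x :: (real^'a) \<times> real). 0 \<partial>lborel)"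
  proof (rule nn_integral_dominated_convergence[where w = "\<lambda>x. ennreal ((w x)\<^sup>2 / \<bar>snd x\<bar>)"])
    show "(\<lambda>x. ennreal ((g x - h n x)\<^sup>2 / \<bar>snd x\<bar>)) \<in> borel_measurable lborel" for n
      by (intro weight_measurable_lborel borel_measurable_diff g h)
    show "(\<lambda>x. ennreal ((w x)\<^sup>2 / \<bar>snd x\<bar>)) \<in> borel_measurable lborel"
      by (intro weight_measurable_lborel w)
    show "(\<integral>\<^sup>+x. ennreal ((w x)\<^sup>2 / \<bar>snd x\<bar>) \<partial>lborel) < \<infinity>"
      using fin by (simp add: wnorm2_def)
    have "(g x - h n x)\<^sup>2 \<le> (w x)\<^sup>2" for n x
      using power_mono[OF b abs_ge_zero, of x n 2] by simp
    then show "AE x in lborel. ennreal ((g x - h n x)\<^sup>2 / \<bar>snd x\<bar>) \<le> ennreal ((w x)\<^sup>2 / \<bar>snd x\<bar>)" for n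
      by (intro AE_I2 ennreal_leI divide_right_mono) auto
    show "AE x in lborel. (\<lambda>n. ennreal ((g x - h n x)\<^sup>2 / \<bar>snd x\<bar>)) \<longlonglongrightarrow> 0"
      using l AE_snd_nonzero
    proof eventually_elim
      case (elim x)
      have "(\<lambda>n. ennreal ((g x - h n x)\<^sup>2 / \<bar>snd x\<bar>)) \<longlonglongrightarrow> ennreal ((g x - g x)\<^sup>2 / \<bar>snd x\<bar>)"
        using elim by (intro tendsto_ennrealI tendsto_intros) auto
      then show ?case by simp
    qed
  qed simp
  then show ?thesis by (simp add: wnorm2_def)
qed

lemma L2ewD:
  assumes "g \<in> L2ew"
  shows "g \<in> borel_measurable borel" "g (x', - s) = g (x', s)" "wnorm2 g < \<infinity>"
  using assms by (auto simp: L2ew_def)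

lemma L2ew_lincomb:
  assumes g: "g \<in> L2ew" and h: "h \<in> L2ew"
  shows "(\<lambda>x. a * g x + b * h x) \<in> L2ew"
proof -
  note [measurable] = L2ewD(1)[OF g] L2ewD(1)[OF h]
  have "wnorm2 (\<lambda>x. a * g x + b * h x) \<le> ennreal (1 + 1) * wnorm2 (\<lambda>x. a * g x) + ennreal (1 + 1 / 1) * wnorm2 (\<lambda>x. b * h x)"
    by (rule wnorm2_triangle) auto
  also have "\<dots> < \<infinity>"
    using L2ewD(3)[OF g] L2ewD(3)[OF h] by (simp add: wnorm2_cmult ennreal_mult_less_top ennreal_mult_eq_top_iff less_top)
  finally show ?thesis
    using g h by (simp add: L2ew_def)
qed

lemma L2ew_diff: "g \<in> L2ew \<Longrightarrow> h \<in> L2ew \<Longrightarrow> (\<lambda>x. g x - h x) \<in> L2ew"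
  using L2ew_lincomb[of g h 1 "- 1"] by simp

lemma Ctilde0e_test_fun:
  assumes "f \<in> Ctilde0e"
  shows "test_fun f" "f (x', - s) = f (x', s)" "f (x', 0) = 0"
proof -
  have f: "C_inf f" "compact (closure {x. f x \<noteq> 0})" "\<And>vs. set vs \<subseteq> Basis \<Longrightarrow> iter_pd vs f (x', 0) = 0"
    using assms by (auto simp: Ctilde0e_def)
  then have "bounded {x. f x \<noteq> 0}"
    by (meson bounded_subset closure_subset compact_imp_bounded)
  then obtain R where "\<And>x. f x \<noteq> 0 \<Longrightarrow> norm x \<le> R"
    by (auto simp: bounded_iff)
  then have "\<forall>x. R < norm x \<longrightarrow> f x = 0" by (meson not_less)
  then show "test_fun f" using f by (auto simp: test_fun_def)
  show "f (x', 0) = 0" using f(3)[of "[]"] by simp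
  show "f (x', - s) = f (x', s)" using assms by (auto simp: Ctilde0e_def)
qed

lemma Ctilde0e_lincomb:
  assumes f: "f \<in> Ctilde0e" and g: "g \<in> Ctilde0e"
  shows "(\<lambda>x. a * f x + b * g x) \<in> Ctilde0e"
proof -
  have C: "C_inf f" "C_inf g" and c: "compact (closure {x. f x \<noteq> 0})" "compact (closure {x. g x \<noteq> 0})"
    using f g by (auto simp: Ctilde0e_def)
  have "bounded ({x. f x \<noteq> 0} \<union> {x. g x \<noteq> 0})"
    using c by (simp add: compact_closure)
  then have "bounded {x. a * f x + b * g x \<noteq> 0}"
    by (rule bounded_subset) auto
  then show ?thesis
    using f g C_inf_lincomb[OF C] by (auto simp: Ctilde0e_def iter_pd_lincomb[OF C] compact_closure)
qed

lemma wnorm2_indicator_bounded: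
  fixes g :: "(real^'m) \<times> real \<Rightarrow> real"
  assumes g: "\<And>z. \<bar>g z\<bar> \<le> c * indicator (cball 0 R) z" and v: "\<And>z. (g z)\<^sup>2 / \<bar>snd z\<bar> \<le> M"
  shows "wnorm2 g < \<infinity>"
proof -
  have p: "ennreal ((g z)\<^sup>2 / \<bar>snd z\<bar>) \<le> ennreal M * indicator (cball 0 R) z" for z
    using g[of z] v[of z] by (cases "z \<in> cball 0 R") (auto intro: ennreal_leI)
  have "wnorm2 g \<le> (\<integral>\<^sup>+z. ennreal M * indicator (cball (0 :: (real^'m) \<times> real) R) z \<partial>lborel)"
    unfolding wnorm2_def by (intro nn_integral_mono p)
  also have "\<dots> = ennreal M * emeasure lborel (cball 0 R :: ((real^'m) \<times> real) set)"
    by (rule nn_integral_cmult_indicator) simp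
  also have "\<dots> < \<infinity>"
    using emeasure_bounded_finite[OF bounded_cball[of "0 :: (real^'m) \<times> real" R]] by (simp add: ennreal_mult_less_top)
  finally show ?thesis .
qed

text \<open>Vanishing on the hyperplane and a bounded derivative in x_n give |f| \<le> M |x_n|.
  Hence f^2/|x_n| is at most \<open>M0 * M\<close>, on a bounded support.\<close>

lemma Ctilde0e_L2ew:
  assumes f: "f \<in> Ctilde0e"
  shows "f \<in> L2ew"
proof -
  have t: "test_fun f" by (rule Ctilde0e_test_fun[OF f])
  then have C: "C_inf f" by (simp add: test_fun_def)
  obtain R where R: "\<And>x. R < norm x \<Longrightarrow> f x = 0"
    using t by (auto simp: test_fun_def)
  have B: "(0, 1) \<in> (Basis :: ((real^'a) \<times> real) set)" by (simp add: Basis_prod_def)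
  obtain M0 where M0: "0 \<le> M0" "\<And>x. norm (f x) \<le> M0"
    using continuous_bounded_support[OF C_inf_continuous[OF C] R] by blast
  have R': "R < norm x \<Longrightarrow> dd (0, 1) f x = 0" for x
    by (rule dd_outside_support[OF R])
  obtain M where M: "0 \<le> M" "\<And>x. norm (dd (0, 1) f x) \<le> M"
    by (rule continuous_bounded_support[of "dd (0, 1) f" R, OF C_inf_continuous[OF C_inf_dd[OF C B]] R']) (assumption, rule that)
  have lip: "\<bar>f (x', s)\<bar> \<le> M * \<bar>s\<bar>" for x' s
  proof -
    have "norm (f ((x', 0) + s *\<^sub>R (0, 1)) - f ((x', 0) + 0 *\<^sub>R (0, 1))) \<le> M * norm (s - 0)"
      by (rule field_differentiable_bound[where S = UNIV and f' = "\<lambda>s. dd (0, 1) f ((x', 0) + s *\<^sub>R (0, 1))"])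
         (rule C_inf_line_DERIV[OF C] M convex_UNIV UNIV_I)+
    then show ?thesis
      using Ctilde0e_test_fun(3)[OF f] by simp
  qed
  have "wnorm2 f < \<infinity>"
  proof (rule wnorm2_indicator_bounded)
    show "\<bar>f z\<bar> \<le> M0 * indicator (cball 0 R) z" for z
      using M0(2)[of z] R[of z] by (cases "z \<in> cball 0 R") auto
    show "(f z)\<^sup>2 / \<bar>snd z\<bar> \<le> M0 * M" for z
    proof (cases "snd z = 0")
      case False
      have "\<bar>f z\<bar> * \<bar>f z\<bar> \<le> M0 * (M * \<bar>snd z\<bar>)"
        using M0 lip[of "fst z" "snd z"] by (intro mult_mono) auto
      then show ?thesis
        using False by (simp add: power2_eq_square divide_le_eq mult.assoc abs_mult[symmetric])
    qed (use M M0 in auto)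
  qed
  then show ?thesis
    using Ctilde0e_test_fun(2)[OF f] borel_measurable_continuous_onI[OF C_inf_continuous[OF C]]
    by (simp add: L2ew_def)
qed

section \<open>Functions approximable by test functions in the weighted norm\<close>

definition approximable :: "((real^'m) \<times> real \<Rightarrow> real) \<Rightarrow> bool" where
  "approximable g \<longleftrightarrow> g \<in> L2ew \<and> (\<forall>\<epsilon>>0. \<exists>f\<in>Ctilde0e. wnorm2 (\<lambda>x. g x - f x) \<le> ennreal \<epsilon>)"

lemma approximable_closed:
  assumes g: "g \<in> L2ew" and h: "\<And>n. approximable (h n)" and l: "(\<lambda>n. wnorm2 (\<lambda>x. g x - h n x)) \<longlonglongrightarrow> 0"
  shows "approximable g"
  unfolding approximable_def
proof (intro conjI allI impI g)
  fix \<epsilon> :: real assume e: "0 < \<epsilon>"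
  \<comment> \<open>A quarter of \<epsilon> for each of two terms, because
    \<open>wnorm2_triangle_diff\<close> doubles both.\<close>
  then have "\<forall>\<^sub>F n in sequentially. wnorm2 (\<lambda>x. g x - h n x) < ennreal (\<epsilon> / 4)"
    by (intro order_tendstoD(2)[OF l]) simp
  then obtain n where n: "wnorm2 (\<lambda>x. g x - h n x) \<le> ennreal (\<epsilon> / 4)"
    by (auto simp: eventually_sequentially intro: less_imp_le)
  obtain f where f: "f \<in> Ctilde0e" "wnorm2 (\<lambda>x. h n x - f x) \<le> ennreal (\<epsilon> / 4)"
    using h[of n] e unfolding approximable_def by (metis divide_pos_pos zero_less_numeral)
  have "wnorm2 (\<lambda>x. g x - f x) \<le> 2 * wnorm2 (\<lambda>x. g x - h n x) + 2 * wnorm2 (\<lambda>x. h n x - f x)"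
    using g h[of n] Ctilde0e_L2ew[OF f(1)] by (intro wnorm2_triangle_diff) (auto simp: approximable_def L2ew_def)
  also have "\<dots> \<le> 2 * ennreal (\<epsilon> / 4) + 2 * ennreal (\<epsilon> / 4)"
    by (intro add_mono mult_left_mono n f) auto
  also have "\<dots> = ennreal 2 * ennreal (\<epsilon> / 4) + ennreal 2 * ennreal (\<epsilon> / 4)"
    by simp
  also have "\<dots> = ennreal \<epsilon>"
    using e by (simp only: ennreal_mult[symmetric] ennreal_plus[symmetric]) (simp flip: ennreal_mult ennreal_plus)
  finally show "\<exists>f\<in>Ctilde0e. wnorm2 (\<lambda>x. g x - f x) \<le> ennreal \<epsilon>"
    using f(1) by blast
qed

lemma approximable_Ctilde0e: "f \<in> Ctilde0e \<Longrightarrow> approximable f"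
  unfolding approximable_def by (auto intro!: Ctilde0e_L2ew bexI[of _ f] simp: wnorm2_def)

text \<open>The rate concerns the squared norm, so the norm error is 4^(-k). This is fast enough to
  afford the weights 2^k by which \<open>wnorm2_Cauchy_convergent\<close> gets pointwise convergence
  without passing to a subsequence.\<close>

lemma approximable_seq:
  assumes "approximable g"
  shows "\<exists>F. \<forall>k. F k \<in> Ctilde0e \<and> wnorm2 (\<lambda>x. g x - F k x) \<le> ennreal (1 / 16 ^ k)"
proof (rule choice, rule allI)
  fix k
  have "0 < 1 / (16 :: real) ^ k" by simp
  then show "\<exists>f. f \<in> Ctilde0e \<and> wnorm2 (\<lambda>x. g x - f x) \<le> ennreal (1 / 16 ^ k)"
    using assms unfolding approximable_def by blast
qed

lemma tendsto_0_geometric: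
  fixes a :: "nat \<Rightarrow> ennreal"
  assumes "\<And>k. a k \<le> ennreal (C / 16 ^ k)"
  shows "a \<longlonglongrightarrow> 0"
proof (rule tendsto_sandwich[OF _ _ tendsto_const])
  have "(\<lambda>k. C * (1 / 16) ^ k) \<longlonglongrightarrow> C * 0"
    by (intro tendsto_intros LIMSEQ_power_zero) simp
  then have "(\<lambda>k. ennreal (C / 16 ^ k)) \<longlonglongrightarrow> ennreal 0"
    by (intro tendsto_ennrealI) (simp add: power_one_over)
  then show "(\<lambda>k. ennreal (C / 16 ^ k)) \<longlonglongrightarrow> 0" by simp
qed (use assms in auto)

lemma wnorm2_tendsto_lincomb:
  assumes g: "\<And>n. g n \<in> borel_measurable borel" "(\<lambda>n. wnorm2 (g n)) \<longlonglongrightarrow> 0"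
    and h: "\<And>n. h n \<in> borel_measurable borel" "(\<lambda>n. wnorm2 (h n)) \<longlonglongrightarrow> 0"
  shows "(\<lambda>n. wnorm2 (\<lambda>x. a * g n x + b * h n x)) \<longlonglongrightarrow> 0"
proof (rule tendsto_sandwich[OF _ _ tendsto_const])
  have "wnorm2 (\<lambda>x. a * g n x + b * h n x) \<le> ennreal (1 + 1) * (ennreal (a\<^sup>2) * wnorm2 (g n)) + ennreal (1 + 1 / 1) * (ennreal (b\<^sup>2) * wnorm2 (h n))" for n
    using wnorm2_triangle[of "\<lambda>x. a * g n x" "\<lambda>x. b * h n x" 1] g(1)[of n] h(1)[of n] by (simp add: wnorm2_cmult)
  then show "\<forall>\<^sub>F n in sequentially. wnorm2 (\<lambda>x. a * g n x + b * h n x) \<le> ennreal (1 + 1) * (ennreal (a\<^sup>2) * wnorm2 (g n)) + ennreal (1 + 1 / 1) * (ennreal (b\<^sup>2) * wnorm2 (h n))"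
    by simp
  have "(\<lambda>n. ennreal (1 + 1) * (ennreal (a\<^sup>2) * wnorm2 (g n)) + ennreal (1 + 1 / 1) * (ennreal (b\<^sup>2) * wnorm2 (h n))) \<longlonglongrightarrow> ennreal (1 + 1) * (ennreal (a\<^sup>2) * 0) + ennreal (1 + 1 / 1) * (ennreal (b\<^sup>2) * 0)"
    by (intro tendsto_add ennreal_tendsto_cmult g h) auto
  then show "(\<lambda>n. ennreal (1 + 1) * (ennreal (a\<^sup>2) * wnorm2 (g n)) + ennreal (1 + 1 / 1) * (ennreal (b\<^sup>2) * wnorm2 (h n))) \<longlonglongrightarrow> 0"
    by simp
qed simp

lemma approximable_lincomb:
  assumes g: "approximable g" and h: "approximable h"
  shows "approximable (\<lambda>x. a * g x + b * h x)"
proof -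
  obtain F where F: "\<And>k. F k \<in> Ctilde0e" "\<And>k. wnorm2 (\<lambda>x. g x - F k x) \<le> ennreal (1 / 16 ^ k)"
    using approximable_seq[OF g] by blast
  obtain G where G: "\<And>k. G k \<in> Ctilde0e" "\<And>k. wnorm2 (\<lambda>x. h x - G k x) \<le> ennreal (1 / 16 ^ k)"
    using approximable_seq[OF h] by blast
  have L: "g \<in> L2ew" "h \<in> L2ew" using g h by (auto simp: approximable_def)
  show ?thesis
  proof (rule approximable_closed[where h = "\<lambda>n x. a * F n x + b * G n x"])
    have "(\<lambda>n. wnorm2 (\<lambda>x. a * (g x - F n x) + b * (h x - G n x))) \<longlonglongrightarrow> 0"
      using tendsto_0_geometric[OF F(2)] tendsto_0_geometric[OF G(2)]
        L2ewD(1)[OF L2ew_diff[OF L(1) Ctilde0e_L2ew[OF F(1)]]] L2ewD(1)[OF L2ew_diff[OF L(2) Ctilde0e_L2ew[OF G(1)]]]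
      by (intro wnorm2_tendsto_lincomb)
    then show "(\<lambda>n. wnorm2 (\<lambda>x. a * g x + b * h x - (a * F n x + b * G n x))) \<longlonglongrightarrow> 0"
      by (simp add: algebra_simps)
  qed (intro L2ew_lincomb L approximable_Ctilde0e Ctilde0e_lincomb F G)+
qed

lemma approximable_sum:
  fixes g :: "'i \<Rightarrow> (real^'m) \<times> real \<Rightarrow> real"
  assumes "finite I" "\<And>i. i \<in> I \<Longrightarrow> approximable (g i)"
  shows "approximable (\<lambda>x. \<Sum>i\<in>I. g i x)"
  using assms
proof (induction I)
  case empty
  have "(\<lambda>x. 0 :: real) \<in> (Ctilde0e :: ((real^'m) \<times> real \<Rightarrow> real) set)"
    using C_inf_const[of 0] iter_pd_zero_open[of UNIV "\<lambda>x. 0"] by (auto simp: Ctilde0e_def)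
  then show ?case by (simp add: approximable_Ctilde0e)
next
  case (insert i I)
  then show ?case
    using approximable_lincomb[of "g i" "\<lambda>x. \<Sum>i\<in>I. g i x" 1 1] by simp
qed

section \<open>From boxes to Borel sets and to arbitrary functions\<close>

definition even_indicator :: "((real^'m) \<times> real) set \<Rightarrow> (real^'m) \<times> real \<Rightarrow> real" where
  "even_indicator A z = indicator A (fst z, \<bar>snd z\<bar>)"

lemma even_indicator_measurable [measurable]:
  assumes "A \<in> sets borel"
  shows "even_indicator A \<in> borel_measurable borel"
proof -
  have "(\<lambda>z. (fst z, \<bar>snd z\<bar>)) \<in> borel_measurable (borel :: ((real^'a) \<times> real) measure)"
    by (intro borel_measurable_continuous_onI continuous_intros)
  from measurable_compose[OF this borel_measurable_indicator[OF assms]] show ?thesis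
    unfolding even_indicator_def[abs_def] by simp
qed

lemma box_snd_less: "z \<in> box l u \<Longrightarrow> snd l < snd (z :: (real^'m) \<times> real)"
proof -
  assume "z \<in> box l u"
  moreover have "(0, 1) \<in> (Basis :: ((real^'m) \<times> real) set)" by (simp add: Basis_prod_def)
  ultimately have "l \<bullet> (0, 1) < z \<bullet> (0, 1)" unfolding mem_box by blast
  then show ?thesis by (simp add: inner_prod_def)
qed

lemma even_indicator_L2ew:
  fixes A :: "((real^'m) \<times> real) set"
  assumes A: "A \<in> sets borel" "A \<subseteq> box l u" and l: "0 < snd l"
  shows "even_indicator A \<in> L2ew"
proof -
  obtain R where R: "\<And>z. z \<in> box l u \<Longrightarrow> norm z \<le> R"
    using bounded_box[of l u] by (auto simp: bounded_iff)
  have "wnorm2 (even_indicator A) < \<infinity>"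
  proof (rule wnorm2_indicator_bounded[where c = 1 and R = R and M = "1 / snd l"])
    fix z :: "(real^'m) \<times> real"
    have n: "norm (fst z, \<bar>snd z\<bar>) = norm z" by (cases z) (simp add: norm_Pair)
    show "\<bar>even_indicator A z\<bar> \<le> 1 * indicator (cball 0 R) z"
      using A(2) R[of "(fst z, \<bar>snd z\<bar>)"] by (auto simp: even_indicator_def indicator_def n)
    show "(even_indicator A z)\<^sup>2 / \<bar>snd z\<bar> \<le> 1 / snd l"
    proof (cases "(fst z, \<bar>snd z\<bar>) \<in> A")
      case True
      then have "snd l < \<bar>snd z\<bar>" using A(2) box_snd_less[of "(fst z, \<bar>snd z\<bar>)" l u] by auto
      then show ?thesis using True l by (simp add: even_indicator_def frac_le)
    qed (use l in \<open>simp add: even_indicator_def\<close>)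
  qed
  then show ?thesis
    using even_indicator_measurable[OF A(1)] by (simp add: L2ew_def even_indicator_def)
qed

text \<open>Even bumps stay below the even indicator and converge to it pointwise, so the indicator
  itself dominates the error.\<close>

lemma approximable_box:
  fixes l u :: "(real^'m) \<times> real"
  assumes l: "0 < snd l"
  shows "approximable (even_indicator (box l u))"
proof (rule approximable_closed[where h = "\<lambda>k z. bump (real (Suc k)) l u z + bump (real (Suc k)) l u (refl_last z)"])
  have L: "even_indicator (box l u) \<in> L2ew"
    by (rule even_indicator_L2ew[OF _ order_refl l]) simp
  then show "even_indicator (box l u) \<in> L2ew" .
  have c: "(\<lambda>z. bump (real (Suc k)) l u z + bump (real (Suc k)) l u (refl_last z)) \<in> Ctilde0e" for k
    by (rule even_bump_Ctilde0e) (use l in auto)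
  then show "approximable (\<lambda>z. bump (real (Suc k)) l u z + bump (real (Suc k)) l u (refl_last z))" for k
    by (rule approximable_Ctilde0e)
  have e: "even_indicator (box l u) z = indicator (box l u) z + indicator (box l u) (refl_last z)" for z
    using box_snd_less[of z l u] box_snd_less[of "refl_last z" l u] l
    by (cases z) (auto simp: even_indicator_def refl_last_def indicator_def abs_if)
  show "(\<lambda>k. wnorm2 (\<lambda>z. even_indicator (box l u) z - (bump (real (Suc k)) l u z + bump (real (Suc k)) l u (refl_last z)))) \<longlonglongrightarrow> 0"
  proof (rule wnorm2_dominated[where w = "even_indicator (box l u)"])
    have bi: "bump (real (Suc k)) l u z \<le> indicator (box l u) z" for k z
      using bump_bounds[of "real (Suc k)" l u z] bump_outside[of "real (Suc k)" z l u] by (cases "z \<in> box l u") auto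
    then show "\<bar>even_indicator (box l u) z - (bump (real (Suc k)) l u z + bump (real (Suc k)) l u (refl_last z))\<bar> \<le> even_indicator (box l u) z" for k z
      unfolding e using bi[of k z] bi[of k "refl_last z"] bump_bounds(1)[of "real (Suc k)" l u z] bump_bounds(1)[of "real (Suc k)" l u "refl_last z"]
      by linarith
    show "AE z in lborel. (\<lambda>k. bump (real (Suc k)) l u z + bump (real (Suc k)) l u (refl_last z)) \<longlonglongrightarrow> even_indicator (box l u) z"
      unfolding e by (intro AE_I2 tendsto_add bump_tendsto)
  qed (use L2ewD[OF L] L2ewD(1)[OF Ctilde0e_L2ew[OF c]] in auto)
qed

text \<open>Boxes are an intersection-stable generator of the Borel sets. Intersecting with one
  fixed box away from x_n = 0 keeps all indicators in the weighted space, so complements become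
  differences of approximable functions and disjoint unions become dominated limits.\<close>

lemma approximable_borel:
  fixes A :: "((real^'m) \<times> real) set"
  assumes A: "A \<in> sets borel" and l: "0 < snd l"
  shows "approximable (even_indicator (A \<inter> box l u))"
proof -
  let ?K = "box l u"
  let ?G = "range (\<lambda>(a, b). box a b :: ((real^'m) \<times> real) set)"
  have sb: "sets (borel :: ((real^'m) \<times> real) measure) = sigma_sets UNIV ?G"
    by (subst borel_eq_box) simp
  have K: "approximable (even_indicator ?K)"
    by (rule approximable_box[OF l])
  have L: "even_indicator (A \<inter> ?K) \<in> L2ew" if "A \<in> sets borel" for A
    by (rule even_indicator_L2ew[OF _ _ l]) (use that in auto)
  have B: "(0, 1) \<in> (Basis :: ((real^'m) \<times> real) set)" by (simp add: Basis_prod_def)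
  have "Int_stable ?G"
  proof (rule Int_stableI)
    fix a b assume "a \<in> ?G" "b \<in> ?G"
    then obtain a1 a2 b1 b2 where "a = box a1 a2" "b = box b1 b2" by auto
    then have "a \<inter> b = (case (\<Sum>i\<in>Basis. max (a1 \<bullet> i) (b1 \<bullet> i) *\<^sub>R i, \<Sum>i\<in>Basis. min (a2 \<bullet> i) (b2 \<bullet> i) *\<^sub>R i) of (a, b) \<Rightarrow> box a b)"
      by (simp add: box_Int_box)
    then show "a \<inter> b \<in> ?G" by (rule range_eqI)
  qed
  moreover have "?G \<subseteq> Pow UNIV" by simp
  moreover have "A \<in> sigma_sets UNIV ?G" using A sb by simp
  ultimately show ?thesis
  proof (induction A rule: sigma_sets_induct_disjoint)
    case (basic A)
    then obtain a b where A: "A = box a b" by auto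
    \<comment> \<open>The lower corner of the intersection of the two boxes; its last coordinate is
      positive, being at least that of l.\<close>
    let ?l = "\<Sum>i\<in>Basis. max (a \<bullet> i) (l \<bullet> i) *\<^sub>R i"
    have "snd ?l = ?l \<bullet> (0, 1)" by (simp add: inner_prod_def)
    also have "\<dots> = max (a \<bullet> (0, 1)) (l \<bullet> (0, 1))"
      using B by (rule inner_sum_left_Basis)
    also have "\<dots> > 0" using l by (simp add: inner_prod_def less_max_iff_disj)
    finally have "0 < snd ?l" .
    then show ?case
      unfolding A box_Int_box by (rule approximable_box)
  next
    case empty
    have "even_indicator ({} \<inter> ?K) = (\<lambda>z. \<Sum>i\<in>{}. 0)"
      by (auto simp: even_indicator_def)
    then show ?case using approximable_sum[of "{}" "\<lambda>i z. 0"] by simp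
  next
    case (compl A)
    have "even_indicator ((UNIV - A) \<inter> ?K) = (\<lambda>z. 1 * even_indicator ?K z + (- 1) * even_indicator (A \<inter> ?K) z)"
      by (auto simp: even_indicator_def indicator_def)
    then show ?case
      using approximable_lincomb[OF K compl(2), of 1 "- 1"] by simp
  next
    case (union A)
    have Ab: "A i \<in> sets borel" for i using union(2) sb by auto
    show ?case
    proof (rule approximable_closed[where h = "\<lambda>n z. \<Sum>i<n. even_indicator (A i \<inter> ?K) z"])
      show "even_indicator (\<Union> (range A) \<inter> ?K) \<in> L2ew"
        using Ab by (intro L) auto
      show "approximable (\<lambda>z. \<Sum>i<n. even_indicator (A i \<inter> ?K) z)" for n
        using union(3) by (intro approximable_sum) auto
      have s: "(\<Sum>i<n. even_indicator (A i \<inter> ?K) z) = even_indicator ((\<Union>i<n. A i) \<inter> ?K) z" for n z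
      proof -
        have "disjoint_family_on (\<lambda>i. A i \<inter> ?K) {..<n}"
          using union(1) by (auto simp: disjoint_family_on_def)
        then show ?thesis
          unfolding even_indicator_def
          by (subst indicator_UN_disjoint[symmetric]) (auto simp: Int_UN_distrib2 intro!: arg_cong2[where f = indicator])
      qed
      show "(\<lambda>n. wnorm2 (\<lambda>z. even_indicator (\<Union> (range A) \<inter> ?K) z - (\<Sum>i<n. even_indicator (A i \<inter> ?K) z))) \<longlonglongrightarrow> 0"
        unfolding s
      proof (rule wnorm2_dominated[where w = "even_indicator ?K"])
        show "\<bar>even_indicator (\<Union> (range A) \<inter> ?K) z - even_indicator ((\<Union>i<n. A i) \<inter> ?K) z\<bar> \<le> even_indicator ?K z" for n z
          by (auto simp: even_indicator_def indicator_def)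
        have "(\<lambda>n. even_indicator ((\<Union>i<n. A i) \<inter> ?K) z) \<longlonglongrightarrow> even_indicator (\<Union> (range A) \<inter> ?K) z" for z
        proof (rule tendsto_eventually)
          show "\<forall>\<^sub>F n in sequentially. even_indicator ((\<Union>i<n. A i) \<inter> ?K) z = even_indicator (\<Union> (range A) \<inter> ?K) z"
          proof (cases "\<exists>i. (fst z, \<bar>snd z\<bar>) \<in> A i")
            case True
            then obtain i where "(fst z, \<bar>snd z\<bar>) \<in> A i" by blast
            then show ?thesis
              by (intro eventually_mono[OF eventually_gt_at_top[of i]]) (auto simp: even_indicator_def indicator_def)
          next
            case False
            then show ?thesis by (intro always_eventually) (auto simp: even_indicator_def)
          qed
        qed
        then show "AE z in lborel. (\<lambda>n. even_indicator ((\<Union>i<n. A i) \<inter> ?K) z) \<longlonglongrightarrow> even_indicator (\<Union> (range A) \<inter> ?K) z"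
          by simp
      qed (use Ab L2ewD[OF L[of UNIV]] in \<open>auto intro!: even_indicator_measurable\<close>)
    qed
  qed
qed

text \<open>The values of g are rounded to multiples of 1 / N n and cut off to boxes in the upper
  half space. The level sets are Borel, so the resulting finite sums are approximable, and |g|
  dominates the error.\<close>

theorem approximable_L2ew:
  fixes g :: "(real^'m) \<times> real \<Rightarrow> real"
  assumes g: "g \<in> L2ew"
  shows "approximable g"
proof -
  note [measurable] = L2ewD(1)[OF g]
  define N where "N n = real (Suc n)" for n
  have N: "1 \<le> N n" "0 < N n" for n by (auto simp: N_def)
  \<comment> \<open>The lower face at height 1 / N n keeps the boxes off the hyperplane while they
    exhaust the open upper half space.\<close>
  define l where "l n = (- N n *\<^sub>R One :: real^'m, 1 / N n)" for n
  define u where "u n = (N n *\<^sub>R One :: real^'m, N n)" for n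
  \<comment> \<open>Rounding goes towards zero, so the rounded value never exceeds g in modulus nor
    has the opposite sign; this is what gives the majorant |g|. Values beyond N n are sent to
    0.\<close>
  define q where "q n z = (if \<bar>g z\<bar> \<le> N n then if 0 \<le> g z then \<lfloor>N n * g z\<rfloor> else - \<lfloor>- N n * g z\<rfloor> else 0)" for n z
  \<comment> \<open>Where |g| \<le> N n, the number N n * |g| is at most N n squared, so finitely
    many integers suffice.\<close>
  define B where "B n = int (Suc n * Suc n)" for n
  have B: "real_of_int (B n) = N n * N n" for n
    by (simp only: B_def N_def of_int_of_nat_eq of_nat_mult of_int_mult)
  define h where "h n z = (\<Sum>i\<in>{- B n..B n}. (real_of_int i / N n) * even_indicator ({z. q n z = i} \<inter> box (l n) (u n)) z)" for n z
  \<comment> \<open>Evenness of g makes the level sets symmetric, so \<open>even_indicator\<close>,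
    which looks only at the upper half space, represents them on both sides.\<close>
  have qe: "q n (fst z, \<bar>snd z\<bar>) = q n z" for n z
    using L2ewD(2)[OF g, of "fst z" "snd z"] by (cases z) (auto simp: q_def abs_if)
  have qm: "{z. q n z = i} \<in> sets borel" for n i
  proof -
    have "q n \<in> measurable borel (count_space UNIV)"
      unfolding q_def[abs_def] by measurable
    from measurable_sets[OF this, of "{i}"] show ?thesis
      by (simp add: vimage_def)
  qed
  have q_range: "q n z \<in> {- B n..B n}" for n z
  proof (cases "\<bar>g z\<bar> \<le> N n")
    case True
    have r: "\<lfloor>N n * y\<rfloor> \<le> B n \<and> 0 \<le> \<lfloor>N n * y\<rfloor>" if "0 \<le> y" "y \<le> N n" for y
    proof -
      have "N n * y \<le> N n * N n" using that N[of n] by (intro mult_left_mono) auto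
      then have "real_of_int \<lfloor>N n * y\<rfloor> \<le> real_of_int (B n)"
        unfolding B by linarith
      then show ?thesis using that N[of n] by simp
    qed
    show ?thesis
    proof (cases "0 \<le> g z")
      case nn: True
      then have "q n z = \<lfloor>N n * g z\<rfloor>" using True by (simp add: q_def)
      moreover have "\<lfloor>N n * g z\<rfloor> \<le> B n \<and> 0 \<le> \<lfloor>N n * g z\<rfloor>"
        by (rule r) (use nn True in auto)
      ultimately show ?thesis unfolding atLeastAtMost_iff by linarith
    next
      case neg: False
      then have "q n z = - \<lfloor>N n * - g z\<rfloor>" using True by (simp add: q_def)
      moreover have "\<lfloor>N n * - g z\<rfloor> \<le> B n \<and> 0 \<le> \<lfloor>N n * - g z\<rfloor>"
        by (rule r) (use neg True in auto)
      ultimately show ?thesis unfolding atLeastAtMost_iff by linarith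
    qed
  next
    case False
    moreover have "0 \<le> B n" unfolding B_def by (rule of_nat_0_le_iff)
    ultimately show ?thesis by (simp add: q_def)
  qed
  have h_eq: "h n z = real_of_int (q n z) / N n * even_indicator (box (l n) (u n)) z" for n z
  proof -
    have "even_indicator ({z. q n z = i} \<inter> box (l n) (u n)) z = (if i = q n z then even_indicator (box (l n) (u n)) z else 0)" for i
      using qe[of n z] by (auto simp: even_indicator_def indicator_def)
    then have "h n z = (\<Sum>i\<in>{- B n..B n}. if i = q n z then real_of_int i / N n * even_indicator (box (l n) (u n)) z else 0)"
      unfolding h_def by (intro sum.cong) auto
    also have "\<dots> = real_of_int (q n z) / N n * even_indicator (box (l n) (u n)) z"
      using q_range[of n z] by (subst sum.delta) auto
    finally show ?thesis .
  qed
  have q_le: "\<bar>g z - real_of_int (q n z) / N n\<bar> \<le> \<bar>g z\<bar>" for n z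
  proof -
    have r: "0 \<le> real_of_int \<lfloor>N n * y\<rfloor> / N n \<and> real_of_int \<lfloor>N n * y\<rfloor> / N n \<le> y" if "0 \<le> y" for y
      using that N[of n] of_int_floor_le[of "N n * y"] by (auto simp: divide_le_eq mult.commute)
    show ?thesis
      using r[of "g z"] r[of "- g z"] by (auto simp: q_def)
  qed
  have q_close: "\<bar>g z - real_of_int (q n z) / N n\<bar> \<le> 1 / N n" if "\<bar>g z\<bar> \<le> N n" for n z
  proof -
    have r: "\<bar>y - real_of_int \<lfloor>N n * y\<rfloor> / N n\<bar> \<le> 1 / N n" for y
    proof -
      have "y - real_of_int \<lfloor>N n * y\<rfloor> / N n = (N n * y - real_of_int \<lfloor>N n * y\<rfloor>) / N n"
        using N[of n] by (simp add: diff_divide_distrib)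
      moreover have "\<bar>N n * y - real_of_int \<lfloor>N n * y\<rfloor>\<bar> \<le> 1" by linarith
      ultimately show ?thesis
        using N[of n] by (simp add: abs_divide divide_right_mono)
    qed
    have "\<bar>g z + real_of_int \<lfloor>- N n * g z\<rfloor> / N n\<bar> \<le> 1 / N n"
      using r[of "- g z"] by (simp add: abs_minus_commute)
    then show ?thesis
      using r[of "g z"] that by (auto simp: q_def)
  qed
  have e01: "even_indicator A z = 0 \<or> even_indicator A z = 1" for A :: "((real^'m) \<times> real) set" and z
    by (auto simp: even_indicator_def indicator_def)
  have snd_l: "0 < snd (l n)" for n using N[of n] by (simp add: l_def)
  have ap: "approximable (h n)" for n
    unfolding h_def
  proof (rule approximable_sum)
    fix i
    show "approximable (\<lambda>z. real_of_int i / N n * even_indicator ({z. q n z = i} \<inter> box (l n) (u n)) z)"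
      using approximable_lincomb[OF approximable_borel[OF qm snd_l] approximable_borel[OF qm snd_l], of "real_of_int i / N n" n i n "u n" 0 n i n "u n"] by simp
  qed simp
  show ?thesis
  proof (rule approximable_closed[OF g ap])
    show "(\<lambda>n. wnorm2 (\<lambda>z. g z - h n z)) \<longlonglongrightarrow> 0"
    proof (rule wnorm2_dominated[where w = "\<lambda>z. \<bar>g z\<bar>"])
      show "h n \<in> borel_measurable borel" for n
        using ap[of n] by (auto simp: approximable_def L2ew_def)
      show "\<bar>g z - h n z\<bar> \<le> \<bar>g z\<bar>" for n z
        using q_le[of z n] e01[of "box (l n) (u n)" z] unfolding h_eq by auto
      show "wnorm2 (\<lambda>z. \<bar>g z\<bar>) < \<infinity>"
        using L2ewD(3)[OF g] by (simp add: wnorm2_def)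
      show "AE z in lborel. (\<lambda>n. h n z) \<longlonglongrightarrow> g z"
        using AE_snd_nonzero
      proof eventually_elim
        case (elim z)
        \<comment> \<open>Once N n exceeds c, the point moved to the upper half space lies in the
          box, and g z is not truncated.\<close>
        define c where "c = max (norm z) (max \<bar>g z\<bar> (1 / \<bar>snd z\<bar>))"
        obtain n0 :: nat where n0: "c < real n0" using reals_Archimedean2 by blast
        have "norm (h n z - g z) \<le> 1 / N n" if "n0 \<le> n" for n
        proof -
          have c: "c < N n" using n0 that by (simp add: N_def)
          have "(fst z, \<bar>snd z\<bar>) \<in> box (l n) (u n)"
          proof -
            have f: "\<bar>fst z \<bullet> i\<bar> < N n" if "i \<in> Basis" for i
              using Basis_le_norm[OF that, of "fst z"] norm_fst_le[of "fst z" "snd z"] c by (simp add: c_def)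
            have s: "\<bar>snd z\<bar> < N n"
              using norm_snd_le[where x = "fst z" and y = "snd z"] c by (simp add: c_def)
            have "1 / \<bar>snd z\<bar> < N n" using c by (simp add: c_def)
            then have "1 / N n < \<bar>snd z\<bar>"
              using elim N[of n] by (simp add: field_simps)
            with f s show ?thesis
              by (force simp: mem_box Basis_prod_def l_def u_def inner_prod_def abs_less_iff)
          qed
          then have "h n z = real_of_int (q n z) / N n"
            unfolding h_eq by (simp add: even_indicator_def)
          moreover have "\<bar>g z\<bar> \<le> N n" using c by (simp add: c_def)
          ultimately show ?thesis
            using q_close[of z n] by (simp add: abs_minus_commute)
        qed
        then have ev: "\<forall>\<^sub>F n in sequentially. norm (h n z - g z) \<le> 1 / N n"
          by (auto simp: eventually_sequentially)
        have "(\<lambda>n. h n z - g z) \<longlonglongrightarrow> 0"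
          by (rule Lim_null_comparison[OF ev]) (unfold N_def, rule inverse_Suc_tendsto_0)
        then show ?case by (rule LIM_zero_cancel)
      qed
    qed measurable
  qed
qed

section \<open>Extension by continuity\<close>

lemma wave_sol_lincomb:
  assumes u: "wave_sol f u" and v: "wave_sol g v"
  shows "wave_sol (\<lambda>x. a * f x + b * g x) (\<lambda>p. a * u p + b * v p)"
proof -
  have C: "C_inf u" "C_inf v" using u v by (auto simp: wave_sol_def)
  have Bt: "(0, 1) \<in> (Basis :: (((real^'a) \<times> real) \<times> real) set)" by (simp add: Basis_prod_def)
  have Bx: "(i, 0) \<in> (Basis :: (((real^'a) \<times> real) \<times> real) set)" if "i \<in> Basis" for i
    by (subst Basis_prod_def) (use that in blast)
  have d2: "dd c (dd c (\<lambda>p. a * u p + b * v p)) = (\<lambda>p. a * dd c (dd c u) p + b * dd c (dd c v) p)" if "c \<in> Basis" for c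
    unfolding dd_lincomb[OF C] by (rule dd_lincomb[OF C_inf_dd[OF C(1) that] C_inf_dd[OF C(2) that]])
  have "dd (0, 1) (dd (0, 1) (\<lambda>p. a * u p + b * v p)) p - (\<Sum>i\<in>Basis. dd (i, 0) (dd (i, 0) (\<lambda>p. a * u p + b * v p)) p) = 0" for p
  proof -
    have eu: "dd (0, 1) (dd (0, 1) u) p - (\<Sum>i\<in>Basis. dd (i, 0) (dd (i, 0) u) p) = 0"
      and ev: "dd (0, 1) (dd (0, 1) v) p - (\<Sum>i\<in>Basis. dd (i, 0) (dd (i, 0) v) p) = 0"
      using u v unfolding wave_sol_def by blast+
    have "(\<Sum>i\<in>Basis. dd (i, 0) (dd (i, 0) (\<lambda>p. a * u p + b * v p)) p)
       = a * (\<Sum>i\<in>Basis. dd (i, 0) (dd (i, 0) u) p) + b * (\<Sum>i\<in>Basis. dd (i, 0) (dd (i, 0) v) p)"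
      by (simp add: d2[OF Bx] sum.distrib sum_distrib_left)
    then show ?thesis
      using eu ev by (simp add: d2[OF Bt])
  qed
  then show ?thesis
    using u v C_inf_lincomb[OF C] by (simp add: wave_sol_def dd_lincomb[OF C])
qed

lemma wave_sol_unique:
  assumes "wave_sol f u" "wave_sol f v"
  shows "u = v"
proof
  fix p :: "((real^'a) \<times> real) \<times> real"
  let ?w = "\<lambda>p. 1 * u p + (- 1) * v p"
  have w: "wave_sol (\<lambda>x. 1 * f x + (- 1) * f x) ?w"
    by (rule wave_sol_lincomb[OF assms])
  then have W: "C_inf ?w" "\<And>p. dd (0, 1) (dd (0, 1) ?w) p - (\<Sum>b\<in>Basis. dd (b, 0) (dd (b, 0) ?w) p) = 0"
    "\<And>x. dd (0, 1) ?w (x, 0) = 0" "\<And>x. ?w (x, 0) = 1 * f x + (- 1) * f x"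
    unfolding wave_sol_def by blast+
  have "?w (x, 0) = 0" for x
    using W(4)[of x] by simp
  then have "?w (fst p, snd p) = 0"
    by (rule wave_unique[OF W(1,2) _ W(3)])
  then show "u p = v p" by simp
qed

lemma wave_sol_wave:
  assumes "f \<in> Ctilde0e"
  shows "wave_sol f (wave f)"
  unfolding wave_sol_def using wave_exists[OF Ctilde0e_test_fun(1)[OF assms]] by blast

lemma wave_sol_the: "wave_sol f u \<Longrightarrow> (THE u. wave_sol f u) = u"
  using wave_sol_unique by blast

lemma Uop_eq_wave:
  assumes "f \<in> Ctilde0e"
  shows "Uop f z = wave f ((fst z, 0), snd z)"
  unfolding Uop_def wave_sol_the[OF wave_sol_wave[OF assms]] by (simp add: case_prod_unfold)

text \<open>By uniqueness the combined solution is the solution for the combined data, so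
  \<open>Uop\<close> is linear pointwise and not only almost everywhere.\<close>

lemma Uop_lincomb:
  assumes "f \<in> Ctilde0e" "g \<in> Ctilde0e"
  shows "Uop (\<lambda>x. a * f x + b * g x) = (\<lambda>x. a * Uop f x + b * Uop g x)"
  unfolding Uop_def wave_sol_the[OF wave_sol_wave[OF assms(1)]] wave_sol_the[OF wave_sol_wave[OF assms(2)]]
    wave_sol_the[OF wave_sol_lincomb[OF wave_sol_wave[OF assms(1)] wave_sol_wave[OF assms(2)]]]
  by (simp add: case_prod_unfold)

lemma Uop_diff: "f \<in> Ctilde0e \<Longrightarrow> g \<in> Ctilde0e \<Longrightarrow> Uop (\<lambda>x. f x - g x) = (\<lambda>x. Uop f x - Uop g x)"
  using Uop_lincomb[of f g 1 "- 1"] by simp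

lemma Ctilde0e_diff: "f \<in> Ctilde0e \<Longrightarrow> g \<in> Ctilde0e \<Longrightarrow> (\<lambda>x. f x - g x) \<in> Ctilde0e"
  using Ctilde0e_lincomb[of f g 1 "- 1"] by simp

lemma wnorm2_Uop:
  assumes f: "f \<in> Ctilde0e"
  shows "wnorm2 (Uop f) = wnorm2 f"
  unfolding wnorm2_def Uop_eq_wave[OF f]
  by (rule wave_trace_isometry[OF Ctilde0e_test_fun[OF f], symmetric])

lemma Uop_L2ew:
  assumes f: "f \<in> Ctilde0e"
  shows "Uop f \<in> L2ew"
proof -
  have "Uop f = (\<lambda>z. wave f ((fst z, 0), snd z))"
    by (rule ext) (rule Uop_eq_wave[OF f])
  moreover have "(\<lambda>z. wave f ((fst z, 0), snd z)) \<in> borel_measurable borel"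
    by (intro borel_measurable_continuous_onI continuous_on_compose2[OF C_inf_continuous[OF wave_exists(1)[OF Ctilde0e_test_fun(1)[OF f]]]] continuous_intros) auto
  ultimately have "Uop f \<in> borel_measurable borel" by simp
  moreover have "Uop f (x', - s) = Uop f (x', s)" for x' s
    unfolding Uop_eq_wave[OF f] by (simp add: wave_def)
  moreover have "wnorm2 (Uop f) < \<infinity>"
    unfolding wnorm2_Uop[OF f] by (rule L2ewD(3)[OF Ctilde0e_L2ew[OF f]])
  ultimately show ?thesis
    by (simp add: L2ew_def)
qed

text \<open>A Riesz-Fischer argument for the weighted norm. Using \<open>lim\<close> pointwise gives
  one explicit representative of the limit, and Fatou's lemma transfers the rate to it.\<close>

lemma
  fixes u :: "nat \<Rightarrow> (real^'m) \<times> real \<Rightarrow> real"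
  assumes u [measurable]: "\<And>k. u k \<in> borel_measurable borel"
    and c: "\<And>j k. k \<le> j \<Longrightarrow> wnorm2 (\<lambda>z. u j z - u k z) \<le> ennreal (4 / 16 ^ k)"
  shows wnorm2_Cauchy_convergent: "AE z in lborel. convergent (\<lambda>k. u k z)"
    and wnorm2_Cauchy_limit: "wnorm2 (\<lambda>z. lim (\<lambda>k. u k z) - u k z) \<le> ennreal (4 / 16 ^ k)"
proof -
  \<comment> \<open>The weight 2^k costs a factor 4^k in the squared norm, which leaves terms of
    size at most 4 / 4^k and a finite sum. Finiteness of the sum at z then bounds the increments by
    a multiple of 2^(-k).\<close>
  let ?t = "\<lambda>k z. ennreal ((2 ^ k * (u (Suc k) z - u k z))\<^sup>2 / \<bar>snd z\<bar>)"
  have m: "(\<lambda>z. ?t k z) \<in> borel_measurable lborel" for k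
    by (rule weight_measurable_lborel) measurable
  have t: "(\<integral>\<^sup>+z. ?t k z \<partial>lborel) \<le> ennreal (4 * (1 / 4) ^ k)" for k
  proof -
    have "(\<integral>\<^sup>+z. ?t k z \<partial>lborel) = wnorm2 (\<lambda>z. 2 ^ k * (u (Suc k) z - u k z))"
      by (simp add: wnorm2_def)
    also have "\<dots> = ennreal ((2 ^ k)\<^sup>2) * wnorm2 (\<lambda>z. u (Suc k) z - u k z)"
      by (rule wnorm2_cmult) measurable
    also have "\<dots> \<le> ennreal ((2 ^ k)\<^sup>2) * ennreal (4 / 16 ^ k)"
      by (intro mult_left_mono c) auto
    also have "\<dots> = ennreal ((2 ^ k)\<^sup>2 * (4 / 16 ^ k))"
      by (rule ennreal_mult[symmetric]) auto
    also have "(2 ^ k)\<^sup>2 * (4 / 16 ^ k) = 4 * (1 / 4 :: real) ^ k"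
    proof -
      have "(2 ^ k)\<^sup>2 = (4 :: real) ^ k" by (simp add: power2_eq_square flip: power_mult_distrib)
      moreover have "(16 :: real) ^ k = 4 ^ k * 4 ^ k" by (simp flip: power_mult_distrib)
      ultimately show ?thesis by (simp add: power_one_over)
    qed
    finally show ?thesis .
  qed
  have "(\<integral>\<^sup>+z. (\<Sum>k. ?t k z) \<partial>lborel) = (\<Sum>k. \<integral>\<^sup>+z. ?t k z \<partial>lborel)"
    by (rule nn_integral_suminf[OF m])
  also have "\<dots> \<le> (\<Sum>k. ennreal (4 * (1 / 4) ^ k))"
    by (intro suminf_le t) auto
  also have "\<dots> = ennreal (\<Sum>k. 4 * (1 / 4) ^ k)"
    by (intro suminf_ennreal2 summable_mult summable_geometric) auto
  also have "\<dots> < \<infinity>" by simp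
  finally have fin: "(\<integral>\<^sup>+z. (\<Sum>k. ?t k z) \<partial>lborel) \<noteq> \<infinity>" by simp
  have "AE z in lborel. (\<Sum>k. ?t k z) \<noteq> \<infinity>"
    by (rule nn_integral_PInf_AE[OF borel_measurable_suminf_order[OF m] fin])
  then show conv: "AE z in lborel. convergent (\<lambda>k. u k z)"
    using AE_snd_nonzero
  proof eventually_elim
    case (elim z)
    define D where "D = enn2real (\<Sum>k. ?t k z)"
    have "ennreal ((2 ^ k * (u (Suc k) z - u k z))\<^sup>2 / \<bar>snd z\<bar>) \<le> ennreal D" for k
    proof -
      have "(\<Sum>k\<in>{k}. ?t k z) \<le> (\<Sum>k. ?t k z)"
        by (rule sum_le_suminf[OF summableI]) auto
      moreover have "(\<Sum>k. ?t k z) = ennreal D"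
        unfolding D_def using elim(1) by (intro ennreal_enn2real[symmetric]) (simp only: less_top infinity_ennreal_def)
      ultimately show ?thesis by (simp only: sum.insert sum.empty finite.emptyI empty_iff not_False_eq_True add_0_right)
    qed
    then have D: "(2 ^ k * (u (Suc k) z - u k z))\<^sup>2 / \<bar>snd z\<bar> \<le> D" for k
      by (subst (asm) ennreal_le_iff) (auto simp: D_def)
    have b: "norm (u (Suc k) z - u k z) \<le> sqrt (D * \<bar>snd z\<bar>) * (1 / 2) ^ k" for k
    proof -
      have "(2 ^ k * (u (Suc k) z - u k z))\<^sup>2 \<le> D * \<bar>snd z\<bar>"
        using D[of k] elim(2) by (simp add: divide_le_eq)
      then have "\<bar>2 ^ k * (u (Suc k) z - u k z)\<bar> \<le> sqrt (D * \<bar>snd z\<bar>)"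
        using real_le_rsqrt[of "\<bar>2 ^ k * (u (Suc k) z - u k z)\<bar>"] by simp
      then have "2 ^ k * \<bar>u (Suc k) z - u k z\<bar> \<le> sqrt (D * \<bar>snd z\<bar>)"
        unfolding abs_mult by simp
      then have "\<bar>u (Suc k) z - u k z\<bar> \<le> sqrt (D * \<bar>snd z\<bar>) / 2 ^ k"
        by (subst pos_le_divide_eq) (simp_all only: mult.commute zero_less_power zero_less_numeral)
      then show ?thesis
        by (simp add: power_one_over)
    qed
    have s: "summable (\<lambda>k. sqrt (D * \<bar>snd z\<bar>) * (1 / 2) ^ k)"
      by (intro summable_mult summable_geometric) simp
    have "summable (\<lambda>k. u (Suc k) z - u k z)"
      by (rule summable_comparison_test'[OF s b])
    then have "convergent (\<lambda>n. \<Sum>k<n. u (Suc k) z - u k z)"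
      by (simp add: summable_iff_convergent)
    then have "convergent (\<lambda>n. (\<Sum>k<n. u (Suc k) z - u k z) + u 0 z)"
      by (intro convergent_add convergent_const)
    moreover have "(\<Sum>k<n. u (Suc k) z - u k z) + u 0 z = u n z" for n
      using sum_lessThan_telescope[of "\<lambda>k. u k z" n] by simp
    ultimately show ?case
      by (simp only:)
  qed
  let ?s = "\<lambda>j z. ennreal ((u j z - u k z)\<^sup>2 / \<bar>snd z\<bar>)"
  have "wnorm2 (\<lambda>z. lim (\<lambda>k. u k z) - u k z) = (\<integral>\<^sup>+z. liminf (\<lambda>j. ?s j z) \<partial>lborel)"
    unfolding wnorm2_def
  proof (rule nn_integral_cong_AE)
    show "AE z in lborel. ennreal ((lim (\<lambda>k. u k z) - u k z)\<^sup>2 / \<bar>snd z\<bar>) = liminf (\<lambda>j. ?s j z)"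
      using conv AE_snd_nonzero
    proof eventually_elim
      case (elim z)
      have "(\<lambda>j. u j z) \<longlonglongrightarrow> lim (\<lambda>k. u k z)"
        using elim(1) by (simp add: convergent_LIMSEQ_iff)
      then have "(\<lambda>j. ?s j z) \<longlonglongrightarrow> ennreal ((lim (\<lambda>k. u k z) - u k z)\<^sup>2 / \<bar>snd z\<bar>)"
        using elim(2) by (intro tendsto_ennrealI tendsto_intros) auto
      then show ?case
        by (rule lim_imp_Liminf[OF sequentially_bot, symmetric])
    qed
  qed
  \<comment> \<open>Fatou's lemma; the integrals on the right obey the assumed bound once j \<ge>
    k.\<close>
  also have "\<dots> \<le> liminf (\<lambda>j. \<integral>\<^sup>+z. ?s j z \<partial>lborel)"
    by (intro nn_integral_liminf weight_measurable_lborel) measurable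
  also have "\<dots> \<le> limsup (\<lambda>j. \<integral>\<^sup>+z. ?s j z \<partial>lborel)"
    by (rule Liminf_le_Limsup) simp
  also have "\<dots> \<le> ennreal (4 / 16 ^ k)"
    by (rule Limsup_bounded)
       (use c[of k] in \<open>auto simp: wnorm2_def intro!: eventually_sequentiallyI[of k]\<close>)
  finally show "wnorm2 (\<lambda>z. lim (\<lambda>k. u k z) - u k z) \<le> ennreal (4 / 16 ^ k)" .
qed

lemma wnorm2_limit_unique:
  assumes a: "a \<in> borel_measurable borel" and b: "b \<in> borel_measurable borel" and u: "\<And>k. u k \<in> borel_measurable borel"
    and la: "(\<lambda>k. wnorm2 (\<lambda>x. a x - u k x)) \<longlonglongrightarrow> 0" and lb: "(\<lambda>k. wnorm2 (\<lambda>x. b x - u k x)) \<longlonglongrightarrow> 0"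
  shows "AE x in lborel. a x = b x"
proof -
  have "(\<lambda>k. wnorm2 (\<lambda>x. 1 * (a x - u k x) + (- 1) * (b x - u k x))) \<longlonglongrightarrow> 0"
    using a b u by (intro wnorm2_tendsto_lincomb la lb) auto
  then have "(\<lambda>k :: nat. wnorm2 (\<lambda>x. a x - b x)) \<longlonglongrightarrow> 0" by simp
  then have "wnorm2 (\<lambda>x. a x - b x) = 0"
    by (simp add: LIMSEQ_const_iff)
  then have "AE x in lborel. a x - b x = 0"
    using a b by (intro wnorm2_eq_0) auto
  then show ?thesis by simp
qed

text \<open>The triangle estimate is applied twice with factor 1 + \<delta>, once between a and
  \<open>u k\<close> and once between \<open>f k\<close> and g. The errors vanish as k grows, and
  then \<delta> tends to 0; finiteness of \<open>wnorm2 g\<close> makes multiplication by it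
  continuous in that limit.\<close>

lemma wnorm2_limit_le:
  assumes a: "a \<in> borel_measurable borel" and g: "g \<in> borel_measurable borel"
    and u: "\<And>k. u k \<in> borel_measurable borel" and f: "\<And>k. f k \<in> borel_measurable borel"
    and la: "(\<lambda>k. wnorm2 (\<lambda>x. a x - u k x)) \<longlonglongrightarrow> 0" and lg: "(\<lambda>k. wnorm2 (\<lambda>x. g x - f k x)) \<longlonglongrightarrow> 0"
    and eq: "\<And>k. wnorm2 (u k) = wnorm2 (f k)" and fin: "wnorm2 g < \<infinity>"
  shows "wnorm2 a \<le> wnorm2 g"
proof -
  have step: "wnorm2 a \<le> ennreal (1 + \<delta>) * (ennreal (1 + \<delta>) * wnorm2 g)" if d: "0 < \<delta>" for \<delta>
  proof (rule LIMSEQ_le_const)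
    let ?c = "ennreal (1 + 1 / \<delta>)"
    let ?d = "ennreal (1 + \<delta>)"
    have "(\<lambda>k. ?d * (?d * wnorm2 g + ?c * wnorm2 (\<lambda>x. g x - f k x)) + ?c * wnorm2 (\<lambda>x. a x - u k x)) \<longlonglongrightarrow> ?d * (?d * wnorm2 g + ?c * 0) + ?c * 0"
      by (intro tendsto_add ennreal_tendsto_cmult tendsto_const la lg) auto
    then show "(\<lambda>k. ?d * (?d * wnorm2 g + ?c * wnorm2 (\<lambda>x. g x - f k x)) + ?c * wnorm2 (\<lambda>x. a x - u k x)) \<longlonglongrightarrow> ?d * (?d * wnorm2 g)"
      by simp
    have "wnorm2 a \<le> ?d * (?d * wnorm2 g + ?c * wnorm2 (\<lambda>x. g x - f k x)) + ?c * wnorm2 (\<lambda>x. a x - u k x)" for k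
    proof -
      have "wnorm2 a \<le> ?d * wnorm2 (u k) + ?c * wnorm2 (\<lambda>x. a x - u k x)"
        using wnorm2_triangle[of "u k" "\<lambda>x. a x - u k x" \<delta>] a u[of k] d by simp
      moreover have "wnorm2 (f k) \<le> ?d * wnorm2 g + ?c * wnorm2 (\<lambda>x. g x - f k x)"
        using wnorm2_triangle[of g "\<lambda>x. f k x - g x" \<delta>] g f[of k] d wnorm2_minus_commute[of g "f k"] by simp
      ultimately show ?thesis
        unfolding eq by (meson add_right_mono mult_left_mono order_trans zero_le)
    qed
    then show "\<exists>N. \<forall>k\<ge>N. wnorm2 a \<le> ?d * (?d * wnorm2 g + ?c * wnorm2 (\<lambda>x. g x - f k x)) + ?c * wnorm2 (\<lambda>x. a x - u k x)"
      by blast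
  qed
  show ?thesis
  proof (rule LIMSEQ_le_const)
    let ?d = "\<lambda>n. 1 / real (Suc n)"
    have "(\<lambda>n. ennreal ((1 + ?d n) * (1 + ?d n))) \<longlonglongrightarrow> ennreal ((1 + 0) * (1 + 0))"
      by (intro tendsto_ennrealI tendsto_intros inverse_Suc_tendsto_0)
    then have "(\<lambda>n. wnorm2 g * ennreal ((1 + ?d n) * (1 + ?d n))) \<longlonglongrightarrow> wnorm2 g * ennreal ((1 + 0) * (1 + 0))"
      using fin by (intro ennreal_tendsto_cmult) auto
    then show "(\<lambda>n. wnorm2 g * ennreal ((1 + ?d n) * (1 + ?d n))) \<longlonglongrightarrow> wnorm2 g" by simp
    have "wnorm2 a \<le> wnorm2 g * ennreal ((1 + ?d n) * (1 + ?d n))" for n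
    proof -
      have "ennreal ((1 + ?d n) * (1 + ?d n)) = ennreal (1 + ?d n) * ennreal (1 + ?d n)"
        by (intro ennreal_mult) auto
      then show ?thesis
        using step[of "?d n"] by (simp add: mult_ac del: of_nat_Suc)
    qed
    then show "\<exists>N. \<forall>n\<ge>N. wnorm2 a \<le> wnorm2 g * ennreal ((1 + ?d n) * (1 + ?d n))" by blast
  qed
qed

lemma wnorm2_limit_eq:
  assumes "a \<in> L2ew" "g \<in> L2ew" "\<And>k. u k \<in> L2ew" "\<And>k. f k \<in> L2ew"
    and "(\<lambda>k. wnorm2 (\<lambda>x. a x - u k x)) \<longlonglongrightarrow> 0" "(\<lambda>k. wnorm2 (\<lambda>x. g x - f k x)) \<longlonglongrightarrow> 0"
    and eq: "\<And>k. wnorm2 (u k) = wnorm2 (f k)"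
  shows "wnorm2 a = wnorm2 g"
proof (rule antisym)
  show "wnorm2 a \<le> wnorm2 g"
    by (rule wnorm2_limit_le[OF L2ewD(1)[OF assms(1)] L2ewD(1)[OF assms(2)] L2ewD(1)[OF assms(3)] L2ewD(1)[OF assms(4)] assms(5-7) L2ewD(3)[OF assms(2)]])
  show "wnorm2 g \<le> wnorm2 a"
    by (rule wnorm2_limit_le[OF L2ewD(1)[OF assms(2)] L2ewD(1)[OF assms(1)] L2ewD(1)[OF assms(4)] L2ewD(1)[OF assms(3)] assms(6,5) eq[symmetric] L2ewD(3)[OF assms(1)]])
qed

text \<open>F picks approximating sequences for each representative independently, so neither
  linearity nor compatibility with equality almost everywhere is built in. Both follow from
  \<open>key\<close>: for any test functions converging to g, the images converge to
  \<open>T g\<close>.\<close>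

lemma isometric_extension_exists:
  fixes F :: "((real^'m) \<times> real \<Rightarrow> real) \<Rightarrow> nat \<Rightarrow> (real^'m) \<times> real \<Rightarrow> real"
  assumes F: "\<And>g k. g \<in> L2ew \<Longrightarrow> F g k \<in> Ctilde0e"
    and FL: "\<And>g k. g \<in> L2ew \<Longrightarrow> wnorm2 (\<lambda>x. g x - F g k x) \<le> ennreal (1 / 16 ^ k)"
  shows "isometric_extension_of_U (\<lambda>g z. lim (\<lambda>k. Uop (F g k) z))"
proof -
  text \<open>On the null set where the sequence diverges, \<open>lim\<close> is unspecified, but still measurable and even in
    the last variable.\<close>
  define T where "T g z = lim (\<lambda>k. Uop (F g k) z)" for g z
  note m = L2ewD(1)
  have Um: "Uop f \<in> borel_measurable borel" if "f \<in> Ctilde0e" for f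
    by (rule m[OF Uop_L2ew[OF that]])
  have fm: "f \<in> borel_measurable borel" if "f \<in> Ctilde0e" for f
    by (rule m[OF Ctilde0e_L2ew[OF that]])
  have U_diff: "wnorm2 (\<lambda>x. Uop f x - Uop g x) = wnorm2 (\<lambda>x. f x - g x)" if "f \<in> Ctilde0e" "g \<in> Ctilde0e" for f g
    using wnorm2_Uop[OF Ctilde0e_diff[OF that]] Uop_diff[OF that] by simp
  have cauchy: "wnorm2 (\<lambda>x. Uop (F g j) x - Uop (F g k) x) \<le> ennreal (4 / 16 ^ k)" if g: "g \<in> L2ew" and jk: "k \<le> j" for g j k
  proof -
    have p: "1 / 16 ^ j \<le> (1 / 16 ^ k :: real)"
      using jk by (intro divide_left_mono power_increasing) auto
    have "wnorm2 (\<lambda>x. F g j x - F g k x) \<le> 2 * wnorm2 (\<lambda>x. F g j x - g x) + 2 * wnorm2 (\<lambda>x. g x - F g k x)"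
      by (rule wnorm2_triangle_diff[OF fm[OF F[OF g]] m[OF g] fm[OF F[OF g]]])
    also have "\<dots> \<le> 2 * ennreal (1 / 16 ^ k) + 2 * ennreal (1 / 16 ^ k)"
      using order_trans[OF FL[OF g, of j] ennreal_leI[OF p]] FL[OF g, of k]
      by (intro add_mono mult_left_mono) (auto simp: wnorm2_minus_commute[of "F g j" g])
    also have "\<dots> = 4 * ennreal (1 / 16 ^ k)"
      by (simp flip: distrib_right)
    also have "\<dots> = ennreal (4 / 16 ^ k)"
      using ennreal_mult[of 4 "1 / 16 ^ k"] by simp
    finally show ?thesis
      unfolding U_diff[OF F[OF g] F[OF g]] .
  qed
  have TU: "wnorm2 (\<lambda>z. T g z - Uop (F g k) z) \<le> ennreal (4 / 16 ^ k)" if "g \<in> L2ew" for g k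
    unfolding T_def by (rule wnorm2_Cauchy_limit[OF Um[OF F[OF that]] cauchy[OF that]])
  have Tm: "T g \<in> borel_measurable borel" if "g \<in> L2ew" for g
    unfolding T_def[abs_def] by (rule borel_measurable_lim_metric) (rule Um[OF F[OF that]])
  have T_L2ew: "T g \<in> L2ew" if g: "g \<in> L2ew" for g
  proof -
    have "T g (x', - s) = T g (x', s)" for x' s
      unfolding T_def using L2ewD(2)[OF Uop_L2ew[OF F[OF g]]] by simp
    moreover have "wnorm2 (T g) < \<infinity>"
    proof -
      have "wnorm2 (T g) \<le> ennreal (1 + 1) * wnorm2 (\<lambda>z. T g z - Uop (F g 0) z) + ennreal (1 + 1 / 1) * wnorm2 (Uop (F g 0))"
        using wnorm2_triangle[of "\<lambda>z. T g z - Uop (F g 0) z" "Uop (F g 0)" 1] Tm[OF g] Um[OF F[OF g]] by simp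
      also have "\<dots> < \<infinity>"
        using order_le_less_trans[OF TU[OF g, of 0] ennreal_less_top] L2ewD(3)[OF Uop_L2ew[OF F[OF g, of 0]]]
        by (simp add: ennreal_mult_less_top)
      finally show ?thesis .
    qed
    ultimately show ?thesis
      using Tm[OF g] by (simp add: L2ew_def)
  qed
  have key: "(\<lambda>k. wnorm2 (\<lambda>z. T g z - Uop (f k) z)) \<longlonglongrightarrow> 0"
    if g: "g \<in> L2ew" and f: "\<And>k. f k \<in> Ctilde0e" and l: "(\<lambda>k. wnorm2 (\<lambda>x. g x - f k x)) \<longlonglongrightarrow> 0" for g f
  proof -
    have "(\<lambda>k. wnorm2 (\<lambda>x. 1 * (g x - f k x) + (- 1) * (g x - F g k x))) \<longlonglongrightarrow> 0"
      using m[OF g] fm[OF F[OF g]] fm[OF f]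
      by (intro wnorm2_tendsto_lincomb l tendsto_0_geometric[of _ 1] FL[OF g]) auto
    then have "(\<lambda>k. wnorm2 (\<lambda>x. F g k x - f k x)) \<longlonglongrightarrow> 0" by simp
    then have l2: "(\<lambda>k. wnorm2 (\<lambda>x. Uop (F g k) x - Uop (f k) x)) \<longlonglongrightarrow> 0"
      by (simp only: U_diff[OF F[OF g] f])
    have l1: "(\<lambda>k. wnorm2 (\<lambda>x. T g x - Uop (F g k) x)) \<longlonglongrightarrow> 0"
      by (rule tendsto_0_geometric[of _ 4]) (rule TU[OF g])
    have "(\<lambda>k. wnorm2 (\<lambda>x. 1 * (T g x - Uop (F g k) x) + 1 * (Uop (F g k) x - Uop (f k) x))) \<longlonglongrightarrow> 0"
      using Tm[OF g] Um[OF F[OF g]] Um[OF f]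
      by (intro wnorm2_tendsto_lincomb l1 l2) auto
    then show ?thesis by simp
  qed
  have FL0: "(\<lambda>k. wnorm2 (\<lambda>x. g x - F g k x)) \<longlonglongrightarrow> 0" if "g \<in> L2ew" for g
    by (rule tendsto_0_geometric[of _ 1]) (rule FL[OF that])
  show ?thesis
    unfolding isometric_extension_of_U_def T_def[symmetric]
  proof (intro conjI ballI allI impI)
    fix g :: "(real^'m) \<times> real \<Rightarrow> real" assume g: "g \<in> L2ew"
    show "T g \<in> L2ew" by (rule T_L2ew[OF g])
    show "wnorm2 (T g) = wnorm2 g"
      by (rule wnorm2_limit_eq[OF T_L2ew[OF g] g Uop_L2ew[OF F[OF g]] Ctilde0e_L2ew[OF F[OF g]] key[OF g F[OF g] FL0[OF g]] FL0[OF g] wnorm2_Uop[OF F[OF g]]])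
    fix h :: "(real^'m) \<times> real \<Rightarrow> real" assume h: "h \<in> L2ew"
    show "AE x in lborel. T g x = T h x" if eq: "AE x in lborel. g x = h x"
    proof (rule wnorm2_limit_unique[OF Tm[OF g] Tm[OF h] Um[OF F[OF g]] key[OF g F[OF g] FL0[OF g]]])
      \<comment> \<open>The sequence chosen for g approximates h as well, so both values of T are
        limits of the same images.\<close>
      have "wnorm2 (\<lambda>x. h x - F g k x) = wnorm2 (\<lambda>x. g x - F g k x)" for k
        by (rule wnorm2_cong_AE) (use eq in eventually_elim, simp)
      then have "(\<lambda>k. wnorm2 (\<lambda>x. h x - F g k x)) \<longlonglongrightarrow> 0"
        using FL0[OF g] by simp
      then show "(\<lambda>k. wnorm2 (\<lambda>x. T h x - Uop (F g k) x)) \<longlonglongrightarrow> 0"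
        by (rule key[OF h F[OF g]])
    qed
    fix a b :: real
    let ?f = "\<lambda>k x. a * F g k x + b * F h k x"
    have f: "?f k \<in> Ctilde0e" for k
      by (rule Ctilde0e_lincomb[OF F[OF g] F[OF h]])
    have L: "(\<lambda>y. a * g y + b * h y) \<in> L2ew"
      by (rule L2ew_lincomb[OF g h])
    show "AE x in lborel. T (\<lambda>y. a * g y + b * h y) x = a * T g x + b * T h x"
    proof (rule wnorm2_limit_unique[OF Tm[OF L] _ Um[OF f]])
      show "(\<lambda>x. a * T g x + b * T h x) \<in> borel_measurable borel"
        using Tm[OF g] Tm[OF h] by measurable
      have "(\<lambda>k. wnorm2 (\<lambda>x. a * (g x - F g k x) + b * (h x - F h k x))) \<longlonglongrightarrow> 0"
        using m[OF g] m[OF h] fm[OF F[OF g]] fm[OF F[OF h]]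
        by (intro wnorm2_tendsto_lincomb FL0 g h) auto
      then have "(\<lambda>k. wnorm2 (\<lambda>x. a * g x + b * h x - ?f k x)) \<longlonglongrightarrow> 0"
        by (simp add: algebra_simps)
      then show "(\<lambda>k. wnorm2 (\<lambda>x. T (\<lambda>y. a * g y + b * h y) x - Uop (?f k) x)) \<longlonglongrightarrow> 0"
        by (rule key[OF L f])
      have "(\<lambda>k. wnorm2 (\<lambda>x. a * (T g x - Uop (F g k) x) + b * (T h x - Uop (F h k) x))) \<longlonglongrightarrow> 0"
        using Tm[OF g] Tm[OF h] Um[OF F[OF g]] Um[OF F[OF h]]
        by (intro wnorm2_tendsto_lincomb key FL0 F g h) auto
      then show "(\<lambda>k. wnorm2 (\<lambda>x. a * T g x + b * T h x - Uop (?f k) x)) \<longlonglongrightarrow> 0"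
        by (simp add: algebra_simps Uop_lincomb[OF F[OF g] F[OF h]])
    qed
  next
    fix f :: "(real^'m) \<times> real \<Rightarrow> real" assume f: "f \<in> Ctilde0e"
    \<comment> \<open>The constant sequence f is admissible in \<open>key\<close>, whatever sequence
      F has chosen for f.\<close>
    have "(\<lambda>k. wnorm2 (\<lambda>x. T f x - Uop f x)) \<longlonglongrightarrow> 0"
      using key[OF Ctilde0e_L2ew[OF f], of "\<lambda>k. f"] f by (simp add: wnorm2_def)
    then have "wnorm2 (\<lambda>x. T f x - Uop f x) = 0"
      by (simp add: LIMSEQ_const_iff)
    then have "AE x in lborel. T f x - Uop f x = 0"
      using Tm[OF Ctilde0e_L2ew[OF f]] Um[OF f] by (intro wnorm2_eq_0) auto
    then show "AE x in lborel. T f x = Uop f x" by simp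
  qed
qed

text \<open>For any extension S, linearity and isometry make the squared distance from
  \<open>S g\<close> to \<open>Uop (F k)\<close> equal to that from g to \<open>F k\<close>. So
  \<open>S g\<close> is a limit of functions that do not depend on S.\<close>

lemma isometric_extension_unique:
  fixes g :: "(real^'m) \<times> real \<Rightarrow> real"
  assumes T: "isometric_extension_of_U T" and T': "isometric_extension_of_U T'" and g: "g \<in> L2ew"
  shows "AE x in lborel. T' g x = T g x"
proof -
  obtain F where F: "\<And>k. F k \<in> Ctilde0e" and FL: "\<And>k. wnorm2 (\<lambda>x. g x - F k x) \<le> ennreal (1 / 16 ^ k)"
    using approximable_seq[OF approximable_L2ew[OF g]] by blast
  have lim: "(\<lambda>k. wnorm2 (\<lambda>x. S g x - Uop (F k) x)) \<longlonglongrightarrow> 0" if S: "isometric_extension_of_U S" for S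
  proof -
    have "wnorm2 (\<lambda>x. S g x - Uop (F k) x) = wnorm2 (\<lambda>x. g x - F k x)" for k
    proof -
      have f: "F k \<in> L2ew" by (rule Ctilde0e_L2ew[OF F])
      have "AE x in lborel. S (\<lambda>y. 1 * g y + (- 1) * F k y) x = 1 * S g x + (- 1) * S (F k) x"
        using S g f unfolding isometric_extension_of_U_def by blast
      moreover have "AE x in lborel. S (F k) x = Uop (F k) x"
        using S F[of k] unfolding isometric_extension_of_U_def by blast
      ultimately have "AE x in lborel. S g x - Uop (F k) x = S (\<lambda>y. 1 * g y + (- 1) * F k y) x"
        by eventually_elim simp
      then have "wnorm2 (\<lambda>x. S g x - Uop (F k) x) = wnorm2 (S (\<lambda>y. 1 * g y + (- 1) * F k y))"
        by (rule wnorm2_cong_AE)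
      also have "\<dots> = wnorm2 (\<lambda>y. 1 * g y + (- 1) * F k y)"
        using S L2ew_lincomb[OF g f, of 1 "- 1"] unfolding isometric_extension_of_U_def by blast
      finally show ?thesis by simp
    qed
    then show ?thesis
      using tendsto_0_geometric[OF FL] by simp
  qed
  have S: "S g \<in> borel_measurable borel" if "isometric_extension_of_U S" for S
    using that g unfolding isometric_extension_of_U_def by (blast intro: L2ewD(1))
  show ?thesis
    by (rule wnorm2_limit_unique[OF S[OF T'] S[OF T] L2ewD(1)[OF Uop_L2ew[OF F]] lim[OF T'] lim[OF T]])
qed

theorem theorem1:
  assumes "odd CARD('m)"
  shows "(\<forall>f \<in> (Ctilde0e :: ((real^'m) \<times> real \<Rightarrow> real) set).
            (\<integral>\<^sup>+ x. ennreal ((f x)\<^sup>2 / \<bar>snd x\<bar>) \<partial>lborel)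
          = (\<integral>\<^sup>+ y. ennreal ((Uop f y)\<^sup>2 / \<bar>snd y\<bar>) \<partial>lborel))
       \<and> (\<exists>T :: ((real^'m) \<times> real \<Rightarrow> real) \<Rightarrow> ((real^'m) \<times> real \<Rightarrow> real).
            isometric_extension_of_U T
          \<and> (\<forall>T'. isometric_extension_of_U T' \<longrightarrow> (\<forall>g\<in>L2ew. AE x in lborel. T' g x = T g x)))"
proof (intro conjI ballI)
  fix f :: "(real^'m) \<times> real \<Rightarrow> real" assume f: "f \<in> Ctilde0e"
  show "(\<integral>\<^sup>+ x. ennreal ((f x)\<^sup>2 / \<bar>snd x\<bar>) \<partial>lborel)
          = (\<integral>\<^sup>+ y. ennreal ((Uop f y)\<^sup>2 / \<bar>snd y\<bar>) \<partial>lborel)"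
    by (rule wnorm2_Uop[OF f, unfolded wnorm2_def, symmetric])
next
  \<comment> \<open>The implication stands inside the existential quantifier so that a choice
    function can be taken over all functions g at once.\<close>
  have "\<forall>g :: (real^'m) \<times> real \<Rightarrow> real. \<exists>F. g \<in> L2ew \<longrightarrow> (\<forall>k. F k \<in> Ctilde0e \<and> wnorm2 (\<lambda>x. g x - F k x) \<le> ennreal (1 / 16 ^ k))"
    using approximable_seq[OF approximable_L2ew] by blast
  from choice[OF this] obtain F where F: "\<And>(g :: (real^'m) \<times> real \<Rightarrow> real) k. g \<in> L2ew \<Longrightarrow> F g k \<in> Ctilde0e"
    "\<And>(g :: (real^'m) \<times> real \<Rightarrow> real) k. g \<in> L2ew \<Longrightarrow> wnorm2 (\<lambda>x. g x - F g k x) \<le> ennreal (1 / 16 ^ k)"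
    by blast
  have T: "isometric_extension_of_U (\<lambda>(g :: (real^'m) \<times> real \<Rightarrow> real) z. lim (\<lambda>k. Uop (F g k) z))"
    by (rule isometric_extension_exists[OF F])
  show "\<exists>T :: ((real^'m) \<times> real \<Rightarrow> real) \<Rightarrow> ((real^'m) \<times> real \<Rightarrow> real).
            isometric_extension_of_U T
          \<and> (\<forall>T'. isometric_extension_of_U T' \<longrightarrow> (\<forall>g\<in>L2ew. AE x in lborel. T' g x = T g x))"
    using isometric_extension_unique[OF T] T by blast
qed

end
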